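(* Let $A$ be a $2\times2$ integer matrix with $\det A=\pm1$ and no eigenvalue on the unit circle, with eigenvalues of absolute values $\lambda,\lambda^{-1}$, $\lambda>1$; let $f_A:\mathbb T^2\to\mathbb T^2$, $f_A(x)=Ax$ mod $1$, and let $k_0\in\mathbb Z^2\setminus\{0\}$. There exist $C,C'\ge1$ such that the following holds for all $L>1$ and $\epsilon,\kappa>0$ small. Let $f:\mathbb T^2\to\mathbb T^2$ be a $C^\infty$ volume-preserving diffeomorphism with $d_{C^\infty}(f,f_A)\le\epsilon$, and let $g_{f,\kappa}$ be the statistically stationary scalar with source $b=e_{k_0}$. Define $$\ell_{\rm crit}=\frac{C}{\log L}\Big(|\log\max\{\epsilon,\kappa\}|-C'\Big).$$ Then, for all integers $0\le\ell\le\ell_{\rm crit}$, $$\mathbb E\big\|\Pi_{[L^\ell,L^{\ell+1}]}\,g_{f,\kappa}\big\|^2=\frac{\log L}{\log\lambda}+O(1),$$ where $O(1)$ is an error term bounded by a constant independent of $L$ and $\ell$ (and of $\kappa$ and $\epsilon$).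
   Context: $\|\cdot\|$ is the $L^2$ norm on $\mathbb T^2=\mathbb R^2/\mathbb Z^2$; $e_k(x)=e^{2\pi ik\cdot x}$. $\Pi_{[a,b]}$ is the orthogonal projection onto Fourier modes $k\in\mathbb Z^2$ with $a\le|k|\le b$. $\mathcal L_f[\varphi]=\varphi\circ f^{-1}$; $e^{t\Delta}$ is the heat semigroup on $\mathbb T^2$, and $\mathcal L_{f,\kappa}=e^{\kappa\Delta}\circ\mathcal L_f$. The statistically stationary scalar is $g_{f,\kappa}=\sum_{n=0}^\infty\eta_n\mathcal L_{f,\kappa}^nb$ with $b=e_{k_0}$ and $(\eta_n)$ IID square-integrable real random variables with mean $0$ and variance $1$; its law is the unique stationary measure, on mean-zero $L^2$ functions, of the Markov chain $g_{n+1}=\mathcal L_{f,\kappa}g_n+\omega_{n+1}b$ with $(\omega_n)$ IID of the same law as $\eta_n$. $\mathbb E$ is expectation over the $\eta_n$. $d_{C^\infty}(f,g)=\sum_{k\ge0}2^{-k}\frac{d_{C^k}(f,g)}{1+d_{C^k}(f,g)}$, where $d_{C^0}$ is the uniform distance and $d_{C^k}(f,g)=\max\{d_{C^{k-1}}(f,g),\sup_x\|D^kf(x)-D^kg(x)\|\}$.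
   Formalization: The constant C is only required to be positive rather than at least 1, since for C ≥ 1 the estimate fails already for f = f_A with ε = κ (scales beyond κ^{-1/2} carry no energy); "ε, κ small" is read with thresholds that may depend on L. *)

theory Defs
  imports "HOL-Probability.Probability"
begin

definition of_int_vec :: "int^'n \<Rightarrow> real^'n" where
  "of_int_vec k = (\<chi> i. of_int (k $ i))"

lemma of_int_vec_add: "of_int_vec (k + l) = of_int_vec k + of_int_vec l"
  by (simp add: of_int_vec_def vec_eq_iff)

lemma of_int_vec_minus: "of_int_vec (- k) = - of_int_vec k"
  by (simp add: of_int_vec_def vec_eq_iff)

lemma of_int_vec_0: "of_int_vec 0 = 0"
  by (simp add: of_int_vec_def vec_eq_iff)

lemma of_int_mat_mult_vec: "map_matrix of_int A *v of_int_vec k = of_int_vec (A *v k)"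
  by (simp add: of_int_vec_def matrix_vector_mult_def vec_eq_iff)

definition matrix_eigenvalue :: "complex^'n^'n \<Rightarrow> complex \<Rightarrow> bool" where
  "matrix_eigenvalue A \<mu> \<longleftrightarrow> (\<exists>v. v \<noteq> 0 \<and> A *v v = \<mu> *s v)"

definition lattice_equiv :: "real^2 \<Rightarrow> real^2 \<Rightarrow> bool" where
  "lattice_equiv x y \<longleftrightarrow> (\<exists>m. x = y + of_int_vec m)"

lemma equivp_lattice_equiv: "equivp lattice_equiv"
proof (rule equivpI)
  show "reflp lattice_equiv"
    unfolding lattice_equiv_def by (intro reflpI exI[of _ 0]) (simp add: of_int_vec_0)
  show "symp lattice_equiv"
    unfolding lattice_equiv_def
    by (rule sympI, elim exE, rule_tac x = "- m" in exI) (simp add: of_int_vec_minus)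
  show "transp lattice_equiv"
    unfolding lattice_equiv_def
    by (rule transpI, elim exE, rule_tac x = "ma + m" in exI) (simp add: of_int_vec_add algebra_simps)
qed

quotient_type torus = "real^2" / lattice_equiv
  morphisms rep_torus proj_torus
  by (rule equivp_lattice_equiv)

lemma proj_torus_eq_iff: "proj_torus x = proj_torus y \<longleftrightarrow> lattice_equiv x y"
  by (simp add: torus.abs_eq_iff)

lemma proj_rep_torus: "proj_torus (rep_torus x) = x"
  by (rule Quotient_abs_rep[OF Quotient_torus])

instantiation torus :: metric_space
begin

definition dist_torus :: "torus \<Rightarrow> torus \<Rightarrow> real" where
  "dist_torus x y = (INF m. norm (rep_torus x - rep_torus y + of_int_vec m))"

definition uniformity_torus :: "(torus \<times> torus) filter" where
  "uniformity_torus = (INF e\<in>{0<..}. principal {(x, y). dist x y < e})"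

definition open_torus :: "torus set \<Rightarrow> bool" where
  "open_torus U \<longleftrightarrow>
     (\<forall>x\<in>U. eventually (\<lambda>(x', y). x' = x \<longrightarrow> y \<in> U) uniformity)"

instance
proof
  have bdd: "bdd_below (range (\<lambda>m. norm (a + of_int_vec m)))" for a :: "real^2"
    by (rule bdd_belowI[where m=0]) auto
  fix x y z :: torus
  show "dist x y = 0 \<longleftrightarrow> x = y"
  proof
    assume "x = y"
    have "dist x x \<le> norm (rep_torus x - rep_torus x + of_int_vec 0)"
      unfolding dist_torus_def by (rule cINF_lower[OF bdd]) simp
    moreover have "0 \<le> dist x x"
      unfolding dist_torus_def by (rule cINF_greatest) auto
    ultimately show "dist x y = 0"
      using \<open>x = y\<close> by (simp add: of_int_vec_0)
  next
    assume "dist x y = 0"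
    define a where "a = rep_torus x - rep_torus y"
    have ex: "\<exists>m. norm (a + of_int_vec m) < e" if "e > 0" for e
    proof (rule ccontr)
      assume "\<nexists>m. norm (a + of_int_vec m) < e"
      then have "e \<le> dist x y"
        unfolding dist_torus_def a_def[symmetric] by (intro cINF_greatest) (auto simp: not_less)
      then show False using \<open>dist x y = 0\<close> that by simp
    qed
    obtain m where m: "norm (a + of_int_vec m) < 1/2"
      using ex[of "1/2"] by auto
    have "a + of_int_vec m = 0"
    proof (rule ccontr)
      assume "a + of_int_vec m \<noteq> 0"
      then obtain n where n: "norm (a + of_int_vec n) < norm (a + of_int_vec m)"
        using ex[of "norm (a + of_int_vec m)"] by auto
      have "m $ i = n $ i" for i
      proof -
        have "\<bar>(a + of_int_vec m) $ i\<bar> < 1/2" "\<bar>(a + of_int_vec n) $ i\<bar> < 1/2"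
          using component_le_norm_cart[of "a + of_int_vec m" i]
            component_le_norm_cart[of "a + of_int_vec n" i] m n by linarith+
        then have "\<bar>a $ i + of_int (m $ i)\<bar> < 1/2" "\<bar>a $ i + of_int (n $ i)\<bar> < 1/2"
          by (simp_all add: of_int_vec_def)
        then have "\<bar>of_int (m $ i) - of_int (n $ i) :: real\<bar> < 1" by linarith
        then show ?thesis by linarith
      qed
      then have "m = n" by (simp add: vec_eq_iff)
      then show False using n by simp
    qed
    then have "rep_torus y = rep_torus x + of_int_vec m"
      by (simp add: a_def algebra_simps)
    then have "lattice_equiv (rep_torus y) (rep_torus x)"
      unfolding lattice_equiv_def by blast
    then have "proj_torus (rep_torus y) = proj_torus (rep_torus x)"
      by (simp add: proj_torus_eq_iff)
    then show "x = y" by (simp add: proj_rep_torus)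
  qed
  show "dist x y \<le> dist x z + dist y z"
  proof (rule field_le_epsilon)
    fix e :: real assume "0 < e"
    have ex: "\<exists>m. norm (rep_torus u - rep_torus v + of_int_vec m) < dist u v + e/2" for u v
    proof (rule ccontr)
      assume "\<nexists>m. norm (rep_torus u - rep_torus v + of_int_vec m) < dist u v + e/2"
      then have "dist u v + e/2 \<le> dist u v"
        by (subst (2) dist_torus_def, intro cINF_greatest) (auto simp: not_less)
      then show False using \<open>0 < e\<close> by simp
    qed
    obtain m where m: "norm (rep_torus x - rep_torus z + of_int_vec m) < dist x z + e/2"
      using ex by blast
    obtain n where n: "norm (rep_torus y - rep_torus z + of_int_vec n) < dist y z + e/2"
      using ex by blast
    have "dist x y \<le> norm (rep_torus x - rep_torus y + of_int_vec (m + - n))"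
      unfolding dist_torus_def by (rule cINF_lower[OF bdd]) simp
    also have "\<dots> = norm ((rep_torus x - rep_torus z + of_int_vec m)
                        - (rep_torus y - rep_torus z + of_int_vec n))"
      by (rule arg_cong[of _ _ norm]) (simp add: of_int_vec_add of_int_vec_minus algebra_simps del: add_uminus_conv_diff)
    also have "\<dots> \<le> norm (rep_torus x - rep_torus z + of_int_vec m)
                   + norm (rep_torus y - rep_torus z + of_int_vec n)"
      by (rule norm_triangle_ineq4)
    finally show "dist x y \<le> dist x z + dist y z + e" using m n by simp
  qed
qed (rule uniformity_torus_def open_torus_def)+

end

definition haar_torus :: "torus measure" where
  "haar_torus = distr (restrict_space lborel {x. \<forall>i. 0 \<le> x $ i \<and> x $ i < 1}) borel proj_torus"

lift_definition torus_map_of_matrix :: "int^2^2 \<Rightarrow> torus \<Rightarrow> torus" is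
  "\<lambda>A x. map_matrix of_int A *v x"
  by (auto simp: lattice_equiv_def matrix_vector_right_distrib of_int_mat_mult_vec)

text \<open>\<open>iter_deriv [v\<^sub>1, \<dots>, v\<^sub>k] F x\<close> is the \<open>k\<close>-linear map \<open>D\<^sup>kF(x)\<close> evaluated at
  \<open>(v\<^sub>1, \<dots>, v\<^sub>k)\<close>.\<close>

fun iter_deriv :: "'a list \<Rightarrow> ('a::real_normed_vector \<Rightarrow> 'b::real_normed_vector) \<Rightarrow> 'a \<Rightarrow> 'b" where
  "iter_deriv [] F = F"
| "iter_deriv (v # vs) F = (\<lambda>x. frechet_derivative (iter_deriv vs F) (at x) v)"

definition C_infinity :: "('a::real_normed_vector \<Rightarrow> 'b::real_normed_vector) \<Rightarrow> bool" where
  "C_infinity F \<longleftrightarrow> (\<forall>vs x. iter_deriv vs F differentiable (at x))"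

definition is_smooth_lift :: "(real^2 \<Rightarrow> real^2) \<Rightarrow> (torus \<Rightarrow> torus) \<Rightarrow> bool" where
  "is_smooth_lift F f \<longleftrightarrow> C_infinity F \<and> (\<forall>x. f (proj_torus x) = proj_torus (F x))"

definition smooth_torus_map :: "(torus \<Rightarrow> torus) \<Rightarrow> bool" where
  "smooth_torus_map f \<longleftrightarrow> (\<exists>F. is_smooth_lift F f)"

definition smooth_torus_diffeo :: "(torus \<Rightarrow> torus) \<Rightarrow> bool" where
  "smooth_torus_diffeo f \<longleftrightarrow> bij f \<and> smooth_torus_map f \<and> smooth_torus_map (inv f)"

definition volume_preserving :: "(torus \<Rightarrow> torus) \<Rightarrow> bool" where
  "volume_preserving f \<longleftrightarrow>
     f \<in> measurable haar_torus haar_torus \<and> distr haar_torus haar_torus f = haar_torus"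

text \<open>Two lifts of \<open>f\<close> differ by a constant lattice vector, so the derivatives of order
  \<open>k \<ge> 1\<close> of the chosen lift depend on \<open>f\<close> only.\<close>

definition smooth_lift :: "(torus \<Rightarrow> torus) \<Rightarrow> real^2 \<Rightarrow> real^2" where
  "smooth_lift f = (SOME F. is_smooth_lift F f)"

text \<open>The operator norm \<open>\<parallel>D\<^sup>kF(x) - D\<^sup>kG(x)\<parallel>\<close> of a difference of \<open>k\<close>-linear maps.\<close>

definition norm_deriv_diff ::
  "nat \<Rightarrow> ('a::real_normed_vector \<Rightarrow> 'b::real_normed_vector) \<Rightarrow> ('a \<Rightarrow> 'b) \<Rightarrow> 'a \<Rightarrow> real" where
  "norm_deriv_diff k F G x =
     (SUP vs\<in>{vs. length vs = k \<and> (\<forall>v\<in>set vs. norm v \<le> 1)}.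
        norm (iter_deriv vs F x - iter_deriv vs G x))"

primrec dist_Ck :: "nat \<Rightarrow> (torus \<Rightarrow> torus) \<Rightarrow> (torus \<Rightarrow> torus) \<Rightarrow> real" where
  "dist_Ck 0 f g = (SUP x. dist (f x) (g x))"
| "dist_Ck (Suc k) f g =
     max (dist_Ck k f g)
         (SUP x. norm_deriv_diff (Suc k) (smooth_lift f) (smooth_lift g) x)"

definition dist_Cinfinity :: "(torus \<Rightarrow> torus) \<Rightarrow> (torus \<Rightarrow> torus) \<Rightarrow> real" where
  "dist_Cinfinity f g = (\<Sum>k. (1/2) ^ k * (dist_Ck k f g / (1 + dist_Ck k f g)))"

lemma cis_lattice_invariant:
  "cis (2 * pi * (of_int_vec k \<bullet> (y + of_int_vec m))) = cis (2 * pi * (of_int_vec k \<bullet> y))"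
proof -
  have "of_int_vec k \<bullet> of_int_vec m = of_int (\<Sum>i\<in>UNIV. k $ i * m $ i)"
    by (simp add: inner_vec_def of_int_vec_def)
  then have "2 * pi * (of_int_vec k \<bullet> (y + of_int_vec m))
      = 2 * pi * (of_int_vec k \<bullet> y) + 2 * pi * of_int (\<Sum>i\<in>UNIV. k $ i * m $ i)"
    by (simp add: inner_add_right distrib_left)
  moreover have "cis (2 * pi * of_int j) = 1" for j
    by (rule cis_multiple_2pi) simp
  ultimately show ?thesis
    by (simp only: cis_mult[symmetric] mult_1_right)
qed

lift_definition fourier_mode :: "int^2 \<Rightarrow> torus \<Rightarrow> complex" is
  "\<lambda>k x. cis (2 * pi * (of_int_vec k \<bullet> x))"
  by (auto simp: lattice_equiv_def cis_lattice_invariant)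

definition fourier_coeff :: "(torus \<Rightarrow> complex) \<Rightarrow> int^2 \<Rightarrow> complex" where
  "fourier_coeff \<phi> k = (\<integral>x. \<phi> x * cnj (fourier_mode k x) \<partial>haar_torus)"

definition L2_norm_torus :: "(torus \<Rightarrow> complex) \<Rightarrow> real" where
  "L2_norm_torus \<phi> = sqrt (\<integral>x. (cmod (\<phi> x))\<^sup>2 \<partial>haar_torus)"

definition fourier_proj :: "real \<Rightarrow> real \<Rightarrow> (torus \<Rightarrow> complex) \<Rightarrow> torus \<Rightarrow> complex" where
  "fourier_proj a b \<phi> = (\<lambda>x.
     \<Sum>k | a \<le> norm (of_int_vec k) \<and> norm (of_int_vec k) \<le> b.
       fourier_coeff \<phi> k * fourier_mode k x)"

text \<open>\<open>e\<^bsup>t\<Delta>\<^esup>\<close> multiplies the \<open>k\<close>-th mode by \<open>exp (- 4 \<pi>\<^sup>2 t |k|\<^sup>2)\<close>. For \<open>t > 0\<close> the series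
  converges absolutely and uniformly and defines a smooth representative.\<close>

definition heat_semigroup :: "real \<Rightarrow> (torus \<Rightarrow> complex) \<Rightarrow> torus \<Rightarrow> complex" where
  "heat_semigroup t \<phi> = (\<lambda>x.
     \<Sum>\<^sub>\<infinity>k. of_real (exp (- 4 * pi\<^sup>2 * t * (norm (of_int_vec k))\<^sup>2))
            * fourier_coeff \<phi> k * fourier_mode k x)"

definition transfer_op :: "(torus \<Rightarrow> torus) \<Rightarrow> (torus \<Rightarrow> complex) \<Rightarrow> torus \<Rightarrow> complex" where
  "transfer_op f \<phi> = \<phi> \<circ> inv f"

definition diffusive_transfer_op ::
  "(torus \<Rightarrow> torus) \<Rightarrow> real \<Rightarrow> (torus \<Rightarrow> complex) \<Rightarrow> torus \<Rightarrow> complex" where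
  "diffusive_transfer_op f \<kappa> = heat_semigroup \<kappa> \<circ> transfer_op f"

text \<open>For volume-preserving \<open>f\<close>, \<open>\<kappa> > 0\<close> and mean-zero \<open>b\<close> the functions
  \<open>(diffusive_transfer_op f \<kappa> ^^ n) b\<close> decay geometrically in the uniform norm, so almost surely
  the series below converges absolutely at every point, uniformly, and hence to its sum in
  \<open>L\<^sup>2\<close>.\<close>

definition stationary_scalar ::
  "(torus \<Rightarrow> torus) \<Rightarrow> real \<Rightarrow> (torus \<Rightarrow> complex) \<Rightarrow> (nat \<Rightarrow> 'w \<Rightarrow> real) \<Rightarrow> 'w \<Rightarrow> torus \<Rightarrow> complex"
  where
  "stationary_scalar f \<kappa> b \<eta> \<omega> = (\<lambda>x.
     \<Sum>n. of_real (\<eta> n \<omega>) * (diffusive_transfer_op f \<kappa> ^^ n) b x)"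

definition normalized_iid :: "'w measure \<Rightarrow> (nat \<Rightarrow> 'w \<Rightarrow> real) \<Rightarrow> bool" where
  "normalized_iid M \<eta> \<longleftrightarrow>
     prob_space M \<and>
     prob_space.indep_vars M (\<lambda>_. borel) \<eta> UNIV \<and>
     (\<forall>n. distr M borel (\<eta> n) = distr M borel (\<eta> 0)) \<and>
     (\<forall>n. integrable M (\<lambda>\<omega>. (\<eta> n \<omega>)\<^sup>2) \<and>
          prob_space.expectation M (\<eta> n) = 0 \<and>
          prob_space.variance M (\<eta> n) = 1)"

text \<open>The constant \<open>C\<close> has to be allowed to be smaller than \<open>1\<close>: for \<open>\<epsilon> \<le> \<kappa>\<close> the wavenumbers up to
  \<open>L powr ell_crit\<close>, which is comparable to \<open>\<kappa> powr (- C)\<close>, must stay below the dissipative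
  wavenumber \<open>\<kappa> powr (- 1/2)\<close>, beyond which the scalar carries no energy.\<close>

definition ell_crit :: "real \<Rightarrow> real \<Rightarrow> real \<Rightarrow> real \<Rightarrow> real \<Rightarrow> real" where
  "ell_crit C C' L \<epsilon> \<kappa> = C / ln L * (\<bar>ln (max \<epsilon> \<kappa>)\<bar> - C')"

end

theory Submission
  imports Defs
begin

text \<open>For \<open>f = f\<^sub>A\<close> and \<open>\<kappa> = 0\<close> the iterates of \<open>e\<^bsub>k\<^sub>0\<^esub>\<close> are single modes \<open>e\<^bsub>k\<^sub>n\<^esub>\<close> with
  \<open>k\<^sub>n = A\<^bsup>-Tn\<^esup> k\<^sub>0\<close>, and \<open>\<bar>k\<^sub>n\<bar>\<close> is comparable to \<open>\<lambda>\<^sup>n\<close>, so a window \<open>[L\<^sup>l, L\<^bsup>l+1\<^esup>]\<close> contains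
  \<open>ln L / ln \<lambda> + O(1)\<close> of them. By orthogonality of the noise the expected energy is
  \<open>\<Sum>n. \<parallel>\<Pi> \<L>\<^sup>n b\<parallel>\<^sup>2\<close>. Put \<open>\<delta> = max \<epsilon> \<kappa>\<close>. For \<open>\<lambda>\<^sup>n \<le> \<delta>\<^bsup>-1/2\<^esup>\<close> the \<open>n\<close>-th iterate differs
  from \<open>e\<^bsub>k\<^sub>n\<^esub>\<close> by \<open>O(\<delta> \<lambda>\<^bsup>2n\<^esup>)\<close> in \<open>L\<^sup>2\<close>, and these errors sum to \<open>O(1)\<close>.

  The remaining iterates are controlled by exponential mixing, uniformly in \<open>f\<close> and \<open>\<kappa>\<close>. Give a
  frequency \<open>j\<close> the weight \<open>\<rho>\<close> to the power \<open>level j\<close>, a small positive power of the frequency in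
  the cone contracted by \<open>A\<^bsup>-T\<^esup>\<close> and a small negative one in the complementary cone. If \<open>k\<close> is
  within a small multiple of \<open>\<bar>j\<bar>\<close> of \<open>A\<^sup>T j\<close>, then \<open>level k \<ge> level j + 1\<close>; for the other pairs
  the matrix entry \<open>\<langle>e\<^sub>k \<circ> f\<^sup>-\<^sup>1, e\<^sub>j\<rangle>\<close> is \<open>O(\<epsilon> \<bar>k - A\<^sup>T j\<bar>\<^sup>-\<^sup>3)\<close> by non-stationary phase. Slicing
  along the level sets of the weight and using that the matrix is an \<open>\<ell>\<^sup>2\<close> contraction on each
  slice shows that the weighted \<open>\<ell>\<^sup>2\<close> norm contracts by a fixed factor; the heat semigroup only
  decreases it.\<close>

section \<open>Contraction of weighted \<open>\<ell>\<^sup>2\<close> norms\<close>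

text \<open>The comparison with single modes stops at \<lambda>^n ~ \<delta>^(-1/2), while the
  series has infinitely many later terms. The transfer operator is an isometry of
  \<open>L\<^sup>2\<close> and heat damping alone sums the tail only at a rate depending on
  \<kappa>, so nothing decays uniformly in the plain norm; the weight is there to make decay
  visible. Entries leading from \<open>j\<close> to a frequency \<open>k\<close> of higher level are
  never estimated: the \<open>\<ell>\<^sup>2\<close> contraction together with the shift by one
  level yields the factor \<rho>^(-2). Only entries with \<open>level k \<le> level j\<close> must
  be small, and for these the mismatch p = k - A^T j dominates both |j| and |k|. The exponents are
  balanced there: the weight and its inverse grow at most like |j|^(1/4), so a quotient of weights
  costs |p|^(1/2); three integrations by parts gain |p|^(-3); and |p|^(-5/2) is summable over the
  planar lattice. Removing the weight on the window costs the factor L^((l+1)/2) in energy. The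
  geometric tail has to beat it, which is one of the two constraints on \<open>C\<close>; the other
  keeps the window inside the range of the comparison.\<close>

lemma schur_test_finite:
  fixes S :: "'j \<Rightarrow> 'k \<Rightarrow> real" and x :: "'k \<Rightarrow> real"
  assumes fin: "finite J" "finite K"
    and S: "\<And>j k. S j k \<ge> 0"
    and row: "\<And>j. j \<in> J \<Longrightarrow> (\<Sum>k\<in>K. S j k) \<le> \<sigma>"
    and col: "\<And>k. k \<in> K \<Longrightarrow> (\<Sum>j\<in>J. S j k) \<le> \<sigma>"
    and \<sigma>: "\<sigma> \<ge> 0"
  shows "(\<Sum>j\<in>J. (\<Sum>k\<in>K. S j k * x k)\<^sup>2) \<le> \<sigma>\<^sup>2 * (\<Sum>k\<in>K. (x k)\<^sup>2)"
proof -
  have one: "(\<Sum>k\<in>K. S j k * x k)\<^sup>2 \<le> \<sigma> * (\<Sum>k\<in>K. S j k * (x k)\<^sup>2)" if "j \<in> J" for j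
  proof -
    \<comment> \<open>Schur test: in Cauchy-Schwarz one factor \<open>sqrt (S j k)\<close> pays for
      the row sum, the other stays with \<open>x k\<close> and later meets the column sum.\<close>
    have "(\<Sum>k\<in>K. S j k * x k) = (\<Sum>k\<in>K. sqrt (S j k) * (sqrt (S j k) * x k))"
      using S by (intro sum.cong) (auto simp: mult.assoc[symmetric])
    then have "(\<Sum>k\<in>K. S j k * x k)\<^sup>2 \<le> (\<Sum>k\<in>K. (sqrt (S j k))\<^sup>2) * (\<Sum>k\<in>K. (sqrt (S j k) * x k)\<^sup>2)"
      using Cauchy_Schwarz_ineq_sum by metis
    also have "\<dots> = (\<Sum>k\<in>K. S j k) * (\<Sum>k\<in>K. S j k * (x k)\<^sup>2)"
      using S by (simp add: power_mult_distrib)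
    also have "\<dots> \<le> \<sigma> * (\<Sum>k\<in>K. S j k * (x k)\<^sup>2)"
      using row[OF that] S by (intro mult_right_mono sum_nonneg) auto
    finally show ?thesis .
  qed
  have "(\<Sum>j\<in>J. (\<Sum>k\<in>K. S j k * x k)\<^sup>2) \<le> (\<Sum>j\<in>J. \<sigma> * (\<Sum>k\<in>K. S j k * (x k)\<^sup>2))"
    by (intro sum_mono one)
  also have "\<dots> = \<sigma> * (\<Sum>k\<in>K. (\<Sum>j\<in>J. S j k) * (x k)\<^sup>2)"
    unfolding sum_distrib_left[symmetric] sum_distrib_right by (subst sum.swap) simp
  also have "\<dots> \<le> \<sigma> * (\<Sum>k\<in>K. \<sigma> * (x k)\<^sup>2)"
    using col \<sigma> by (intro mult_left_mono sum_mono mult_right_mono) auto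
  finally show ?thesis by (simp add: sum_distrib_left power2_eq_square mult.assoc)
qed

text \<open>Young's inequality. The free \<open>d\<close> keeps the first coefficient as close to 1
  as needed, since the first square later gains only the fixed factor
  \<open>1 / \<rho>\<^sup>2\<close>.\<close>

lemma power2_add_le_weighted:
  fixes x y d :: real
  assumes "d > 0"
  shows "(x + y)\<^sup>2 \<le> (1 + d) * x\<^sup>2 + (1 + 1 / d) * y\<^sup>2"
proof -
  have "0 \<le> (d * x - y)\<^sup>2 / d" using assms by simp
  also have "\<dots> = d * x\<^sup>2 - 2 * x * y + y\<^sup>2 / d"
    using assms by (simp add: field_simps power2_eq_square)
  finally show ?thesis by (simp add: power2_eq_square algebra_simps)
qed

text \<open>Entries with \<open>n k > n j\<close> carry no size bound and are handled by
  \<open>contr\<close> alone. The squared weight at \<open>j\<close> is a sum of increments over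
  thresholds \<open>m \<le> n j\<close>; for each threshold only indices \<open>k\<close> strictly
  above it are kept, so the weight handed back to \<open>k\<close> ends one level below
  \<open>n k\<close>. The other entries form a small matrix after conjugation by the weight, with
  Schur bounds \<open>row\<close> and \<open>col\<close>. Each threshold cuts out a different subset
  of \<open>K\<close>, which is why \<open>contr\<close> speaks of all subsets.\<close>

lemma weighted_contraction:
  fixes M :: "'j \<Rightarrow> 'j \<Rightarrow> complex" and n :: "'j \<Rightarrow> int" and \<rho> \<sigma> d :: real
  assumes fin: "finite J" "finite K" and \<rho>: "\<rho> > 1" and d: "d > 0" and \<sigma>: "\<sigma> \<ge> 0"
    and contr: "\<And>L c. L \<subseteq> K \<Longrightarrow> (\<Sum>j\<in>J. (cmod (\<Sum>k\<in>L. M j k * c k))\<^sup>2) \<le> (\<Sum>k\<in>L. (cmod (c k))\<^sup>2)"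
    and row: "\<And>j. j \<in> J \<Longrightarrow> (\<Sum>k | k \<in> K \<and> n k \<le> n j. \<rho> powi (n j - n k) * cmod (M j k)) \<le> \<sigma>"
    and col: "\<And>k. k \<in> K \<Longrightarrow> (\<Sum>j | j \<in> J \<and> n k \<le> n j. \<rho> powi (n j - n k) * cmod (M j k)) \<le> \<sigma>"
  shows "(\<Sum>j\<in>J. (\<rho> powi n j * cmod (\<Sum>k\<in>K. M j k * a k))\<^sup>2)
      \<le> ((1 + d) / \<rho>\<^sup>2 + (1 + 1 / d) * \<sigma>\<^sup>2) * (\<Sum>k\<in>K. (\<rho> powi n k * cmod (a k))\<^sup>2)"
proof (cases "J = {}")
  case True
  then show ?thesis using d by (simp add: sum_nonneg)
next
  case False
  define R where "R = \<rho>\<^sup>2"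
  have R: "R > 1" unfolding R_def using \<rho> by (simp add: power2_eq_square less_1_mult)
  have sq: "(\<rho> powi m)\<^sup>2 = R powi m" for m
    unfolding R_def by (simp add: power_int_mult_distrib power2_eq_square)
  define m0 m1 where "m0 = Min (n ` J)" and "m1 = Max (n ` J)"
  have m0: "m0 \<le> n j" and m1: "n j \<le> m1" if "j \<in> J" for j
    unfolding m0_def m1_def using fin that by auto
  \<comment> \<open>Abel summation: \<open>R powi n j\<close> is the sum of the increments \<open>c m\<close> over \<open>m0 \<le> m \<le> n j\<close>.\<close>
  define c where "c = (\<lambda>m. if m = m0 then R powi m0 else R powi m - R powi (m - 1))"
  have c0: "c m \<ge> 0" for m
    unfolding c_def using R by (auto intro!: power_int_increasing)
  have tel: "(\<Sum>m\<in>{m0..q}. c m) = R powi q" if "m0 \<le> q" for q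
    using that
  proof (induction q rule: int_ge_induct)
    case base
    then show ?case by (simp add: c_def)
  next
    case (step i)
    have "{m0..i+1} = insert (i+1) {m0..i}" using step by auto
    then show ?case using step by (simp add: c_def)
  qed
  define t where "t = (\<lambda>j. \<Sum>k | k \<in> K \<and> n k \<le> n j. cmod (M j k) * cmod (a k))"
  define b where "b = (\<lambda>j. \<Sum>k\<in>K. M j k * a k)"
  define x where "x = (\<lambda>m j. \<Sum>k | k \<in> K \<and> m + 1 \<le> n k. M j k * a k)"
  \<comment> \<open>The low part cut off at \<open>m\<close> is dominated by \<open>t j\<close>,
    which does not depend on \<open>m\<close>; the increments multiplying it can therefore be summed
    back to the full weight.\<close>
  have split: "(cmod (b j))\<^sup>2 \<le> (1 + d) * (cmod (x m j))\<^sup>2 + (1 + 1 / d) * (t j)\<^sup>2"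
    if "m \<le> n j" for m j
  proof -
    have Ks: "K = {k \<in> K. m + 1 \<le> n k} \<union> {k \<in> K. n k \<le> m}" by auto
    have "b j = x m j + (\<Sum>k | k \<in> K \<and> n k \<le> m. M j k * a k)"
      unfolding b_def x_def by (subst Ks, subst sum.union_disjoint) (use fin in auto)
    then have "cmod (b j) \<le> cmod (x m j) + cmod (\<Sum>k | k \<in> K \<and> n k \<le> m. M j k * a k)"
      by (simp add: norm_triangle_ineq)
    also have "cmod (\<Sum>k | k \<in> K \<and> n k \<le> m. M j k * a k) \<le> (\<Sum>k | k \<in> K \<and> n k \<le> m. cmod (M j k) * cmod (a k))"
      by (rule sum_norm_le) (simp add: norm_mult)
    also have "\<dots> \<le> t j"
      unfolding t_def using that fin by (intro sum_mono2) auto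
    finally have "(cmod (b j))\<^sup>2 \<le> (cmod (x m j) + t j)\<^sup>2"
      by (intro power_mono) auto
    also have "\<dots> \<le> (1 + d) * (cmod (x m j))\<^sup>2 + (1 + 1 / d) * (t j)\<^sup>2"
      by (rule power2_add_le_weighted[OF d])
    finally show ?thesis .
  qed
  \<comment> \<open>After exchanging the sums, \<open>k\<close> collects the increments up to
    \<open>n k - 1\<close>, and these telescope to at most \<open>R powi (n k - 1)\<close>. This
    shift is the whole gain \<open>1 / R\<close>.\<close>
  have first: "(\<Sum>j\<in>J. \<Sum>m\<in>{m0..n j}. c m * (cmod (x m j))\<^sup>2)
      \<le> (\<Sum>k\<in>K. (\<rho> powi n k * cmod (a k))\<^sup>2) / R"
  proof -
    have "(\<Sum>j\<in>J. \<Sum>m\<in>{m0..n j}. c m * (cmod (x m j))\<^sup>2)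
        \<le> (\<Sum>j\<in>J. \<Sum>m\<in>{m0..m1}. c m * (cmod (x m j))\<^sup>2)"
      using c0 m1 by (intro sum_mono sum_mono2) force+
    also have "\<dots> = (\<Sum>m\<in>{m0..m1}. c m * (\<Sum>j\<in>J. (cmod (x m j))\<^sup>2))"
      by (subst sum.swap) (simp add: sum_distrib_left)
    also have "\<dots> \<le> (\<Sum>m\<in>{m0..m1}. c m * (\<Sum>k | k \<in> K \<and> m + 1 \<le> n k. (cmod (a k))\<^sup>2))"
      unfolding x_def using c0 by (intro sum_mono mult_left_mono contr) auto
    also have "\<dots> = (\<Sum>m\<in>{m0..m1}. \<Sum>k\<in>K. if m + 1 \<le> n k then c m * (cmod (a k))\<^sup>2 else 0)"
      using fin by (intro sum.cong refl) (simp add: sum.inter_filter[symmetric] sum_distrib_left)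
    also have "\<dots> = (\<Sum>k\<in>K. \<Sum>m\<in>{m0..m1}. if m + 1 \<le> n k then c m * (cmod (a k))\<^sup>2 else 0)"
      by (rule sum.swap)
    also have "\<dots> \<le> (\<Sum>k\<in>K. (\<rho> powi n k * cmod (a k))\<^sup>2 / R)"
    proof (rule sum_mono)
      fix k
      have "(\<Sum>m\<in>{m0..m1}. if m + 1 \<le> n k then c m * (cmod (a k))\<^sup>2 else 0)
         = (\<Sum>m | m \<in> {m0..m1} \<and> m + 1 \<le> n k. c m) * (cmod (a k))\<^sup>2"
        by (simp add: sum.inter_filter[symmetric] sum_distrib_right)
      also have "(\<Sum>m | m \<in> {m0..m1} \<and> m + 1 \<le> n k. c m) \<le> R powi (n k - 1)"
      proof (cases "m0 \<le> n k - 1")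
        case True
        have "(\<Sum>m | m \<in> {m0..m1} \<and> m + 1 \<le> n k. c m) \<le> (\<Sum>m\<in>{m0..n k - 1}. c m)"
          using c0 by (intro sum_mono2) auto
        then show ?thesis using tel[OF True] by simp
      next
        case False
        then have empty: "{m. m \<in> {m0..m1} \<and> m + 1 \<le> n k} = {}" by auto
        show ?thesis unfolding empty using R by simp
      qed
      also have "R powi (n k - 1) = R powi n k / R"
        using R by (simp add: power_int_diff)
      finally show "(\<Sum>m\<in>{m0..m1}. if m + 1 \<le> n k then c m * (cmod (a k))\<^sup>2 else 0)
          \<le> (\<rho> powi n k * cmod (a k))\<^sup>2 / R"
        by (simp add: power_mult_distrib sq mult_right_mono)
    qed
    finally show ?thesis by (simp add: sum_divide_distrib)
  qed
  have second: "(\<Sum>j\<in>J. (\<rho> powi n j * t j)\<^sup>2) \<le> \<sigma>\<^sup>2 * (\<Sum>k\<in>K. (\<rho> powi n k * cmod (a k))\<^sup>2)"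
  proof -
    \<comment> \<open>The matrix conjugated by the weight and restricted to the entries whose level
      does not rise from \<open>j\<close> to \<open>k\<close>.\<close>
    define S where "S = (\<lambda>j k. if n k \<le> n j then \<rho> powi (n j - n k) * cmod (M j k) else 0)"
    have "(\<Sum>k\<in>K. S j k * (\<rho> powi n k * cmod (a k))) = \<rho> powi n j * t j" for j
    proof -
      have "(\<Sum>k\<in>K. S j k * (\<rho> powi n k * cmod (a k)))
         = (\<Sum>k\<in>K. if n k \<le> n j then \<rho> powi n j * (cmod (M j k) * cmod (a k)) else 0)"
        unfolding S_def using \<rho> by (intro sum.cong) (auto simp: power_int_diff)
      then show ?thesis unfolding t_def using fin
        by (simp add: sum.inter_filter[symmetric] sum_distrib_left)
    qed
    moreover have "(\<Sum>j\<in>J. (\<Sum>k\<in>K. S j k * (\<rho> powi n k * cmod (a k)))\<^sup>2)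
       \<le> \<sigma>\<^sup>2 * (\<Sum>k\<in>K. (\<rho> powi n k * cmod (a k))\<^sup>2)"
    proof (rule schur_test_finite[OF fin])
      show "S j k \<ge> 0" for j k unfolding S_def using \<rho> by auto
      show "(\<Sum>k\<in>K. S j k) \<le> \<sigma>" if "j \<in> J" for j
        using row[OF that] fin by (simp add: S_def sum.inter_filter[symmetric])
      show "(\<Sum>j\<in>J. S j k) \<le> \<sigma>" if "k \<in> K" for k
        using col[OF that] fin by (simp add: S_def sum.inter_filter[symmetric])
    qed (fact \<sigma>)
    ultimately show ?thesis by simp
  qed
  have "(\<Sum>j\<in>J. (\<rho> powi n j * cmod (b j))\<^sup>2) = (\<Sum>j\<in>J. \<Sum>m\<in>{m0..n j}. c m * (cmod (b j))\<^sup>2)"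
    using m0 tel by (intro sum.cong) (auto simp: power_mult_distrib sq sum_distrib_right[symmetric])
  also have "\<dots> \<le> (\<Sum>j\<in>J. \<Sum>m\<in>{m0..n j}. c m * ((1 + d) * (cmod (x m j))\<^sup>2 + (1 + 1 / d) * (t j)\<^sup>2))"
    using c0 by (intro sum_mono mult_left_mono split) auto
  also have "\<dots> = (1 + d) * (\<Sum>j\<in>J. \<Sum>m\<in>{m0..n j}. c m * (cmod (x m j))\<^sup>2)
     + (1 + 1 / d) * (\<Sum>j\<in>J. (\<rho> powi n j * t j)\<^sup>2)"
  proof -
    have "(\<Sum>m\<in>{m0..n j}. c m * ((1 + d) * (cmod (x m j))\<^sup>2 + (1 + 1 / d) * (t j)\<^sup>2))
        = (1 + d) * (\<Sum>m\<in>{m0..n j}. c m * (cmod (x m j))\<^sup>2) + (1 + 1 / d) * (\<rho> powi n j * t j)\<^sup>2"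
      if "j \<in> J" for j
    proof -
      have "(\<Sum>m\<in>{m0..n j}. c m * ((1 + d) * (cmod (x m j))\<^sup>2 + (1 + 1 / d) * (t j)\<^sup>2))
        = (\<Sum>m\<in>{m0..n j}. (1 + d) * (c m * (cmod (x m j))\<^sup>2) + c m * ((1 + 1 / d) * (t j)\<^sup>2))"
        by (intro sum.cong) (auto simp: algebra_simps)
      also have "\<dots> = (1 + d) * (\<Sum>m\<in>{m0..n j}. c m * (cmod (x m j))\<^sup>2)
          + (\<Sum>m\<in>{m0..n j}. c m) * ((1 + 1 / d) * (t j)\<^sup>2)"
        by (simp add: sum.distrib sum_distrib_left sum_distrib_right)
      finally show ?thesis using tel[OF m0[OF that]] by (simp add: power_mult_distrib sq)
    qed
    then show ?thesis by (simp add: sum.distrib sum_distrib_left)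
  qed
  also have "\<dots> \<le> (1 + d) * ((\<Sum>k\<in>K. (\<rho> powi n k * cmod (a k))\<^sup>2) / R)
     + (1 + 1 / d) * (\<sigma>\<^sup>2 * (\<Sum>k\<in>K. (\<rho> powi n k * cmod (a k))\<^sup>2))"
    using d first second by (intro add_mono mult_left_mono) auto
  finally show ?thesis by (simp add: b_def R_def algebra_simps)
qed


section \<open>Non-stationary phase in one variable\<close>

text \<open>Integrated over a period, this is one integration by parts: it trades the amplitude \<open>X\<close> for
  \<open>(X / D)'\<close>.\<close>

lemma cis_phase_deriv:
  fixes q D X :: "real \<Rightarrow> real"
  assumes "(q has_real_derivative D t) (at t)" "(D has_real_derivative d1) (at t)"
    "(X has_real_derivative x') (at t)" "D t \<noteq> 0"
  shows "((\<lambda>t. cis (2 * pi * q t) * of_real (X t / D t)) has_vector_derivative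
     (2 * pi * \<i> * (cis (2 * pi * q t) * of_real (X t))
      + cis (2 * pi * q t) * of_real (x' / D t - X t * d1 / (D t)\<^sup>2))) (at t)"
proof -
  have a: "((\<lambda>t. cis (2 * pi * q t)) has_vector_derivative (2 * pi * D t) *\<^sub>R (\<i> * cis (2 * pi * q t))) (at t)"
  proof -
    show ?thesis using assms(1) unfolding has_vector_derivative_def has_field_derivative_def
      by (auto intro!: derivative_eq_intros simp: fun_eq_iff scaleR_conv_of_real)
  qed
  have "((\<lambda>t. X t / D t) has_real_derivative (x' / D t - X t * d1 / (D t)\<^sup>2)) (at t)"
    using assms by (auto intro!: derivative_eq_intros simp: field_simps power2_eq_square)
  then have b: "((\<lambda>t. of_real (X t / D t) :: complex) has_vector_derivative of_real (x' / D t - X t * d1 / (D t)\<^sup>2)) (at t)"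
    by (rule has_vector_derivative_of_real)
  show ?thesis
    using has_vector_derivative_mult[OF a b] assms(4)
    by (simp add: scaleR_conv_of_real mult_ac add_ac)
qed

text \<open>Three integrations by parts, with boundary terms cancelling by periodicity. Every term
  of the final amplitude contains a derivative of \<open>D\<close>, so besides the decay
  \<open>1 / P ^ 3\<close> the bound is linear in \<open>e\<close>; this is what makes the matrix
  entries small, not merely decaying.\<close>

lemma oscillatory_integral_bound:
  fixes q D D1 D2 D3 :: "real \<Rightarrow> real"
  assumes q: "\<And>t. (q has_real_derivative D t) (at t)"
    and D: "\<And>t. (D has_real_derivative D1 t) (at t)"
    and D1: "\<And>t. (D1 has_real_derivative D2 t) (at t)"
    and D2: "\<And>t. (D2 has_real_derivative D3 t) (at t)"
    and P: "P > 0" and DP: "\<And>t. P \<le> \<bar>D t\<bar>"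
    and e: "0 \<le> e" "e \<le> 1"
    and D1P: "\<And>t. \<bar>D1 t\<bar> \<le> e * P" and D2P: "\<And>t. \<bar>D2 t\<bar> \<le> e * P" and D3P: "\<And>t. \<bar>D3 t\<bar> \<le> e * P"
    and per: "D 1 = D 0" "D1 1 = D1 0" "D2 1 = D2 0" "cis (2 * pi * q 1) = cis (2 * pi * q 0)"
  shows "cmod (integral {0..1} (\<lambda>t. cis (2 * pi * q t))) \<le> e / P ^ 3"
proof -
  have nz: "D t \<noteq> 0" for t using DP[of t] P by auto
  \<comment> \<open>The amplitudes produced by starting from 1 and applying
    \<open>X \<mapsto> (X / D)'\<close> three times.\<close>
  define X1 where "X1 = (\<lambda>t. - D1 t / (D t)^2)"
  define X2 where "X2 = (\<lambda>t. - D2 t / (D t)^3 + 3 * (D1 t)^2 / (D t)^4)"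
  define X3 where "X3 = (\<lambda>t. - D3 t / (D t)^4 + 10 * D1 t * D2 t / (D t)^5 - 15 * (D1 t)^3 / (D t)^6)"
  have X1d: "(X1 has_real_derivative (- D2 t / (D t)^2 + 2 * (D1 t)^2 / (D t)^3)) (at t)" for t
    unfolding X1_def using nz[of t]
    by (auto intro!: derivative_eq_intros D D1 simp: field_simps power2_eq_square power3_eq_cube)
  have X2d: "(X2 has_real_derivative (- D3 t / (D t)^3 + 9 * D1 t * D2 t / (D t)^4 - 12 * (D1 t)^3 / (D t)^5)) (at t)" for t
  proof -
    have "((\<lambda>t. - D2 t / (D t)^3) has_real_derivative (- D3 t / (D t)^3 + 3 * D1 t * D2 t / (D t)^4)) (at t)"
      using nz[of t] by (auto intro!: derivative_eq_intros D D2 simp: field_simps eval_nat_numeral)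
    moreover have "((\<lambda>t. 3 * (D1 t)^2 / (D t)^4) has_real_derivative (6 * D1 t * D2 t / (D t)^4 - 12 * (D1 t)^3 / (D t)^5)) (at t)"
      using nz[of t] by (auto intro!: derivative_eq_intros D D1 simp: field_simps eval_nat_numeral)
    ultimately show ?thesis unfolding X2_def
      by (rule DERIV_add[THEN DERIV_cong]) (simp add: algebra_simps add_divide_distrib)
  qed
  let ?c = "1 / (2 * pi * \<i>)"
  let ?E = "\<lambda>t. cis (2 * pi * q t)"
  \<comment> \<open>Since \<open>?c * (2 * pi * \<i>) = 1\<close>, the alternating signs cancel the
    intermediate amplitudes: the derivative of \<open>H\<close> is the integrand plus the third
    amplitude alone.\<close>
  define H where "H = (\<lambda>t. ?c * (?E t * of_real (1 / D t)) - ?c^2 * (?E t * of_real (X1 t / D t))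
     + ?c^3 * (?E t * of_real (X2 t / D t)))"
  have "(H has_vector_derivative (?E t + ?c^3 * (?E t * of_real (X3 t)))) (at t)" for t
  proof -
    have x1: "0 / D t - 1 * D1 t / (D t)\<^sup>2 = X1 t" by (simp add: X1_def)
    have x2: "(- D2 t / (D t)^2 + 2 * (D1 t)^2 / (D t)^3) / D t - X1 t * D1 t / (D t)\<^sup>2 = X2 t"
      using nz[of t] by (simp add: X1_def X2_def field_simps eval_nat_numeral)
    have x3: "(- D3 t / (D t)^3 + 9 * D1 t * D2 t / (D t)^4 - 12 * (D1 t)^3 / (D t)^5) / D t - X2 t * D1 t / (D t)\<^sup>2 = X3 t"
      using nz[of t] by (simp add: X2_def X3_def field_simps eval_nat_numeral)
    note h0 = cis_phase_deriv[where X="\<lambda>_. 1" and q=q and D=D and t=t, OF q D DERIV_const nz[of t], unfolded x1]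
    note h1 = cis_phase_deriv[where q=q and D=D and t=t and X=X1, OF q D X1d nz[of t], unfolded x2]
    note h2 = cis_phase_deriv[where q=q and D=D and t=t and X=X2, OF q D X2d nz[of t], unfolded x3]
    have "(H has_vector_derivative (?c * (2 * pi * \<i> * (?E t * of_real 1) + ?E t * of_real (X1 t))
      - ?c^2 * (2 * pi * \<i> * (?E t * of_real (X1 t)) + ?E t * of_real (X2 t))
      + ?c^3 * (2 * pi * \<i> * (?E t * of_real (X2 t)) + ?E t * of_real (X3 t)))) (at t)"
      unfolding H_def
      by (intro has_vector_derivative_add has_vector_derivative_diff has_vector_derivative_mult_right h0 h1 h2)
    also have "(?c * (2 * pi * \<i> * (?E t * of_real 1) + ?E t * of_real (X1 t))
      - ?c^2 * (2 * pi * \<i> * (?E t * of_real (X1 t)) + ?E t * of_real (X2 t))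
      + ?c^3 * (2 * pi * \<i> * (?E t * of_real (X2 t)) + ?E t * of_real (X3 t)))
      = (?E t + ?c^3 * (?E t * of_real (X3 t)))"
    proof -
      have "c * (w * (z * 1) + z * x1) - c^2 * (w * (z * x1) + z * x2) + c^3 * (w * (z * x2) + z * x3)
          = z + c^3 * (z * x3)" if "c * w = 1" for c w z x1 x2 x3 :: complex
        using that by algebra
      from this[of ?c "2 * pi * \<i>" "?E t" "of_real (X1 t)" "of_real (X2 t)" "of_real (X3 t)"]
      show ?thesis by simp
    qed
    finally show ?thesis .
  qed
  then have i1: "((\<lambda>t. ?E t + ?c^3 * (?E t * of_real (X3 t))) has_integral (H 1 - H 0)) {0..1}"
    by (intro fundamental_theorem_of_calculus) (auto intro: has_vector_derivative_at_within)
  have H01: "H 1 - H 0 = 0"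
    using per by (simp add: H_def X1_def X2_def)
  have "continuous_on {0..1} q"
    using q by (intro DERIV_continuous_on) (rule has_field_derivative_at_within)
  then have "?E integrable_on {0..1}"
    by (intro integrable_continuous_real continuous_intros)
  then have i2: "(?E has_integral integral {0..1} ?E) {0..1}" by (rule integrable_integral)
  have hi: "((\<lambda>t. ?c^3 * (?E t * of_real (X3 t))) has_integral (- integral {0..1} ?E)) {0..1}"
    using has_integral_diff[OF i1 i2] unfolding H01 add_diff_cancel_left' diff_0 .
  \<comment> \<open>26 = 1 + 10 + 15 adds the coefficients of \<open>X3\<close>, higher powers of
    \<open>e\<close> being at most \<open>e\<close>. The factor
    \<open>(2 * pi) ^ 3 \<ge> 216\<close> in the denominator absorbs it afterwards.\<close>
  have X3b: "\<bar>X3 t\<bar> \<le> 26 * e / P ^ 3" for t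
  proof -
    have Dp: "0 < \<bar>D t\<bar>" using nz by simp
    have r: "\<bar>D1 t\<bar> / \<bar>D t\<bar> \<le> e" "\<bar>D2 t\<bar> / \<bar>D t\<bar> \<le> e" "\<bar>D3 t\<bar> / \<bar>D t\<bar> \<le> e"
      using D1P[of t] D2P[of t] D3P[of t] mult_left_mono[OF DP[of t] e(1)] Dp
      by (auto simp: divide_le_eq)
    have e2: "e * e \<le> e" "e * e * e \<le> e"
      using mult_left_le[of e e] mult_left_le[of e "e * e"] e by auto
    have i: "1 / \<bar>D t\<bar> ^ 3 \<le> 1 / P ^ 3"
      using DP[of t] P by (intro divide_left_mono power_mono) auto
    have "\<bar>X3 t\<bar> \<le> \<bar>D3 t / (D t)^4\<bar> + \<bar>10 * D1 t * D2 t / (D t)^5\<bar> + \<bar>15 * (D1 t)^3 / (D t)^6\<bar>"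
      unfolding X3_def by linarith
    also have "\<dots> = (\<bar>D3 t\<bar> / \<bar>D t\<bar> + 10 * (\<bar>D1 t\<bar> / \<bar>D t\<bar>) * (\<bar>D2 t\<bar> / \<bar>D t\<bar>)
        + 15 * (\<bar>D1 t\<bar> / \<bar>D t\<bar>) * (\<bar>D1 t\<bar> / \<bar>D t\<bar>) * (\<bar>D1 t\<bar> / \<bar>D t\<bar>)) * (1 / \<bar>D t\<bar> ^ 3)"
      using nz[of t] by (simp add: abs_mult power_abs field_simps eval_nat_numeral)
    also have "\<dots> \<le> (e + 10 * e * e + 15 * e * e * e) * (1 / P ^ 3)"
      using r i e P Dp by (intro mult_mono add_mono order_refl mult_nonneg_nonneg add_nonneg_nonneg divide_nonneg_nonneg) auto
    also have "\<dots> \<le> (26 * e) * (1 / P ^ 3)"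
      using e2 P by (intro mult_right_mono) auto
    finally show ?thesis by simp
  qed
  have "norm (- integral {0..1} ?E) \<le> (e / P ^ 3) * measure lborel {0..(1::real)}"
  proof (rule has_integral_bound_real[OF _ finite.emptyI hi])
    show "0 \<le> e / P ^ 3" using e P by simp
    fix t :: real
    have "(2 * 3) ^ 3 \<le> (2 * pi) ^ 3"
      using pi_gt3 by (intro power_mono mult_left_mono) auto
    then have p: "26 \<le> (2 * pi) ^ 3" by simp
    have "norm (?c^3 * (?E t * of_real (X3 t))) = \<bar>X3 t\<bar> / (2 * pi) ^ 3"
      by (simp add: norm_mult norm_divide norm_power power_divide)
    also have "\<dots> \<le> (26 * e / P ^ 3) / 26"
      using X3b[of t] p e P by (intro frac_le) auto
    finally show "norm (?c^3 * (?E t * of_real (X3 t))) \<le> e / P ^ 3" by simp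
  qed
  then show ?thesis by simp
qed


section \<open>Fourier analysis on the torus\<close>

lemma two_neq_succ: "(i::2) + 1 \<noteq> i" "(i::2) \<noteq> i + 1"
  using exhaust_2[of i] by auto

lemma UNIV_2_succ: "UNIV = {i::2, i + 1}"
  using exhaust_2[of i] by (auto simp: UNIV_2)

text \<open>Coordinates with a chosen axis first. Arithmetic in the index type \<open>2\<close> is
  modulo 2, so \<open>i + 1\<close> is the other axis. The choice of \<open>i\<close> stays free
  because the direction of integration by parts depends on the frequency.\<close>

definition axis_plane :: "2 \<Rightarrow> real \<times> real \<Rightarrow> real^2" where
  "axis_plane i = (\<lambda>(a, b). a *\<^sub>R axis i 1 + b *\<^sub>R axis (i + 1) 1)"

lemma axis_plane_nth [simp]: "axis_plane i (a, b) $ i = a" "axis_plane i (a, b) $ (i + 1) = b"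
  by (simp_all add: axis_plane_def axis_def two_neq_succ)

lemma continuous_on_axis_plane: "continuous_on UNIV (axis_plane i)"
  unfolding axis_plane_def case_prod_unfold by (intro continuous_intros)

lemma measurable_axis_plane [measurable]: "axis_plane i \<in> borel_measurable (lborel \<Otimes>\<^sub>M lborel)"
  using borel_measurable_continuous_onI[OF continuous_on_axis_plane] by (simp add: lborel_prod)

lemma distr_axis_plane: "distr (lborel \<Otimes>\<^sub>M lborel) borel (axis_plane i) = (lborel :: (real^2) measure)"
proof (rule lborel_eqI[symmetric])
  fix l u :: "real^2"
  assume le: "\<And>b. b \<in> Basis \<Longrightarrow> l \<bullet> b \<le> u \<bullet> b"
  have le': "l $ j \<le> u $ j" for j
    using le[of "axis j 1"] by (auto simp: inner_axis)
  have B: "Basis = {axis i (1::real), axis (i+1) 1 :: real^2}"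
    using UNIV_2_succ[of i] by (auto simp: Basis_vec_def)
  have ne: "axis i (1::real) \<noteq> axis (i+1) 1"
    by (metis axis_eq_axis two_neq_succ(2) zero_neq_one)
  have vim: "axis_plane i -` box l u = {l $ i<..<u $ i} \<times> {l $ (i+1)<..<u $ (i+1)}"
    by (auto simp: mem_box B inner_axis)
  have "emeasure (distr (lborel \<Otimes>\<^sub>M lborel) borel (axis_plane i)) (box l u)
      = emeasure (lborel \<Otimes>\<^sub>M lborel) (axis_plane i -` box l u)"
    by (subst emeasure_distr) (auto simp: space_pair_measure)
  also have "\<dots> = ennreal (u $ i - l $ i) * ennreal (u $ (i+1) - l $ (i+1))"
    unfolding vim by (subst lborel.emeasure_pair_measure_Times) (use le' in auto)
  also have "\<dots> = ennreal (\<Prod>b\<in>Basis. (u - l) \<bullet> b)"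
    unfolding B using ne le' by (simp add: inner_axis ennreal_mult)
  finally show "emeasure (distr (lborel \<Otimes>\<^sub>M lborel) borel (axis_plane i)) (box l u) = (\<Prod>b\<in>Basis. (u - l) \<bullet> b)" .
qed simp

lemma rep_proj_torus: "\<exists>m. rep_torus (proj_torus x) = x + of_int_vec m"
  using proj_rep_torus[of "proj_torus x"] unfolding proj_torus_eq_iff lattice_equiv_def .

lemma dist_torus_le: "dist x y \<le> norm (rep_torus x - rep_torus y + of_int_vec m)"
  unfolding dist_torus_def by (rule cINF_lower) (auto intro!: bdd_belowI[where m=0])

lemma dist_proj_torus_le: "dist (proj_torus x) (proj_torus y) \<le> norm (x - y)"
proof -
  obtain m n where "rep_torus (proj_torus x) = x + of_int_vec m" "rep_torus (proj_torus y) = y + of_int_vec n"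
    using rep_proj_torus by meson
  then have "rep_torus (proj_torus x) - rep_torus (proj_torus y) + of_int_vec (n - m) = x - y"
    using of_int_vec_add[of n "- m"] by (simp add: of_int_vec_minus)
  then show ?thesis using dist_torus_le[of "proj_torus x" "proj_torus y" "n - m"] by simp
qed

lemma continuous_on_proj_torus: "continuous_on UNIV proj_torus"
  unfolding continuous_on_iff using dist_proj_torus_le
  by (metis UNIV_I dist_norm le_less_trans)

lemma measurable_proj_torus [measurable]: "proj_torus \<in> borel_measurable borel"
  by (rule borel_measurable_continuous_onI[OF continuous_on_proj_torus])

definition unit_square :: "(real^2) set" where
  "unit_square = {x. \<forall>i. 0 \<le> x $ i \<and> x $ i < 1}"

lemma unit_square_borel [measurable]: "unit_square \<in> sets borel"
  unfolding unit_square_def by measurable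

lemma axis_plane_in_unit_square:
  "axis_plane i (a, b) \<in> unit_square \<longleftrightarrow> a \<in> {0..<1} \<and> b \<in> {0..<1}"
proof -
  have "(\<forall>j. P j) \<longleftrightarrow> P i \<and> P (i + 1)" for P :: "2 \<Rightarrow> bool"
    using UNIV_2_succ[of i] by (metis UNIV_I insert_iff singletonD)
  then show ?thesis by (simp add: unit_square_def)
qed

lemma indicator_unit_square_axis_plane:
  "indicator unit_square (axis_plane i (a, b)) = (indicator {0..<1} a * indicator {0..<1} b :: real)"
  unfolding indicator_def axis_plane_in_unit_square by simp

lemma haar_torus_eq: "haar_torus = distr (restrict_space lborel unit_square) borel proj_torus"
  by (simp add: haar_torus_def unit_square_def)

lemma sets_haar_torus [measurable_cong, simp]: "sets haar_torus = sets borel"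
  by (simp add: haar_torus_def)

lemma space_haar_torus [simp]: "space haar_torus = UNIV"
  by (simp add: haar_torus_def)

lemma emeasure_unit_square: "emeasure lborel unit_square = 1"
proof -
  have "emeasure lborel unit_square = emeasure (lborel \<Otimes>\<^sub>M lborel) (axis_plane 1 -` unit_square)"
    by (subst distr_axis_plane[symmetric, of 1], subst emeasure_distr) (auto simp: space_pair_measure)
  also have "axis_plane 1 -` unit_square = {0..<1} \<times> {0..<1}"
    using axis_plane_in_unit_square[of 1] by auto
  also have "emeasure (lborel \<Otimes>\<^sub>M lborel) ({0..<1::real} \<times> {0..<1::real}) = 1"
    by (subst lborel.emeasure_pair_measure_Times) auto
  finally show ?thesis .
qed

lemma prob_space_haar_torus: "prob_space haar_torus"
proof -
  have "prob_space (restrict_space lborel unit_square)"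
    by (rule prob_spaceI) (simp add: space_restrict_space emeasure_restrict_space emeasure_unit_square)
  then show ?thesis unfolding haar_torus_eq
    by (rule prob_space.prob_space_distr) (auto intro: measurable_restrict_space1)
qed

interpretation haar: prob_space haar_torus
  by (rule prob_space_haar_torus)

lemma haar_prob_UNIV [simp]: "haar.prob UNIV = 1"
  using haar.prob_space by simp

lemma measurable_cnj [measurable]: "cnj \<in> borel_measurable borel"
  by (intro borel_measurable_continuous_onI continuous_intros)

lemma integrable_haar_bounded:
  fixes \<phi> :: "torus \<Rightarrow> 'b::{banach, second_countable_topology}"
  assumes "\<phi> \<in> borel_measurable borel" "\<And>x. norm (\<phi> x) \<le> B"
  shows "integrable haar_torus \<phi>"
  using assms by (intro haar.integrable_const_bound[of _ B]) auto

lemma norm_integral_haar_le: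
  fixes \<phi> :: "torus \<Rightarrow> 'b::{banach, second_countable_topology}"
  assumes "\<And>x. norm (\<phi> x) \<le> B" "0 \<le> B"
  shows "norm (integral\<^sup>L haar_torus \<phi>) \<le> B"
proof -
  have "norm (integral\<^sup>L haar_torus \<phi>) \<le> (\<integral>x. norm (\<phi> x) \<partial>haar_torus)"
    by (rule integral_norm_bound)
  also have "\<dots> \<le> B"
  proof (rule integral_real_bounded[OF assms(2)])
    have "(\<integral>\<^sup>+x. ennreal (norm (\<phi> x)) \<partial>haar_torus) \<le> (\<integral>\<^sup>+x. ennreal B \<partial>haar_torus)"
      by (rule nn_integral_mono) (use assms in \<open>auto intro: ennreal_leI\<close>)
    then show "(\<integral>\<^sup>+x. ennreal (norm (\<phi> x)) \<partial>haar_torus) \<le> ennreal B"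
      by (simp add: haar.emeasure_space_1[simplified])
  qed
  finally show ?thesis .
qed

text \<open>Fubini on the unit square: a one-dimensional estimate along axis \<open>i\<close>,
  uniform in the base point, bounds the integral over the torus. This is the passage from the
  oscillatory integral on the line to matrix entries.\<close>

lemma norm_integral_haar_le_slices:
  fixes \<phi> :: "torus \<Rightarrow> complex"
  assumes meas [measurable]: "\<phi> \<in> borel_measurable borel" and bd: "\<And>x. cmod (\<phi> x) \<le> C"
    and B: "B \<ge> 0"
    and slices: "\<And>x. cmod (integral {0..1} (\<lambda>t. \<phi> (proj_torus (x + t *\<^sub>R axis i 1)))) \<le> B"
  shows "cmod (integral\<^sup>L haar_torus \<phi>) \<le> B"
proof -
  let ?g = "\<lambda>z. indicator unit_square (axis_plane i z) *\<^sub>R \<phi> (proj_torus (axis_plane i z))"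
  have "integral\<^sup>L haar_torus \<phi> = (LINT x|restrict_space lborel unit_square. \<phi> (proj_torus x))"
    unfolding haar_torus_eq by (subst integral_distr) (auto intro!: measurable_restrict_space1)
  also have "\<dots> = (LINT x|lborel. indicator unit_square x *\<^sub>R \<phi> (proj_torus x))"
    by (subst integral_restrict_space) auto
  also have "\<dots> = (LINT z|(lborel \<Otimes>\<^sub>M lborel). ?g z)"
    by (subst distr_axis_plane[symmetric, of i], subst integral_distr) auto
  finally have eq: "integral\<^sup>L haar_torus \<phi> = (LINT z|(lborel \<Otimes>\<^sub>M lborel). ?g z)" .
  have ind: "integrable (lborel \<Otimes>\<^sub>M lborel) (\<lambda>z. indicator ({0..<1::real} \<times> {0..<1::real}) z *\<^sub>R C)"
    by (rule integrable_scaleR_left)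
      (auto simp: lborel.emeasure_pair_measure_Times intro!: integrable_real_indicator)
  have int: "integrable (lborel \<Otimes>\<^sub>M lborel) ?g"
  proof (rule Bochner_Integration.integrable_bound[OF ind])
    show "AE z in lborel \<Otimes>\<^sub>M lborel. norm (?g z) \<le> norm (indicator ({0..<1::real} \<times> {0..<1::real}) z *\<^sub>R C)"
    proof (rule AE_I2)
      fix z :: "real \<times> real"
      have "norm (\<phi> (proj_torus (axis_plane i z))) \<le> \<bar>C\<bar>" using bd by (meson abs_ge_self order_trans)
      then show "norm (?g z) \<le> norm (indicator ({0..<1::real} \<times> {0..<1::real}) z *\<^sub>R C)"
        by (cases z) (auto simp: axis_plane_in_unit_square indicator_def)
    qed
  qed measurable
  have inner: "cmod (LINT a|lborel. ?g (a, b)) \<le> indicator {0..<1} b * B" for b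
  proof -
    let ?h = "\<lambda>a. \<phi> (proj_torus (b *\<^sub>R axis (i+1) 1 + a *\<^sub>R axis i 1))"
    have hm [measurable]: "?h \<in> borel_measurable lborel"
    proof -
      have "(\<lambda>a. b *\<^sub>R axis (i+1) 1 + a *\<^sub>R axis i (1::real)) \<in> borel_measurable borel"
        by (intro borel_measurable_continuous_onI continuous_intros)
      then show ?thesis by simp
    qed
    \<comment> \<open>The unit square is half-open while the slices run over the closed interval;
      the difference is the null set \<open>a = 1\<close>.\<close>
    have "(LINT a|lborel. ?g (a, b)) = (LINT a|lborel. indicator {0..<1} b *\<^sub>R (indicator {0..1} a *\<^sub>R ?h a))"
    proof (rule integral_cong_AE)
      have "AE a in lborel. a \<noteq> (1::real)" by (rule AE_lborel_singleton)
      then show "AE a in lborel. ?g (a, b) = indicator {0..<1} b *\<^sub>R (indicator {0..1} a *\<^sub>R ?h a)"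
      proof eventually_elim
        case (elim a)
        have "?g (a, b) = (indicator {0..<1} a * indicator {0..<1} b) *\<^sub>R ?h a"
          unfolding indicator_unit_square_axis_plane by (simp add: axis_plane_def add_ac)
        then show ?case using elim by (auto simp: indicator_def)
      qed
    qed measurable
    also have "\<dots> = indicator {0..<1} b *\<^sub>R (LINT a:{0..1}|lborel. ?h a)"
      by (simp only: set_lebesgue_integral_def integral_scaleR_right)
    also have "(LINT a:{0..1}|lborel. ?h a) = integral {0..1} ?h"
    proof (rule set_borel_integral_eq_integral(2))
      show "set_integrable lborel {0..1} ?h"
        unfolding set_integrable_def
        by (rule integrableI_bounded_set_indicator[where B=C]) (use bd in auto)
    qed
    finally show ?thesis using slices[of "b *\<^sub>R axis (i+1) 1"] by (auto simp: indicator_def)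
  qed
  have cp: "(\<lambda>(a, b). ?g (a, b)) = ?g" by (simp add: fun_eq_iff)
  have "integral\<^sup>L haar_torus \<phi> = (LINT b|lborel. LINT a|lborel. ?g (a, b))"
    unfolding eq by (rule lborel_pair.integral_snd[of "\<lambda>a b. ?g (a, b)", unfolded cp, OF int, symmetric])
  also have "cmod \<dots> \<le> (LINT b::real|lborel. indicator {0..<1} b * B)"
  proof (rule order_trans[OF integral_norm_bound integral_mono])
    show "integrable lborel (\<lambda>b. cmod (LINT a|lborel. ?g (a, b)))"
      using lborel_pair.integrable_snd[of "\<lambda>a b. ?g (a, b)", unfolded cp, OF int] by (rule integrable_norm)
    show "integrable lborel (\<lambda>b::real. indicator {0..<1} b * B)"
      by (intro integrable_mult_left integrable_real_indicator) auto
  qed (use inner in auto)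
  also have "\<dots> = B" by simp
  finally show ?thesis .
qed


section \<open>Characters: Lipschitz bound, orthogonality, Parseval and Bessel\<close>

lemma norm_cis_diff_le: "cmod (cis a - cis b) \<le> \<bar>a - b\<bar>"
proof -
  have "cmod (cis a - cis b) \<le> 1 * norm (a - b)"
  proof (rule differentiable_bound[where S=UNIV and f'="\<lambda>x h. h *\<^sub>R (\<i> * cis x)"])
    show "(cis has_derivative (\<lambda>h. h *\<^sub>R (\<i> * cis x))) (at x within UNIV)" for x
      by (auto intro!: derivative_eq_intros)
    show "onorm (\<lambda>h. h *\<^sub>R (\<i> * cis x)) \<le> 1" for x
      by (rule onorm_le) (simp add: norm_mult)
  qed auto
  then show ?thesis by simp
qed

lemma fourier_mode_proj: "fourier_mode k (proj_torus x) = cis (2 * pi * (of_int_vec k \<bullet> x))"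
  by (rule fourier_mode.abs_eq)

text \<open>The free shift \<open>m\<close> matters: a bound proved for every lattice translate of
  the representative passes to the infimum that defines the torus metric.\<close>

lemma fourier_mode_eq_rep:
  "fourier_mode k x = cis (2 * pi * (of_int_vec k \<bullet> (rep_torus x + of_int_vec m)))"
  using fourier_mode_proj[of k "rep_torus x"] by (simp add: proj_rep_torus cis_lattice_invariant)

lemma cmod_fourier_mode [simp]: "cmod (fourier_mode k x) = 1"
  by (simp add: fourier_mode_eq_rep[of _ _ 0])

lemma fourier_mode_0 [simp]: "fourier_mode 0 x = 1"
  by (simp add: fourier_mode_eq_rep[of _ _ 0] of_int_vec_0)

lemma fourier_mode_add: "fourier_mode (k + l) x = fourier_mode k x * fourier_mode l x"
  by (simp add: fourier_mode_eq_rep[of _ _ 0] of_int_vec_add inner_add_left cis_mult distrib_left)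

lemma cnj_fourier_mode: "cnj (fourier_mode k x) = fourier_mode (- k) x"
  by (simp add: fourier_mode_eq_rep[of _ _ 0] of_int_vec_minus cis_cnj)

lemma fourier_mode_mult_cnj: "fourier_mode k x * cnj (fourier_mode l x) = fourier_mode (k - l) x"
  using fourier_mode_add[of k "- l" x] by (simp add: cnj_fourier_mode)

lemma fourier_mode_lipschitz:
  "cmod (fourier_mode k x - fourier_mode k y) \<le> 2 * pi * norm (of_int_vec k) * dist x y"
proof (cases "k = 0")
  case True
  then show ?thesis by simp
next
  case False
  then have kn: "norm (of_int_vec k) > 0"
    by (auto simp: of_int_vec_def vec_eq_iff)
  have "cmod (fourier_mode k x - fourier_mode k y) / (2 * pi * norm (of_int_vec k)) \<le> dist x y"
    unfolding dist_torus_def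
  proof (rule cINF_greatest)
    fix m :: "int^2"
    have "cmod (fourier_mode k x - fourier_mode k y)
      \<le> \<bar>2 * pi * (of_int_vec k \<bullet> (rep_torus x + of_int_vec m)) - 2 * pi * (of_int_vec k \<bullet> (rep_torus y + of_int_vec 0))\<bar>"
      unfolding fourier_mode_eq_rep[of k x m] fourier_mode_eq_rep[of k y 0] by (rule norm_cis_diff_le)
    also have "\<dots> = \<bar>2 * pi * (of_int_vec k \<bullet> (rep_torus x - rep_torus y + of_int_vec m))\<bar>"
      by (simp add: of_int_vec_0 inner_add_right inner_diff_right algebra_simps)
    also have "\<dots> = 2 * pi * \<bar>of_int_vec k \<bullet> (rep_torus x - rep_torus y + of_int_vec m)\<bar>"
      by (simp add: abs_mult)
    also have "\<dots> \<le> 2 * pi * (norm (of_int_vec k) * norm (rep_torus x - rep_torus y + of_int_vec m))"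
      by (intro mult_left_mono Cauchy_Schwarz_ineq2) auto
    finally show "cmod (fourier_mode k x - fourier_mode k y) / (2 * pi * norm (of_int_vec k))
        \<le> norm (rep_torus x - rep_torus y + of_int_vec m)"
      using kn by (simp add: divide_le_eq mult_ac)
  qed auto
  then show ?thesis using kn by (simp add: divide_le_eq mult_ac)
qed

lemma continuous_on_fourier_mode: "continuous_on UNIV (fourier_mode k)"
proof -
  have "(2 * pi * norm (of_int_vec k))-lipschitz_on UNIV (fourier_mode k)"
    using fourier_mode_lipschitz by (intro lipschitz_onI) (auto simp: dist_norm)
  then show ?thesis by (rule lipschitz_on_continuous_on)
qed

lemma measurable_fourier_mode [measurable]: "fourier_mode k \<in> borel_measurable borel"
  by (rule borel_measurable_continuous_onI[OF continuous_on_fourier_mode])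

lemma integrable_fourier_mode [simp]: "integrable haar_torus (fourier_mode k)"
  by (rule integrable_haar_bounded[where B=1]) auto

lemma integral_fourier_mode: "(\<integral>x. fourier_mode k x \<partial>haar_torus) = (if k = 0 then 1 else 0)"
proof (cases "k = 0")
  case True
  then show ?thesis by (simp add: haar.prob_space)
next
  case False
  then obtain i where i: "k $ i \<noteq> 0" by (auto simp: vec_eq_iff)
  have "cmod (\<integral>x. fourier_mode k x \<partial>haar_torus) \<le> 0"
  proof (rule norm_integral_haar_le_slices[where C=1])
    fix x :: "real^2"
    \<comment> \<open>Along an axis with \<open>k $ i \<noteq> 0\<close> the phase is linear, so the
      oscillatory estimate applies with \<open>e = 0\<close> and the integral vanishes.\<close>
    have "cmod (integral {0..1} (\<lambda>t. cis (2 * pi * (of_int_vec k \<bullet> x + t * of_int (k $ i))))) \<le> 0 / \<bar>of_int (k $ i)\<bar> ^ 3"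
    proof (rule oscillatory_integral_bound[where D="\<lambda>_. of_int (k $ i)" and ?D1.0="\<lambda>_. 0" and ?D2.0="\<lambda>_. 0" and ?D3.0="\<lambda>_. 0"])
      show "cis (2 * pi * (of_int_vec k \<bullet> x + 1 * of_int (k $ i))) = cis (2 * pi * (of_int_vec k \<bullet> x + 0 * of_int (k $ i)))"
        by (simp add: distrib_left cis_mult[symmetric] cis_multiple_2pi)
    qed (use i in \<open>auto intro!: derivative_eq_intros\<close>)
    moreover have "(\<lambda>t. fourier_mode k (proj_torus (x + t *\<^sub>R axis i 1))) = (\<lambda>t. cis (2 * pi * (of_int_vec k \<bullet> x + t * of_int (k $ i))))"
      by (simp add: fourier_mode_proj inner_add_right inner_axis of_int_vec_def)
    ultimately show "cmod (integral {0..1} (\<lambda>t. fourier_mode k (proj_torus (x + t *\<^sub>R axis i 1)))) \<le> 0"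
      by simp
  qed auto
  then show ?thesis using False by simp
qed

lemma integral_cmod_sq:
  assumes "integrable haar_torus (\<lambda>x. (cmod (g x))\<^sup>2)"
  shows "complex_of_real (\<integral>x. (cmod (g x))\<^sup>2 \<partial>haar_torus) = (\<integral>x. g x * cnj (g x) \<partial>haar_torus)"
  using integral_complex_of_real[of haar_torus "\<lambda>x. (cmod (g x))\<^sup>2"] by (simp add: complex_norm_square del: of_real_power)

lemma cmod_trig_sum_le: "cmod (\<Sum>k\<in>K. a k * fourier_mode k x) \<le> (\<Sum>k\<in>K. cmod (a k))"
  by (rule sum_norm_le) (simp add: norm_mult)

lemma parseval_finite:
  assumes "finite K"
  shows "(\<integral>x. (cmod (\<Sum>k\<in>K. a k * fourier_mode k x))\<^sup>2 \<partial>haar_torus) = (\<Sum>k\<in>K. (cmod (a k))\<^sup>2)"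
proof -
  let ?s = "\<lambda>x. \<Sum>k\<in>K. a k * fourier_mode k x"
  have "integrable haar_torus (\<lambda>x. (cmod (?s x))\<^sup>2)"
    by (rule integrable_haar_bounded[where B="(\<Sum>k\<in>K. cmod (a k))\<^sup>2"])
      (auto intro!: power_mono cmod_trig_sum_le)
  then have "complex_of_real (\<integral>x. (cmod (?s x))\<^sup>2 \<partial>haar_torus) = (\<integral>x. ?s x * cnj (?s x) \<partial>haar_torus)"
    by (rule integral_cmod_sq)
  also have "\<dots> = (\<integral>x. (\<Sum>k\<in>K. \<Sum>l\<in>K. a k * cnj (a l) * fourier_mode (k - l) x) \<partial>haar_torus)"
    by (simp add: sum_product fourier_mode_mult_cnj[symmetric] mult_ac)
  also have "\<dots> = (\<Sum>k\<in>K. \<Sum>l\<in>K. a k * cnj (a l) * (if k = l then 1 else 0))"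
    by (simp add: integral_fourier_mode)
  also have "\<dots> = (\<Sum>k\<in>K. of_real ((cmod (a k))\<^sup>2))"
    using assms by (simp add: if_distrib[of "(*) _"] complex_norm_square del: of_real_power cong: if_cong)
  finally show ?thesis by (simp only: of_real_sum[symmetric] of_real_eq_iff)
qed

lemma cmod_diff_power2: "(cmod (a - b))\<^sup>2 = (cmod a)\<^sup>2 + (cmod b)\<^sup>2 - 2 * Re (a * cnj b)"
  by (simp add: cmod_power2) (simp add: power2_eq_square algebra_simps)

lemma integral_add_diff_Re:
  assumes "integrable M u" "integrable M v" "integrable M w"
  shows "(\<integral>x. u x + v x - 2 * Re (w x) \<partial>M) = (\<integral>x. u x \<partial>M) + (\<integral>x. v x \<partial>M) - 2 * Re (\<integral>x. w x \<partial>M)"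
proof -
  have "integrable M (\<lambda>x. Re (w x))" using assms(3) by (rule integrable_Re)
  then show ?thesis using assms by simp
qed

text \<open>The squared distance from \<open>g\<close> to its partial Fourier sum over
  \<open>J\<close> is nonnegative. The pointwise bound supplies the integrability of all products
  that occur.\<close>

lemma bessel_finite:
  assumes [measurable]: "g \<in> borel_measurable borel" and bd: "\<And>x. cmod (g x) \<le> B" and J: "finite J"
  shows "(\<Sum>j\<in>J. (cmod (fourier_coeff g j))\<^sup>2) \<le> (\<integral>x. (cmod (g x))\<^sup>2 \<partial>haar_torus)"
proof -
  let ?c = "fourier_coeff g"
  let ?s = "\<lambda>x. \<Sum>k\<in>J. ?c k * fourier_mode k x"
  have B: "0 \<le> B" using bd[of undefined] norm_ge_zero order_trans by blast
  have sb: "cmod (?s x) \<le> (\<Sum>k\<in>J. cmod (?c k))" for x by (rule cmod_trig_sum_le)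
  have i1 [simp]: "integrable haar_torus (\<lambda>x. (cmod (g x))\<^sup>2)"
    by (rule integrable_haar_bounded[where B="B\<^sup>2"]) (auto intro!: power_mono bd)
  have i2 [simp]: "integrable haar_torus (\<lambda>x. (cmod (?s x))\<^sup>2)"
    by (rule integrable_haar_bounded[where B="(\<Sum>k\<in>J. cmod (?c k))\<^sup>2"])
      (auto intro!: power_mono sb)
  have i3 [simp]: "integrable haar_torus (\<lambda>x. g x * cnj (fourier_mode k x))" for k
    by (rule integrable_haar_bounded[where B=B]) (auto simp: norm_mult bd)
  have i4 [simp]: "integrable haar_torus (\<lambda>x. g x * cnj (?s x))"
    by (rule integrable_haar_bounded[where B="B * (\<Sum>k\<in>J. cmod (?c k))"])
      (auto simp: norm_mult simp del: cnj_sum intro!: mult_mono bd sb B)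
  have "(\<integral>x. g x * cnj (?s x) \<partial>haar_torus) = (\<integral>x. (\<Sum>k\<in>J. cnj (?c k) * (g x * cnj (fourier_mode k x))) \<partial>haar_torus)"
    by (simp add: sum_distrib_left mult_ac)
  also have "\<dots> = (\<Sum>k\<in>J. cnj (?c k) * ?c k)"
    by (simp add: fourier_coeff_def[of g])
  also have "\<dots> = of_real (\<Sum>k\<in>J. (cmod (?c k))\<^sup>2)"
    by (simp add: complex_norm_square mult.commute del: of_real_power)
  finally have e: "(\<integral>x. g x * cnj (?s x) \<partial>haar_torus) = of_real (\<Sum>k\<in>J. (cmod (?c k))\<^sup>2)" .
  have "0 \<le> (\<integral>x. (cmod (g x - ?s x))\<^sup>2 \<partial>haar_torus)" by simp
  also have "\<dots> = (\<integral>x. (cmod (g x))\<^sup>2 + (cmod (?s x))\<^sup>2 - 2 * Re (g x * cnj (?s x)) \<partial>haar_torus)"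
    by (simp only: cmod_diff_power2)
  also have "\<dots> = (\<integral>x. (cmod (g x))\<^sup>2 \<partial>haar_torus) + (\<integral>x. (cmod (?s x))\<^sup>2 \<partial>haar_torus)
     - 2 * Re (\<integral>x. g x * cnj (?s x) \<partial>haar_torus)"
    using i1 i2 i4 by (rule integral_add_diff_Re)
  also have "\<dots> = (\<integral>x. (cmod (g x))\<^sup>2 \<partial>haar_torus) - (\<Sum>k\<in>J. (cmod (?c k))\<^sup>2)"
    unfolding e parseval_finite[OF J] by simp
  finally show ?thesis by simp
qed


section \<open>Lifts and derivative bounds\<close>

lemma C_infinityD: "C_infinity F \<Longrightarrow> iter_deriv vs F differentiable (at x)"
  by (auto simp: C_infinity_def)

lemma iter_deriv_append: "iter_deriv (us @ vs) F = iter_deriv us (iter_deriv vs F)"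
  by (induction us) auto

lemma C_infinity_iter_deriv: "C_infinity F \<Longrightarrow> C_infinity (iter_deriv vs F)"
  by (auto simp: C_infinity_def iter_deriv_append[symmetric])

lemma iter_deriv_sum:
  assumes "finite I" "\<And>i. i \<in> I \<Longrightarrow> C_infinity (G i)"
  shows "iter_deriv us (\<lambda>x. \<Sum>i\<in>I. c i *\<^sub>R G i x) = (\<lambda>x. \<Sum>i\<in>I. c i *\<^sub>R iter_deriv us (G i) x)"
proof (induction us)
  case (Cons u us)
  have "((\<lambda>x. \<Sum>i\<in>I. c i *\<^sub>R iter_deriv us (G i) x) has_derivative
      (\<lambda>h. \<Sum>i\<in>I. c i *\<^sub>R frechet_derivative (iter_deriv us (G i)) (at x) h)) (at x)" for x
    by (intro has_derivative_sum has_derivative_scaleR_right)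
      (use C_infinityD[OF assms(2)] frechet_derivative_works in blast)
  from frechet_derivative_at[OF this] show ?case
    unfolding iter_deriv.simps Cons by (auto simp: fun_eq_iff)
qed simp

lemma iter_deriv_Cons_basis:
  fixes F :: "'a::euclidean_space \<Rightarrow> 'b::real_normed_vector"
  assumes "C_infinity F"
  shows "iter_deriv (v # vs) F = (\<lambda>x. \<Sum>b\<in>Basis. (v \<bullet> b) *\<^sub>R iter_deriv (b # vs) F x)"
proof
  fix x
  let ?D = "frechet_derivative (iter_deriv vs F) (at x)"
  have "linear ?D"
    using C_infinityD[OF assms] by (rule linear_frechet_derivative)
  then have "?D (\<Sum>b\<in>Basis. (v \<bullet> b) *\<^sub>R b) = (\<Sum>b\<in>Basis. (v \<bullet> b) *\<^sub>R ?D b)"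
    by (simp add: linear_sum linear_scale)
  then show "iter_deriv (v # vs) F x = (\<Sum>b\<in>Basis. (v \<bullet> b) *\<^sub>R iter_deriv (b # vs) F x)"
    by (simp add: euclidean_representation)
qed

section \<open>Periodicity and boundedness of the derivatives of a lift\<close>

lemma is_smooth_lift_smooth_lift: "smooth_torus_map f \<Longrightarrow> is_smooth_lift (smooth_lift f) f"
  unfolding smooth_torus_map_def smooth_lift_def using someI_ex[of "\<lambda>F. is_smooth_lift F f"] by blast

lemma continuous_on_lift: "is_smooth_lift F f \<Longrightarrow> continuous_on UNIV F"
  unfolding is_smooth_lift_def C_infinity_def
  by (metis differentiable_imp_continuous_within continuous_at_imp_continuous_on iter_deriv.simps(1))

text \<open>A continuous map from the connected plane into a discrete set is constant. It is applied
  to the difference of a lift and its lattice translate, and to the difference of two lifts of the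
  linear map.\<close>

lemma lattice_valued_constant:
  fixes h :: "real^2 \<Rightarrow> real^2"
  assumes "continuous_on UNIV h" "\<And>x. \<exists>m. h x = of_int_vec m"
  shows "h constant_on UNIV"
proof -
  have "(\<lambda>x. h x $ i) constant_on UNIV" for i
  proof (rule continuous_discrete_range_constant[OF connected_UNIV])
    show "continuous_on UNIV (\<lambda>x. h x $ i)"
      by (intro continuous_intros assms(1))
    fix x :: "real^2"
    have "1 \<le> norm (h y $ i - h x $ i)" if "h y $ i \<noteq> h x $ i" for y
    proof -
      obtain m n where "h x = of_int_vec m" "h y = of_int_vec n" using assms(2) by meson
      with that have "h x $ i = of_int (m $ i)" "h y $ i = of_int (n $ i)" "m $ i \<noteq> n $ i"
        by (auto simp: of_int_vec_def)
      then show ?thesis by simp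
    qed
    then show "\<exists>e>0. \<forall>y. y \<in> UNIV \<and> h y $ i \<noteq> h x $ i \<longrightarrow> e \<le> norm (h y $ i - h x $ i)"
      using zero_less_one by blast
  qed
  then have "h x = h 0" for x
    unfolding constant_on_def vec_eq_iff by (metis UNIV_I)
  then show ?thesis unfolding constant_on_def by blast
qed

lemma lift_translate:
  assumes "is_smooth_lift F f"
  shows "\<exists>d. \<forall>x. F (x + of_int_vec m) = F x + d"
proof -
  have "(\<lambda>x. F (x + of_int_vec m) - F x) constant_on UNIV"
  proof (rule lattice_valued_constant)
    show "continuous_on UNIV (\<lambda>x. F (x + of_int_vec m) - F x)"
      by (intro continuous_intros continuous_on_compose2[OF continuous_on_lift[OF assms]]) auto
    fix x
    have "proj_torus (x + of_int_vec m) = proj_torus x"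
      unfolding proj_torus_eq_iff lattice_equiv_def by blast
    then have "proj_torus (F (x + of_int_vec m)) = proj_torus (F x)"
      using assms unfolding is_smooth_lift_def by metis
    then obtain n where "F (x + of_int_vec m) = F x + of_int_vec n"
      unfolding proj_torus_eq_iff lattice_equiv_def by blast
    then show "\<exists>n. F (x + of_int_vec m) - F x = of_int_vec n" by auto
  qed
  then obtain d where "F (x + of_int_vec m) - F x = d" for x by (auto simp: constant_on_def)
  then have "F (x + of_int_vec m) = F x + d" for x by (simp add: diff_eq_eq add.commute)
  then show ?thesis by blast
qed

lemma frechet_derivative_translate:
  fixes G :: "'a::real_normed_vector \<Rightarrow> 'b::real_normed_vector"
  assumes "\<And>x. G differentiable (at x)" "\<And>x. G (x + c) = G x + d"
  shows "frechet_derivative G (at (x + c)) = frechet_derivative G (at x)"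
proof -
  have "(G has_derivative frechet_derivative G (at (x + c))) (at (x + c))"
    using assms(1) frechet_derivative_works by blast
  then have "((\<lambda>y. G (y + c)) has_derivative frechet_derivative G (at (x + c))) (at x)"
    by (auto intro!: derivative_eq_intros has_derivative_compose[where f="\<lambda>y. y + c" and g=G])
  moreover have "((\<lambda>y. G y + d) has_derivative frechet_derivative G (at x)) (at x)"
    using assms(1) frechet_derivative_works by (auto intro!: derivative_eq_intros)
  ultimately show ?thesis unfolding assms(2) by (rule has_derivative_unique)
qed

lemma iter_deriv_lift_periodic:
  assumes "is_smooth_lift F f" "vs \<noteq> []"
  shows "iter_deriv vs F (x + of_int_vec m) = iter_deriv vs F x"
proof -
  have cinf: "C_infinity F" using assms(1) by (simp add: is_smooth_lift_def)
  \<comment> \<open>A lift is periodic only up to an additive constant. One derivative removes the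
    constant, and the induction carries \<open>d\<close> to bridge that first step.\<close>
  have "\<exists>d. \<forall>x. iter_deriv vs F (x + of_int_vec m) = iter_deriv vs F x + d \<and> (vs \<noteq> [] \<longrightarrow> d = 0)"
  proof (induction vs)
    case Nil
    then show ?case using lift_translate[OF assms(1)] by simp
  next
    case (Cons v vs)
    then obtain d where "\<And>x. iter_deriv vs F (x + of_int_vec m) = iter_deriv vs F x + d" by blast
    from frechet_derivative_translate[OF C_infinityD[OF cinf] this] show ?case by simp
  qed
  then show ?thesis using assms(2) by auto
qed

lemma periodic_bounded:
  fixes G :: "real^2 \<Rightarrow> 'b::real_normed_vector"
  assumes "continuous_on UNIV G" "\<And>x m. G (x + of_int_vec m) = G x"
  shows "\<exists>B. \<forall>x. norm (G x) \<le> B"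
proof -
  have "compact (G ` cbox 0 1)"
    by (intro compact_continuous_image compact_cbox continuous_on_subset[OF assms(1)]) auto
  then obtain B where B: "\<And>x. x \<in> cbox 0 1 \<Longrightarrow> norm (G x) \<le> B"
    by (meson bounded_iff compact_imp_bounded image_eqI)
  have "norm (G x) \<le> B" for x
  proof -
    let ?m = "(\<chi> i. - floor (x $ i)) :: int^2"
    have "x + of_int_vec ?m \<in> cbox 0 1"
      by (auto simp: mem_box_cart of_int_vec_def) linarith+
    then show ?thesis using B assms(2) by metis
  qed
  then show ?thesis by blast
qed

text \<open>The directions range over a whole ball, so boundedness of one periodic derivative is not
  enough. The innermost direction of \<open>vs\<close> is expanded in the basis and moved into the
  fixed tail \<open>bs\<close>; at \<open>k = 0\<close> a single continuous periodic function
  remains. The induction needs \<open>bs\<close> arbitrary for this.\<close>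

lemma iter_deriv_lift_bounded:
  assumes "is_smooth_lift F f" "k + length bs > 0"
  shows "\<exists>B. \<forall>vs x. length vs = k \<and> (\<forall>v\<in>set vs. norm v \<le> 1) \<longrightarrow> norm (iter_deriv (vs @ bs) F x) \<le> B"
  using assms(2)
proof (induction k arbitrary: bs)
  case 0
  have cinf: "C_infinity F" using assms(1) by (simp add: is_smooth_lift_def)
  have "continuous_on UNIV (iter_deriv bs F)"
    by (intro continuous_at_imp_continuous_on ballI differentiable_imp_continuous_within C_infinityD cinf)
  then have "\<exists>B. \<forall>x. norm (iter_deriv bs F x) \<le> B"
    using 0 by (intro periodic_bounded iter_deriv_lift_periodic[OF assms(1)]) auto
  then show ?case by simp
next
  case (Suc k)
  have cinf: "C_infinity F" using assms(1) by (simp add: is_smooth_lift_def)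
  have "\<exists>B. \<forall>vs x. length vs = k \<and> (\<forall>v\<in>set vs. norm v \<le> 1) \<longrightarrow> norm (iter_deriv (vs @ (b # bs)) F x) \<le> B" for b
    by (rule Suc.IH) simp
  then obtain B where B: "\<And>b vs x. length vs = k \<Longrightarrow> (\<forall>v\<in>set vs. norm v \<le> 1) \<Longrightarrow> norm (iter_deriv (vs @ (b # bs)) F x) \<le> B b"
    by metis
  have "norm (iter_deriv (vs @ bs) F x) \<le> (\<Sum>b\<in>Basis. B b)"
    if len: "length vs = Suc k" and unit: "\<forall>v\<in>set vs. norm v \<le> 1" for vs x
  proof -
    obtain us v where vs: "vs = us @ [v]" using len by (metis length_Suc_conv_rev)
    have us: "length us = k" "\<forall>v\<in>set us. norm v \<le> 1" and v: "norm v \<le> 1" using len unit vs by auto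
    have "iter_deriv (vs @ bs) F = iter_deriv us (\<lambda>x. \<Sum>b\<in>Basis. (v \<bullet> b) *\<^sub>R iter_deriv (b # bs) F x)"
      unfolding vs append_assoc append_Cons append_Nil
      by (subst iter_deriv_append) (simp only: iter_deriv_Cons_basis[OF cinf, of v])
    also have "\<dots> = (\<lambda>x. \<Sum>b\<in>Basis. (v \<bullet> b) *\<^sub>R iter_deriv (us @ (b # bs)) F x)"
      unfolding iter_deriv_append by (intro iter_deriv_sum C_infinity_iter_deriv cinf) simp
    finally have "iter_deriv (vs @ bs) F x = (\<Sum>b\<in>Basis. (v \<bullet> b) *\<^sub>R iter_deriv (us @ (b # bs)) F x)" by simp
    also have "norm \<dots> \<le> (\<Sum>b\<in>Basis. B b)"
    proof (rule sum_norm_le)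
      fix b :: "real^2" assume b: "b \<in> Basis"
      have "\<bar>v \<bullet> b\<bar> \<le> 1" using Basis_le_norm[OF b, of v] v by simp
      then have "norm ((v \<bullet> b) *\<^sub>R iter_deriv (us @ (b # bs)) F x) \<le> 1 * B b"
        unfolding norm_scaleR using B[OF us] by (intro mult_mono) auto
      then show "norm ((v \<bullet> b) *\<^sub>R iter_deriv (us @ (b # bs)) F x) \<le> B b" by simp
    qed
    finally show ?thesis .
  qed
  then show ?case by blast
qed

text \<open>A real supremum is an upper bound only over a bounded set. These bounds make the suprema
  inside the metric usable.\<close>

lemma iter_deriv_diff_le_norm_deriv_diff:
  assumes F: "is_smooth_lift F f" and G: "is_smooth_lift G g" and k: "k > 0"
  shows "\<exists>B. (\<forall>x. norm_deriv_diff k F G x \<le> B)"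
    and "length vs = k \<Longrightarrow> \<forall>v\<in>set vs. norm v \<le> 1 \<Longrightarrow>
      norm (iter_deriv vs F x - iter_deriv vs G x) \<le> norm_deriv_diff k F G x"
proof -
  let ?S = "{vs::(real^2) list. length vs = k \<and> (\<forall>v\<in>set vs. norm v \<le> 1)}"
  obtain B1 where B1: "\<And>vs x. vs \<in> ?S \<Longrightarrow> norm (iter_deriv vs F x) \<le> B1"
    using iter_deriv_lift_bounded[OF F, of k "[]"] k by auto
  obtain B2 where B2: "\<And>vs x. vs \<in> ?S \<Longrightarrow> norm (iter_deriv vs G x) \<le> B2"
    using iter_deriv_lift_bounded[OF G, of k "[]"] k by auto
  have B: "norm (iter_deriv vs F x - iter_deriv vs G x) \<le> B1 + B2" if "vs \<in> ?S" for vs x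
    using norm_triangle_ineq4[of "iter_deriv vs F x" "iter_deriv vs G x"] B1[OF that, of x] B2[OF that, of x] by linarith
  have "replicate k 0 \<in> ?S" by simp
  then have "norm_deriv_diff k F G x \<le> B1 + B2" for x
    unfolding norm_deriv_diff_def by (intro cSUP_least B) blast+
  then show "\<exists>B. \<forall>x. norm_deriv_diff k F G x \<le> B" by blast
  show "norm (iter_deriv vs F x - iter_deriv vs G x) \<le> norm_deriv_diff k F G x"
    if "length vs = k" "\<forall>v\<in>set vs. norm v \<le> 1"
    unfolding norm_deriv_diff_def
    by (rule cSUP_upper) (use that B in \<open>auto intro!: bdd_aboveI2\<close>)
qed

section \<open>From the metric to bounds on derivatives\<close>

lemma dist_torus_le_2: "dist (x::torus) y \<le> 2"
proof -
  let ?a = "rep_torus x - rep_torus y"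
  let ?m = "(\<chi> i. - floor (?a $ i)) :: int^2"
  have c: "\<bar>(?a + of_int_vec ?m) $ i\<bar> \<le> 1" for i
    by (simp add: of_int_vec_def) linarith
  have "dist x y \<le> norm (?a + of_int_vec ?m)" by (rule dist_torus_le)
  also have "\<dots> \<le> (\<Sum>i\<in>UNIV. \<bar>(?a + of_int_vec ?m) $ i\<bar>)" by (rule norm_le_l1_cart)
  also have "\<dots> \<le> (\<Sum>i\<in>(UNIV::2 set). 1)" by (intro sum_mono c)
  finally show ?thesis by simp
qed

lemma dist_le_dist_Ck_0: "dist (f x) (g x) \<le> dist_Ck 0 f g"
  unfolding dist_Ck.simps by (rule cSUP_upper) (auto intro!: bdd_aboveI2[where M=2] dist_torus_le_2)

lemma dist_Ck_mono: "k \<le> l \<Longrightarrow> dist_Ck k f g \<le> dist_Ck l f g"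
  by (rule lift_Suc_mono_le[of "\<lambda>k. dist_Ck k f g"]) auto

lemma dist_Ck_nonneg: "0 \<le> dist_Ck k f g"
  using dist_Ck_mono[of 0 k f g] dist_le_dist_Ck_0[of f undefined g]
  by (meson le0 order_trans zero_le_dist)

lemma iter_deriv_diff_le_dist_Ck:
  assumes "smooth_torus_map f" "smooth_torus_map g" "vs \<noteq> []" "length vs \<le> k" "\<forall>v\<in>set vs. norm v \<le> 1"
  shows "norm (iter_deriv vs (smooth_lift f) x - iter_deriv vs (smooth_lift g) x) \<le> dist_Ck k f g"
proof -
  note F = is_smooth_lift_smooth_lift[OF assms(1)] and G = is_smooth_lift_smooth_lift[OF assms(2)]
  obtain n where n: "length vs = Suc n" using assms(3) by (cases vs) auto
  have "norm (iter_deriv vs (smooth_lift f) x - iter_deriv vs (smooth_lift g) x)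
      \<le> norm_deriv_diff (Suc n) (smooth_lift f) (smooth_lift g) x"
    using iter_deriv_diff_le_norm_deriv_diff(2)[OF F G] n assms(5) by simp
  also have "\<dots> \<le> (SUP x. norm_deriv_diff (Suc n) (smooth_lift f) (smooth_lift g) x)"
    using iter_deriv_diff_le_norm_deriv_diff(1)[OF F G, of "Suc n"] by (intro cSUP_upper) (auto intro: bdd_aboveI2)
  also have "\<dots> \<le> dist_Ck (Suc n) f g" by simp
  also have "\<dots> \<le> dist_Ck k f g" using n assms(4) by (intro dist_Ck_mono) simp
  finally show ?thesis .
qed

text \<open>One term of the series gives \<open>d / (1 + d) \<le> 2 ^ k * \<epsilon>\<close> for the
  \<open>k\<close>-th distance \<open>d\<close>. With the right side at most 1/2, the
  \<open>d\<close> in the denominator is absorbed at the cost of a factor 2.\<close>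

lemma dist_Ck_le_dist_Cinfinity:
  assumes "dist_Cinfinity f g \<le> \<epsilon>" "2 ^ k * \<epsilon> \<le> 1 / 2"
  shows "dist_Ck k f g \<le> 2 * 2 ^ k * \<epsilon>"
proof -
  let ?d = "\<lambda>k. dist_Ck k f g"
  let ?t = "\<lambda>k. (1/2) ^ k * (?d k / (1 + ?d k))"
  have d: "0 \<le> ?d k / (1 + ?d k)" "?d k / (1 + ?d k) \<le> 1" for k
    using dist_Ck_nonneg[of k f g] by auto
  have tn: "0 \<le> ?t n" for n using d(1)[of n] by (intro mult_nonneg_nonneg) auto
  have "summable ?t"
  proof (rule summable_comparison_test'[of "\<lambda>k. (1/2::real) ^ k" 0])
    show "norm (?t n) \<le> (1/2) ^ n" for n
    proof -
      have "norm (?t n) = ?t n" using tn by (simp only: real_norm_def abs_of_nonneg)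
      also have "\<dots> \<le> (1/2) ^ n" by (intro mult_left_le d) auto
      finally show ?thesis .
    qed
  qed (simp add: summable_geometric)
  then have "sum ?t {k} \<le> suminf ?t"
    by (rule sum_le_suminf) (use tn in auto)
  then have "?t k \<le> \<epsilon>" using assms(1) by (simp add: dist_Cinfinity_def)
  then have "?d k / (1 + ?d k) \<le> 2 ^ k * \<epsilon>"
    using mult_left_mono[of "?t k" \<epsilon> "2 ^ k"] by (simp add: power_one_over)
  then have a: "?d k \<le> (2 ^ k * \<epsilon>) * (1 + ?d k)"
    using dist_Ck_nonneg[of k f g] by (simp add: pos_divide_le_eq add_pos_nonneg)
  have "(2 ^ k * \<epsilon>) * ?d k \<le> 1/2 * ?d k"
    using assms(2) dist_Ck_nonneg by (rule mult_right_mono)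
  with a show ?thesis by (simp add: distrib_left)
qed

abbreviation real_mat :: "int^2^2 \<Rightarrow> real^2^2" where
  "real_mat A \<equiv> map_matrix of_int A"

lemma torus_map_of_matrix_proj: "torus_map_of_matrix A (proj_torus x) = proj_torus (real_mat A *v x)"
  by (rule torus_map_of_matrix.abs_eq)

lemma iter_deriv_affine:
  fixes vs :: "(real^2) list" and B :: "real^2^2"
  assumes "\<And>x. G x = B *v x + c"
  shows "iter_deriv [v] G = (\<lambda>x. B *v v)" "length vs \<ge> 2 \<Longrightarrow> iter_deriv vs G = (\<lambda>x. 0)" "C_infinity G"
proof -
  have "(G has_derivative (\<lambda>h. B *v h)) (at x)" for x
    unfolding assms[abs_def]
    by (intro has_derivative_add_const bounded_linear_imp_has_derivative matrix_vector_mul_bounded_linear)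
  note G = frechet_derivative_at[OF this, symmetric] this
  show one: "iter_deriv [v] G = (\<lambda>x. B *v v)" for v using G(1) by (simp add: fun_eq_iff)
  have two: "iter_deriv (vs @ [u, v]) G = (\<lambda>x. 0)" for vs u v
  proof (induction vs)
    case Nil
    then show ?case by (simp only: append_Nil iter_deriv.simps(2)[of u "[v]"] one frechet_derivative_const)
  qed (simp add: frechet_derivative_const)
  show long: "iter_deriv vs G = (\<lambda>x. 0)" if "length vs \<ge> 2" for vs :: "(real^2) list"
  proof -
    define ws where "ws = drop (length vs - 2) vs"
    have "length ws = 2" using that by (simp add: ws_def)
    then obtain u v where "ws = [u, v]" by (cases ws; cases "tl ws") auto
    moreover have "vs = take (length vs - 2) vs @ ws" by (simp add: ws_def)
    ultimately obtain us where "vs = us @ [u, v]" by metis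
    then show ?thesis by (simp only: two)
  qed
  show "C_infinity G" unfolding C_infinity_def
  proof (intro allI)
    fix vs :: "(real^2) list" and x
    consider "vs = []" | v where "vs = [v]" | "length vs \<ge> 2"
      by (cases vs; cases "tl vs") auto
    then show "iter_deriv vs G differentiable (at x)"
    proof cases
      case 1
      then show ?thesis by (simp only: iter_deriv.simps(1)) (rule differentiableI[OF G(2)])
    next
      case (2 v)
      then show ?thesis by (simp only: one differentiable_const)
    next
      case 3
      then show ?thesis by (simp only: long differentiable_const)
    qed
  qed
qed

lemma is_smooth_lift_matrix: "is_smooth_lift ((*v) (real_mat A)) (torus_map_of_matrix A)"
  unfolding is_smooth_lift_def
  using iter_deriv_affine(3)[of "(*v) (real_mat A)" "real_mat A" 0] by (simp add: torus_map_of_matrix_proj)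

text \<open>\<open>smooth_lift\<close> is an arbitrary choice among lifts, so it agrees with the
  linear map only up to a constant, which derivatives do not see.\<close>

lemma smooth_lift_matrix: "\<exists>c. \<forall>x. smooth_lift (torus_map_of_matrix A) x = real_mat A *v x + c"
proof -
  let ?G = "smooth_lift (torus_map_of_matrix A)"
  have G: "is_smooth_lift ?G (torus_map_of_matrix A)"
    using is_smooth_lift_matrix by (intro is_smooth_lift_smooth_lift) (auto simp: smooth_torus_map_def)
  have "(\<lambda>x. ?G x - real_mat A *v x) constant_on UNIV"
  proof (rule lattice_valued_constant)
    show "continuous_on UNIV (\<lambda>x. ?G x - real_mat A *v x)"
      by (intro continuous_intros continuous_on_lift[OF G] linear_continuous_on matrix_vector_mul_bounded_linear)
    fix x
    have "proj_torus (?G x) = proj_torus (real_mat A *v x)"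
      using G unfolding is_smooth_lift_def by (metis torus_map_of_matrix_proj)
    then obtain n where "?G x = real_mat A *v x + of_int_vec n"
      unfolding proj_torus_eq_iff lattice_equiv_def by blast
    then show "\<exists>n. ?G x - real_mat A *v x = of_int_vec n" by auto
  qed
  then obtain d where "?G x - real_mat A *v x = d" for x by (auto simp: constant_on_def)
  then have "?G x = real_mat A *v x + d" for x by (simp add: diff_eq_eq add.commute)
  then show ?thesis by blast
qed

text \<open>Three integrations by parts of a phase whose gradient involves the first derivative of
  \<open>F\<close> use derivatives up to order 4. At \<open>k = 4\<close> the constant is
  \<open>2 * 2 ^ 4 = 32\<close>, and \<open>\<epsilon> \<le> 1 / 32\<close> is the absorption
  condition. The model is affine, so its derivatives of order at least 2 vanish and those of
  \<open>F\<close> are themselves small.\<close>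

lemma near_matrix_lift:
  assumes f: "smooth_torus_map f" and d: "dist_Cinfinity f (torus_map_of_matrix A) \<le> \<epsilon>" and \<epsilon>: "\<epsilon> \<le> 1 / 32"
  obtains F where "is_smooth_lift F f"
    "\<And>v x. norm v \<le> 1 \<Longrightarrow> norm (iter_deriv [v] F x - real_mat A *v v) \<le> 32 * \<epsilon>"
    "\<And>vs x. 2 \<le> length vs \<Longrightarrow> length vs \<le> 4 \<Longrightarrow> \<forall>v\<in>set vs. norm v \<le> 1 \<Longrightarrow> norm (iter_deriv vs F x) \<le> 32 * \<epsilon>"
    "\<And>x. dist (f x) (torus_map_of_matrix A x) \<le> 32 * \<epsilon>"
proof (rule that[of "smooth_lift f"])
  have d4: "dist_Ck 4 f (torus_map_of_matrix A) \<le> 32 * \<epsilon>"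
    using dist_Ck_le_dist_Cinfinity[OF d, of 4] \<epsilon> by simp
  have A: "smooth_torus_map (torus_map_of_matrix A)"
    using is_smooth_lift_matrix by (auto simp: smooth_torus_map_def)
  obtain c where c: "\<And>x. smooth_lift (torus_map_of_matrix A) x = real_mat A *v x + c"
    using smooth_lift_matrix by blast
  note D = order_trans[OF iter_deriv_diff_le_dist_Ck[OF f A, where k=4] d4]
  show "is_smooth_lift (smooth_lift f) f" by (rule is_smooth_lift_smooth_lift[OF f])
  show "norm (iter_deriv [v] (smooth_lift f) x - real_mat A *v v) \<le> 32 * \<epsilon>" if "norm v \<le> 1" for v x
    using D[of "[v]" x] that by (simp add: iter_deriv_affine(1)[OF c] del: iter_deriv.simps)
  show "norm (iter_deriv vs (smooth_lift f) x) \<le> 32 * \<epsilon>"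
    if "2 \<le> length vs" "length vs \<le> 4" "\<forall>v\<in>set vs. norm v \<le> 1" for vs x
  proof -
    have "vs \<noteq> []" using that(1) by auto
    then show ?thesis
      using D[of vs x] that by (simp add: iter_deriv_affine(2)[OF c] del: iter_deriv.simps)
  qed
  show "dist (f x) (torus_map_of_matrix A x) \<le> 32 * \<epsilon>" for x
    using dist_le_dist_Ck_0[of f x "torus_map_of_matrix A"] dist_Ck_mono[of 0 4 f "torus_map_of_matrix A"] d4 by simp
qed


section \<open>Fourier matrix of the transfer operator\<close>

text \<open>A small torus distance is nearly attained by some translate of the representative, and
  continuity of the lift applies at that translate.\<close>

lemma continuous_torus_map:
  assumes G: "continuous_on UNIV G" and g: "\<And>x. g (proj_torus x) = proj_torus (G x)"
  shows "continuous_on UNIV (g :: torus \<Rightarrow> torus)"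
  unfolding continuous_on_iff
proof (intro ballI allI impI)
  fix y :: torus and e :: real assume e: "e > 0"
  obtain d where d: "d > 0" "\<And>x. dist x (rep_torus y) < d \<Longrightarrow> dist (G x) (G (rep_torus y)) < e"
    using G e unfolding continuous_on_iff by (metis UNIV_I)
  have "dist (g z) (g y) < e" if z: "dist z y < d" for z
  proof -
    have "\<exists>m. norm (rep_torus z - rep_torus y + of_int_vec m) < d"
    proof (rule ccontr)
      assume "\<nexists>m. norm (rep_torus z - rep_torus y + of_int_vec m) < d"
      then have "d \<le> dist z y"
        unfolding dist_torus_def by (intro cINF_greatest) (auto simp: not_less)
      then show False using z by simp
    qed
    then obtain m where m: "norm (rep_torus z - rep_torus y + of_int_vec m) < d" by blast
    have z': "proj_torus (rep_torus z + of_int_vec m) = z"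
      using proj_rep_torus[of z] unfolding proj_torus_eq_iff[symmetric] lattice_equiv_def
      by (metis lattice_equiv_def proj_torus_eq_iff)
    have "dist (g z) (g y) = dist (proj_torus (G (rep_torus z + of_int_vec m))) (proj_torus (G (rep_torus y)))"
      using g[of "rep_torus z + of_int_vec m"] g[of "rep_torus y"] by (simp add: z' proj_rep_torus)
    also have "\<dots> \<le> dist (G (rep_torus z + of_int_vec m)) (G (rep_torus y))"
      using dist_proj_torus_le by (simp add: dist_norm)
    also have "\<dots> < e" using m by (intro d(2)) (simp add: dist_norm algebra_simps)
    finally show ?thesis .
  qed
  then show "\<exists>d>0. \<forall>z\<in>UNIV. dist z y < d \<longrightarrow> dist (g z) (g y) < e" using d(1) by blast
qed

lemma smooth_torus_map_measurable:
  assumes "smooth_torus_map g"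
  shows "g \<in> borel_measurable borel"
proof -
  obtain G where G: "is_smooth_lift G g" using assms unfolding smooth_torus_map_def by blast
  show ?thesis
    using G continuous_on_lift[OF G] unfolding is_smooth_lift_def
    by (intro borel_measurable_continuous_onI continuous_torus_map[of G]) auto
qed

section \<open>Absolutely summable Fourier series\<close>

definition fourier_series :: "(int^2 \<Rightarrow> complex) \<Rightarrow> torus \<Rightarrow> complex" where
  "fourier_series a x = (\<Sum>\<^sub>\<infinity>k. a k * fourier_mode k x)"

text \<open>The remainder bound does not involve \<open>x\<close>. Uniform convergence, hence
  continuity, and termwise integration both rest on it.\<close>

lemma fourier_series_tail:
  assumes a: "(\<lambda>k. norm (a k)) summable_on UNIV" and K: "finite K"
  shows "cmod (fourier_series a x - (\<Sum>k\<in>K. a k * fourier_mode k x))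
     \<le> (\<Sum>\<^sub>\<infinity>k. cmod (a k)) - (\<Sum>k\<in>K. cmod (a k))"
proof -
  let ?t = "\<lambda>k. a k * fourier_mode k x"
  have t: "(\<lambda>k. norm (?t k)) summable_on UNIV" using a by (simp add: norm_mult)
  then have s: "?t summable_on UNIV" by (rule Infinite_Sum.abs_summable_summable)
  have "infsum ?t UNIV = infsum ?t (UNIV - K) + infsum ?t K"
    using infsum_Un_disjoint[of ?t "UNIV - K" K] summable_on_subset_banach[OF s] by auto
  then have "cmod (fourier_series a x - (\<Sum>k\<in>K. ?t k)) = cmod (infsum ?t (UNIV - K))"
    using K by (simp add: fourier_series_def)
  also have "\<dots> \<le> infsum (\<lambda>k. cmod (?t k)) (UNIV - K)"
    by (rule norm_infsum_bound) (rule summable_on_subset_banach[OF t], simp)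
  also have "\<dots> = infsum (\<lambda>k. cmod (a k)) (UNIV - K)" by (simp add: norm_mult)
  also have "\<dots> = (\<Sum>\<^sub>\<infinity>k. cmod (a k)) - (\<Sum>k\<in>K. cmod (a k))"
    using infsum_Diff[OF a, of K] K by simp
  finally show ?thesis .
qed

lemma abs_summable_remainder:
  fixes a :: "'i \<Rightarrow> 'b::real_normed_vector"
  assumes "(\<lambda>k. norm (a k)) summable_on UNIV"
  shows "((\<lambda>K. (\<Sum>\<^sub>\<infinity>k. norm (a k)) - (\<Sum>k\<in>K. norm (a k))) \<longlongrightarrow> 0) (finite_subsets_at_top UNIV)"
proof -
  have "((\<lambda>K. \<Sum>k\<in>K. norm (a k)) \<longlongrightarrow> (\<Sum>\<^sub>\<infinity>k. norm (a k))) (finite_subsets_at_top UNIV)"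
    using has_sum_infsum[OF assms] unfolding has_sum_def .
  from tendsto_diff[OF tendsto_const this, of "\<Sum>\<^sub>\<infinity>k. norm (a k)"] show ?thesis by simp
qed

lemma continuous_on_fourier_series:
  assumes a: "(\<lambda>k. norm (a k)) summable_on UNIV"
  shows "continuous_on UNIV (fourier_series a)"
proof (rule uniform_limit_theorem)
  show "uniform_limit UNIV (\<lambda>K x. \<Sum>k\<in>K. a k * fourier_mode k x) (fourier_series a) (finite_subsets_at_top UNIV)"
  proof (rule uniform_limitI)
    fix e :: real assume "e > 0"
    with abs_summable_remainder[OF a]
    have "\<forall>\<^sub>F K in finite_subsets_at_top UNIV. \<bar>(\<Sum>\<^sub>\<infinity>k. cmod (a k)) - (\<Sum>k\<in>K. cmod (a k))\<bar> < e"
      by (auto simp: tendsto_iff dist_real_def)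
    moreover have "\<forall>\<^sub>F K in finite_subsets_at_top (UNIV::(int^2) set). finite K"
      by (simp add: eventually_finite_subsets_at_top_weakI)
    ultimately show "\<forall>\<^sub>F K in finite_subsets_at_top UNIV. \<forall>x\<in>UNIV. dist (\<Sum>k\<in>K. a k * fourier_mode k x) (fourier_series a x) < e"
    proof eventually_elim
      case (elim K)
      then show ?case using fourier_series_tail[OF a, of K]
        by (smt (verit) dist_commute dist_norm)
    qed
  qed
qed (auto intro!: always_eventually continuous_intros continuous_on_fourier_mode)

lemma measurable_fourier_series: "(\<lambda>k. norm (a k)) summable_on UNIV \<Longrightarrow> fourier_series a \<in> borel_measurable borel"
  by (rule borel_measurable_continuous_onI[OF continuous_on_fourier_series])

lemma cmod_fourier_series_le:
  "(\<lambda>k. norm (a k)) summable_on UNIV \<Longrightarrow> cmod (fourier_series a x) \<le> (\<Sum>\<^sub>\<infinity>k. cmod (a k))"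
  using fourier_series_tail[of a "{}" x] by simp

lemma has_sum_integral_fourier_series:
  assumes a: "(\<lambda>k. norm (a k)) summable_on UNIV"
    and h [measurable]: "h \<in> borel_measurable borel" and h1: "\<And>x. cmod (h x) \<le> 1"
  shows "((\<lambda>k. a k * (\<integral>x. fourier_mode k x * h x \<partial>haar_torus)) has_sum
     (\<integral>x. fourier_series a x * h x \<partial>haar_torus)) UNIV"
  unfolding has_sum_def
proof (rule LIM_zero_cancel, rule Lim_null_comparison[OF _ abs_summable_remainder[OF a]])
  note [measurable] = measurable_fourier_series[OF a]
  show "\<forall>\<^sub>F K in finite_subsets_at_top UNIV.
      norm ((\<Sum>k\<in>K. a k * (\<integral>x. fourier_mode k x * h x \<partial>haar_torus)) - (\<integral>x. fourier_series a x * h x \<partial>haar_torus))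
      \<le> (\<Sum>\<^sub>\<infinity>k. norm (a k)) - (\<Sum>k\<in>K. norm (a k))"
  proof (rule eventually_finite_subsets_at_top_weakI)
    fix K :: "(int^2) set" assume K: "finite K"
    let ?R = "(\<Sum>\<^sub>\<infinity>k. norm (a k)) - (\<Sum>k\<in>K. norm (a k))"
    have i1: "integrable haar_torus (\<lambda>x. fourier_mode k x * h x)" for k
      by (rule integrable_haar_bounded[where B=1]) (auto simp: norm_mult h1)
    have i2: "integrable haar_torus (\<lambda>x. fourier_series a x * h x)"
    proof (rule integrable_haar_bounded)
      show "norm (fourier_series a x * h x) \<le> (\<Sum>\<^sub>\<infinity>k. cmod (a k)) * 1" for x
        unfolding norm_mult by (intro mult_mono h1 cmod_fourier_series_le[OF a] infsum_nonneg) auto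
    qed measurable
    have "(\<Sum>k\<in>K. a k * (\<integral>x. fourier_mode k x * h x \<partial>haar_torus)) - (\<integral>x. fourier_series a x * h x \<partial>haar_torus)
        = (\<integral>x. (\<Sum>k\<in>K. a k * (fourier_mode k x * h x)) - fourier_series a x * h x \<partial>haar_torus)"
      using i1 i2 by (simp add: Bochner_Integration.integral_diff)
    also have "norm \<dots> \<le> ?R"
    proof (rule norm_integral_haar_le)
      fix x
      have "norm ((\<Sum>k\<in>K. a k * (fourier_mode k x * h x)) - fourier_series a x * h x)
          = norm (fourier_series a x - (\<Sum>k\<in>K. a k * fourier_mode k x)) * norm (h x)"
        by (simp add: norm_minus_commute left_diff_distrib sum_distrib_right mult.assoc flip: norm_mult)
      also have "\<dots> \<le> ?R * 1"
        using fourier_series_tail[OF a K, of x] h1[of x] norm_ge_zero order_trans by (intro mult_mono) blast+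
      finally show "norm ((\<Sum>k\<in>K. a k * (fourier_mode k x * h x)) - fourier_series a x * h x) \<le> ?R" by simp
    next
      show "0 \<le> ?R" using fourier_series_tail[OF a K] norm_ge_zero order_trans by blast
    qed
    finally show "norm ((\<Sum>k\<in>K. a k * (\<integral>x. fourier_mode k x * h x \<partial>haar_torus)) - (\<integral>x. fourier_series a x * h x \<partial>haar_torus)) \<le> ?R" .
  qed
qed

lemma fourier_coeff_fourier_series:
  assumes a: "(\<lambda>k. norm (a k)) summable_on UNIV"
  shows "fourier_coeff (fourier_series a) j = a j"
proof -
  have "((\<lambda>k. a k * (\<integral>x. fourier_mode k x * cnj (fourier_mode j x) \<partial>haar_torus)) has_sum fourier_coeff (fourier_series a) j) UNIV"
    unfolding fourier_coeff_def by (rule has_sum_integral_fourier_series[OF a]) auto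
  then have h: "((\<lambda>k. a k * (if k = j then 1 else 0)) has_sum fourier_coeff (fourier_series a) j) UNIV"
    by (simp add: fourier_mode_mult_cnj integral_fourier_mode)
  have "((\<lambda>k. a k * (if k = j then 1 else 0)) has_sum a j) UNIV"
    using has_sum_finite_neutralI[of "{j}" UNIV "\<lambda>k. a k * (if k = j then 1 else 0)"] by simp
  with h show ?thesis by (rule has_sum_unique)
qed

text \<open>The entry \<langle>e_k \<circ> f^(-1), e_j\<rangle> after substituting \<open>f\<close>,
  which preserves the measure. In this form only \<open>f\<close> and its lift occur, and it is
  \<open>f\<close>, not \<open>inv f\<close>, whose closeness to the linear map is given.\<close>

definition transfer_entry :: "(torus \<Rightarrow> torus) \<Rightarrow> int^2 \<Rightarrow> int^2 \<Rightarrow> complex" where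
  "transfer_entry f j k = (\<integral>x. fourier_mode k x * cnj (fourier_mode j (f x)) \<partial>haar_torus)"

locale volume_preserving_diffeo =
  fixes f :: "torus \<Rightarrow> torus"
  assumes smooth: "smooth_torus_diffeo f" and vol: "volume_preserving f"
begin

lemma bij: "bij f"
  using smooth by (simp add: smooth_torus_diffeo_def)

lemma inv_f [simp]: "inv f (f x) = x"
  using bij by (simp add: bij_is_inj)

lemma measurable_f [measurable]: "f \<in> borel_measurable borel"
  using smooth smooth_torus_map_measurable by (simp add: smooth_torus_diffeo_def)

lemma measurable_inv_f [measurable]: "inv f \<in> borel_measurable borel"
  using smooth smooth_torus_map_measurable by (simp add: smooth_torus_diffeo_def)

lemma integral_comp:
  fixes \<phi> :: "torus \<Rightarrow> 'b::{banach, second_countable_topology}"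
  assumes [measurable]: "\<phi> \<in> borel_measurable borel"
  shows "(\<integral>x. \<phi> (f x) \<partial>haar_torus) = (\<integral>x. \<phi> x \<partial>haar_torus)"
proof -
  have "f \<in> measurable haar_torus haar_torus" by measurable
  then have "(\<integral>x. \<phi> (f x) \<partial>haar_torus) = (\<integral>x. \<phi> x \<partial>(distr haar_torus haar_torus f))"
    by (subst integral_distr) auto
  also have "distr haar_torus haar_torus f = haar_torus" using vol by (simp add: volume_preserving_def)
  finally show ?thesis .
qed

lemma fourier_coeff_transfer:
  assumes [measurable]: "\<phi> \<in> borel_measurable borel"
  shows "fourier_coeff (transfer_op f \<phi>) j = (\<integral>x. \<phi> x * cnj (fourier_mode j (f x)) \<partial>haar_torus)"
proof -
  have "fourier_coeff (transfer_op f \<phi>) j = (\<integral>x. \<phi> (inv f (f x)) * cnj (fourier_mode j (f x)) \<partial>haar_torus)"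
    unfolding fourier_coeff_def transfer_op_def o_def
    by (rule integral_comp[symmetric]) measurable
  then show ?thesis by simp
qed

lemma has_sum_fourier_coeff_transfer:
  assumes "(\<lambda>k. norm (a k)) summable_on UNIV"
  shows "((\<lambda>k. a k * transfer_entry f j k) has_sum fourier_coeff (transfer_op f (fourier_series a)) j) UNIV"
  unfolding fourier_coeff_transfer[OF measurable_fourier_series[OF assms]] transfer_entry_def
  by (rule has_sum_integral_fourier_series[OF assms]) auto

lemma integrable_entry [simp]: "integrable haar_torus (\<lambda>x. fourier_mode k x * cnj (fourier_mode j (f x)))"
  by (rule integrable_haar_bounded[where B=1]) (auto simp: norm_mult)

text \<open>Bessel's inequality for the transferred trigonometric polynomial, then invariance of the
  measure and Parseval.\<close>

lemma transfer_entry_contraction: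
  assumes J: "finite J" and K: "finite K"
  shows "(\<Sum>j\<in>J. (cmod (\<Sum>k\<in>K. transfer_entry f j k * c k))\<^sup>2) \<le> (\<Sum>k\<in>K. (cmod (c k))\<^sup>2)"
proof -
  let ?s = "\<lambda>x. \<Sum>k\<in>K. c k * fourier_mode k x"
  have "fourier_coeff (transfer_op f ?s) j = (\<Sum>k\<in>K. transfer_entry f j k * c k)" for j
  proof -
    have "fourier_coeff (transfer_op f ?s) j = (\<integral>x. ?s x * cnj (fourier_mode j (f x)) \<partial>haar_torus)"
      by (rule fourier_coeff_transfer) measurable
    also have "\<dots> = (\<integral>x. (\<Sum>k\<in>K. c k * (fourier_mode k x * cnj (fourier_mode j (f x)))) \<partial>haar_torus)"
      by (simp add: sum_distrib_right mult.assoc)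
    also have "\<dots> = (\<Sum>k\<in>K. c k * transfer_entry f j k)"
      by (simp add: transfer_entry_def)
    finally show ?thesis by (simp add: mult.commute)
  qed
  then have "(\<Sum>j\<in>J. (cmod (\<Sum>k\<in>K. transfer_entry f j k * c k))\<^sup>2)
      = (\<Sum>j\<in>J. (cmod (fourier_coeff (transfer_op f ?s) j))\<^sup>2)" by simp
  also have "\<dots> \<le> (\<integral>x. (cmod (transfer_op f ?s x))\<^sup>2 \<partial>haar_torus)"
    unfolding transfer_op_def o_def
    by (rule bessel_finite[where B="\<Sum>k\<in>K. cmod (c k)"]) (use J cmod_trig_sum_le in auto)
  also have "\<dots> = (\<integral>x. (cmod (transfer_op f ?s (f x)))\<^sup>2 \<partial>haar_torus)"
    unfolding transfer_op_def o_def by (rule integral_comp[symmetric]) measurable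
  also have "\<dots> = (\<Sum>k\<in>K. (cmod (c k))\<^sup>2)"
    using parseval_finite[OF K] by (simp add: transfer_op_def)
  finally show ?thesis .
qed

lemma transfer_entry_0_left: "k \<noteq> 0 \<Longrightarrow> transfer_entry f 0 k = 0"
  by (simp add: transfer_entry_def integral_fourier_mode)

text \<open>On the linear map e_k = e_k' \<circ> f_A, so e_k \<circ> f^(-1) is uniformly close to
  e_k' by the Lipschitz bound for characters. Bessel turns this into closeness of column
  \<open>k\<close> to the unit vector at \<open>k'\<close>.\<close>

lemma transfer_entry_column:
  assumes close: "\<And>x. dist (f x) (torus_map_of_matrix A x) \<le> d" and J: "finite J"
    and k: "transpose A *v k' = k"
  shows "(\<Sum>j\<in>J. (cmod (transfer_entry f j k - (if j = k' then 1 else 0)))\<^sup>2) \<le> (2 * pi * norm (of_int_vec k') * d)\<^sup>2"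
proof -
  let ?g = "\<lambda>x. transfer_op f (fourier_mode k) x - fourier_mode k' x"
  have gm [measurable]: "transfer_op f (fourier_mode k) \<in> borel_measurable borel"
    unfolding transfer_op_def o_def by measurable
  have gb: "cmod (?g x) \<le> 2 * pi * norm (of_int_vec k') * d" for x
  proof -
    obtain y where y: "x = f y" using bij by (meson bij_pointE)
    have "fourier_mode k y = fourier_mode k' (torus_map_of_matrix A y)"
    proof -
      have "of_int_vec k \<bullet> z = of_int_vec k' \<bullet> (real_mat A *v z)" for z :: "real^2"
        unfolding k[symmetric] by (simp add: inner_vec_def of_int_vec_def matrix_vector_mult_def transpose_def sum_2 algebra_simps)
      then show ?thesis
        using fourier_mode_proj[of k "rep_torus y"] fourier_mode_proj[of k' "real_mat A *v rep_torus y"]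
        by (simp add: torus_map_of_matrix_proj[symmetric] proj_rep_torus)
    qed
    then have "cmod (?g x) = cmod (fourier_mode k' (torus_map_of_matrix A y) - fourier_mode k' (f y))"
      by (simp add: transfer_op_def y)
    also have "\<dots> \<le> 2 * pi * norm (of_int_vec k') * dist (torus_map_of_matrix A y) (f y)"
      by (rule fourier_mode_lipschitz)
    also have "\<dots> \<le> 2 * pi * norm (of_int_vec k') * d"
      using close[of y] by (intro mult_left_mono) (auto simp: dist_commute)
    finally show ?thesis .
  qed
  have coeff: "fourier_coeff ?g j = transfer_entry f j k - (if j = k' then 1 else 0)" for j
  proof -
    have 1: "integrable haar_torus (\<lambda>x. transfer_op f (fourier_mode k) x * cnj (fourier_mode j x))"
      by (rule integrable_haar_bounded[where B=1]) (auto simp: norm_mult transfer_op_def)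
    have 2: "integrable haar_torus (\<lambda>x. fourier_mode k' x * cnj (fourier_mode j x))"
      by (simp add: fourier_mode_mult_cnj)
    have "fourier_coeff ?g j = fourier_coeff (transfer_op f (fourier_mode k)) j - (\<integral>x. fourier_mode k' x * cnj (fourier_mode j x) \<partial>haar_torus)"
      unfolding fourier_coeff_def using 1 2 by (simp add: left_diff_distrib Bochner_Integration.integral_diff)
    then show ?thesis
      by (cases "j = k'") (simp_all add: fourier_coeff_transfer transfer_entry_def fourier_mode_mult_cnj integral_fourier_mode)
  qed
  have "(\<Sum>j\<in>J. (cmod (transfer_entry f j k - (if j = k' then 1 else 0)))\<^sup>2) = (\<Sum>j\<in>J. (cmod (fourier_coeff ?g j))\<^sup>2)"
    by (simp add: coeff)
  also have "\<dots> \<le> (\<integral>x. (cmod (?g x))\<^sup>2 \<partial>haar_torus)"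
    by (rule bessel_finite[OF _ gb J]) measurable
  also have "\<dots> \<le> norm (\<integral>x. (cmod (?g x))\<^sup>2 \<partial>haar_torus)" by simp
  also have "\<dots> \<le> (2 * pi * norm (of_int_vec k') * d)\<^sup>2"
  proof (rule norm_integral_haar_le)
    show "norm ((cmod (?g x))\<^sup>2) \<le> (2 * pi * norm (of_int_vec k') * d)\<^sup>2" for x
      using power_mono[OF gb[of x] norm_ge_zero, of 2] by (simp add: norm_power)
  qed simp
  finally show ?thesis .
qed

end

section \<open>Decay of the entries away from the linear model\<close>

lemma iter_deriv_line:
  assumes "C_infinity F"
  shows "((\<lambda>t. u \<bullet> iter_deriv vs F (x + t *\<^sub>R e)) has_real_derivative u \<bullet> iter_deriv (e # vs) F (x + t *\<^sub>R e)) (at t)"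
proof -
  let ?D = "frechet_derivative (iter_deriv vs F) (at (x + t *\<^sub>R e))"
  have D: "(iter_deriv vs F has_derivative ?D) (at (x + t *\<^sub>R e))"
    using C_infinityD[OF assms] frechet_derivative_works by blast
  have "((\<lambda>t. x + t *\<^sub>R e) has_derivative (\<lambda>h. h *\<^sub>R e)) (at t)"
    by (auto intro!: derivative_eq_intros)
  from has_derivative_compose[OF this D]
  have "((\<lambda>t. u \<bullet> iter_deriv vs F (x + t *\<^sub>R e)) has_derivative (\<lambda>h. u \<bullet> ?D (h *\<^sub>R e))) (at t)"
    by (rule has_derivative_inner_right)
  moreover have "(\<lambda>h. u \<bullet> ?D (h *\<^sub>R e)) = (*) (u \<bullet> ?D e)"
    using linear_frechet_derivative[OF C_infinityD[OF assms, of vs]] by (auto simp: linear_scale)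
  ultimately show ?thesis by (simp add: has_field_derivative_def)
qed

lemma axis_of_int: "axis i 1 = of_int_vec (axis i 1)"
  by (simp add: of_int_vec_def axis_def vec_eq_iff)

text \<open>Non-stationary phase: when \<open>k\<close> is far from \<open>A\<^sup>T j\<close>, the phase
  \<open>k \<bullet> x - j \<bullet> F x\<close> has gradient of size comparable to \<open>\<bar>k - A\<^sup>T j\<bar>\<close>.\<close>

lemma transfer_entry_far:
  assumes F: "is_smooth_lift F f" and fm [measurable]: "f \<in> borel_measurable borel"
    and D1: "\<And>v x. norm v \<le> 1 \<Longrightarrow> norm (iter_deriv [v] F x - real_mat A *v v) \<le> 32 * \<epsilon>"
    and D2: "\<And>vs x. 2 \<le> length vs \<Longrightarrow> length vs \<le> 4 \<Longrightarrow> \<forall>v\<in>set vs. norm v \<le> 1 \<Longrightarrow> norm (iter_deriv vs F x) \<le> 32 * \<epsilon>"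
    and \<epsilon>: "0 \<le> \<epsilon>" "128 * \<epsilon> \<le> r" and r: "0 < r"
    and p: "p = k - transpose A *v j" and far: "r * norm (of_int_vec j) \<le> norm (of_int_vec p)" and p0: "p \<noteq> 0"
  shows "cmod (transfer_entry f j k) \<le> 8192 * \<epsilon> / r / norm (of_int_vec p) ^ 3"
proof -
  have cinf: "C_infinity F" using F by (simp add: is_smooth_lift_def)
  define N where "N = norm (of_int_vec p)"
  have N: "N > 0" unfolding N_def using p0 by (auto simp: of_int_vec_def vec_eq_iff)
  \<comment> \<open>One coordinate of \<open>p\<close> carries at least half of the norm; the
    integration by parts runs along that axis.\<close>
  obtain i where i: "N \<le> 2 * \<bar>of_int (p $ i)\<bar>"
  proof -
    have "N \<le> \<bar>of_int (p $ 1)\<bar> + \<bar>of_int (p $ 2)\<bar>"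
      unfolding N_def using norm_le_l1_cart[of "of_int_vec p"] by (simp add: of_int_vec_def sum_2)
    then show ?thesis using that[of 1] that[of 2] by linarith
  qed
  let ?j = "of_int_vec j :: real^2" and ?e = "axis i 1 :: real^2"
  have e1: "norm ?e \<le> 1" by simp
  have jN: "norm ?j * (32 * \<epsilon>) \<le> 32 * \<epsilon> / r * N"
  proof -
    have "norm ?j \<le> N / r" using far r by (simp add: N_def le_divide_eq mult.commute)
    then have "norm ?j * (32 * \<epsilon>) \<le> N / r * (32 * \<epsilon>)" using \<epsilon> by (intro mult_right_mono) auto
    then show ?thesis by (simp add: mult_ac)
  qed
  have er: "32 * \<epsilon> / r \<le> 1 / 4" using \<epsilon> r by (simp add: divide_le_eq)
  have jb: "\<bar>?j \<bullet> w\<bar> \<le> 32 * \<epsilon> / r * N" if "norm w \<le> 32 * \<epsilon>" for w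
  proof -
    have "\<bar>?j \<bullet> w\<bar> \<le> norm ?j * norm w" by (rule Cauchy_Schwarz_ineq2)
    also have "\<dots> \<le> norm ?j * (32 * \<epsilon>)" using that by (intro mult_left_mono) auto
    finally show ?thesis using jN by linarith
  qed
  let ?\<phi> = "\<lambda>x. fourier_mode k x * cnj (fourier_mode j (f x))"
  \<comment> \<open>Here \<open>P = N / 4\<close>, because
    \<open>\<bar>p $ i\<bar> \<ge> N / 2\<close> loses at most \<open>N / 4\<close> to the
    perturbation, and \<open>e = 128 * \<epsilon> / r\<close>, so that \<open>e * P\<close> is the
    bound \<open>32 * \<epsilon> / r * N\<close> on the higher derivatives of the phase. The
    constant 8192 below is 128 times \<open>4 ^ 3\<close>.\<close>
  have "cmod (integral\<^sup>L haar_torus ?\<phi>) \<le> (128 * \<epsilon> / r) / (N / 4) ^ 3"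
  proof (rule norm_integral_haar_le_slices[where C=1])
    show "?\<phi> \<in> borel_measurable borel" by measurable
    show "cmod (?\<phi> x) \<le> 1" for x by (simp add: norm_mult)
    show "0 \<le> (128 * \<epsilon> / r) / (N / 4) ^ 3" using \<epsilon> r N by simp
    fix x :: "real^2"
    define q where "q = (\<lambda>t. of_int_vec k \<bullet> (x + t *\<^sub>R ?e) - ?j \<bullet> F (x + t *\<^sub>R ?e))"
    define E where "E = (\<lambda>vs t. - (?j \<bullet> iter_deriv vs F (x + t *\<^sub>R ?e)))"
    define D where "D = (\<lambda>t. of_int (k $ i) + E [?e] t)"
    have Ed: "(E vs has_real_derivative E (?e # vs) t) (at t)" for vs t
      unfolding E_def by (rule DERIV_minus[OF iter_deriv_line[OF cinf]])
    have per: "E vs 1 = E vs 0" if "vs \<noteq> []" for vs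
      using iter_deriv_lift_periodic[OF F that, of x "axis i 1"]
      by (simp add: E_def axis_of_int[symmetric])
    have small: "\<bar>E vs t\<bar> \<le> (128 * \<epsilon> / r) * (N / 4)"
      if "2 \<le> length vs" "length vs \<le> 4" "\<forall>v\<in>set vs. norm v \<le> 1" for vs t
      using jb[OF D2[OF that], of "x + t *\<^sub>R ?e"] by (simp add: E_def mult_ac)
    have phase: "?\<phi> (proj_torus (x + t *\<^sub>R ?e)) = cis (2 * pi * q t)" for t
    proof -
      have "f (proj_torus (x + t *\<^sub>R ?e)) = proj_torus (F (x + t *\<^sub>R ?e))"
        using F by (simp add: is_smooth_lift_def)
      then show ?thesis
        by (simp add: fourier_mode_proj cis_cnj cis_mult q_def right_diff_distrib)
    qed
    have "cmod (integral {0..1} (\<lambda>t. cis (2 * pi * q t))) \<le> (128 * \<epsilon> / r) / (N / 4) ^ 3"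
    proof (rule oscillatory_integral_bound[where D=D])
      show "(q has_real_derivative D t) (at t)" for t
      proof -
        have "((\<lambda>t. of_int_vec k \<bullet> (x + t *\<^sub>R ?e)) has_real_derivative of_int (k $ i)) (at t)"
          by (auto intro!: derivative_eq_intros simp: inner_add_right inner_axis of_int_vec_def)
        from DERIV_diff[OF this iter_deriv_line[OF cinf, of ?j "[]" x ?e t]]
        show ?thesis unfolding q_def D_def E_def by simp
      qed
      show "(D has_real_derivative E [?e, ?e] t) (at t)" for t
        unfolding D_def using DERIV_add[OF DERIV_const Ed[of "[?e]" t]] by simp
      show "(E [?e, ?e] has_real_derivative E [?e, ?e, ?e] t) (at t)" for t by (rule Ed)
      show "(E [?e, ?e, ?e] has_real_derivative E [?e, ?e, ?e, ?e] t) (at t)" for t by (rule Ed)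
      show "0 < N / 4" using N by simp
      show "N / 4 \<le> \<bar>D t\<bar>" for t
      proof -
        let ?w = "iter_deriv [?e] F (x + t *\<^sub>R ?e) - real_mat A *v ?e"
        have "?j \<bullet> (real_mat A *v ?e) = of_int ((transpose A *v j) $ i)"
          using exhaust_2[of i] by (auto simp: inner_vec_def of_int_vec_def matrix_vector_mult_def transpose_def sum_2 axis_def)
        then have "D t = of_int (p $ i) - ?j \<bullet> ?w"
          unfolding D_def E_def p by (simp add: inner_diff_right)
        moreover have "\<bar>?j \<bullet> ?w\<bar> \<le> N / 4"
        proof -
          have "32 * \<epsilon> / r * N \<le> 1 / 4 * N" using er N by (intro mult_right_mono) auto
          then show ?thesis using jb[OF D1[OF e1], of "x + t *\<^sub>R ?e"] by linarith
        qed
        ultimately show ?thesis using i by linarith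
      qed
      show "0 \<le> 128 * \<epsilon> / r" "128 * \<epsilon> / r \<le> 1" using \<epsilon> r by auto
      show "\<bar>E [?e, ?e] t\<bar> \<le> (128 * \<epsilon> / r) * (N / 4)" "\<bar>E [?e, ?e, ?e] t\<bar> \<le> (128 * \<epsilon> / r) * (N / 4)"
        "\<bar>E [?e, ?e, ?e, ?e] t\<bar> \<le> (128 * \<epsilon> / r) * (N / 4)" for t
        by (rule small; simp)+
      show "D 1 = D 0" "E [?e, ?e] 1 = E [?e, ?e] 0" "E [?e, ?e, ?e] 1 = E [?e, ?e, ?e] 0"
        unfolding D_def by (simp_all only: per list.distinct not_False_eq_True)
      \<comment> \<open>\<open>q\<close> itself may change by an integer over one period. The
        equality of the two \<open>cis\<close> values is read off from the integrand, which is a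
        function on the torus.\<close>
      have "proj_torus (x + 1 *\<^sub>R ?e) = proj_torus (x + 0 *\<^sub>R ?e)"
        unfolding proj_torus_eq_iff lattice_equiv_def axis_of_int by (intro exI[of _ "axis i 1"]) simp
      then show "cis (2 * pi * q 1) = cis (2 * pi * q 0)" by (metis phase)
    qed
    then show "cmod (integral {0..1} (\<lambda>t. ?\<phi> (proj_torus (x + t *\<^sub>R ?e)))) \<le> (128 * \<epsilon> / r) / (N / 4) ^ 3"
      by (simp only: phase)
  qed
  also have "\<dots> = 8192 * \<epsilon> / r / N ^ 3" by (simp add: power_divide)
  finally show ?thesis by (simp add: transfer_entry_def N_def)
qed


section \<open>Hyperbolic levels of lattice points\<close>

lemma norm_of_int_vec_ge_1: "k \<noteq> 0 \<Longrightarrow> 1 \<le> norm (of_int_vec k :: real^'n)"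
proof -
  assume "k \<noteq> 0"
  then obtain i where "k $ i \<noteq> 0" by (auto simp: vec_eq_iff)
  then have "1 \<le> \<bar>(of_int_vec k :: real^'n) $ i\<bar>" by (simp add: of_int_vec_def)
  then show ?thesis using component_le_norm_cart order_trans by blast
qed

section \<open>Linear forms from eigenvectors\<close>

definition linear_form :: "complex^2 \<Rightarrow> int^2 \<Rightarrow> complex" where
  "linear_form v j = (\<Sum>i\<in>UNIV. of_int (j $ i) * v $ i)"

lemma linear_form_diff: "linear_form v (a - b) = linear_form v a - linear_form v b"
  by (simp add: linear_form_def sum_2 algebra_simps)

text \<open>An eigenvector of \<open>A\<close> is an eigenform of the transpose, the matrix that
  acts on frequencies.\<close>

lemma linear_form_eigen:
  assumes "map_matrix of_int A *v v = \<mu> *s v"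
  shows "linear_form v (transpose A *v j) = \<mu> * linear_form v j"
proof -
  have "of_int (A $ i $ 1) * v $ 1 + of_int (A $ i $ 2) * v $ 2 = \<mu> * v $ i" for i
    using assms by (simp add: vec_eq_iff matrix_vector_mult_def sum_2 vector_scalar_mult_def)
  note e = this[of 1] this[of 2]
  have "linear_form v (transpose A *v j) = of_int (j $ 1) * (of_int (A $ 1 $ 1) * v $ 1 + of_int (A $ 1 $ 2) * v $ 2)
      + of_int (j $ 2) * (of_int (A $ 2 $ 1) * v $ 1 + of_int (A $ 2 $ 2) * v $ 2)"
    by (simp add: linear_form_def matrix_vector_mult_def transpose_def sum_2 algebra_simps)
  then show ?thesis unfolding e by (simp add: linear_form_def sum_2 algebra_simps)
qed

lemma cmod_linear_form_le: "cmod (linear_form v j) \<le> (cmod (v $ 1) + cmod (v $ 2)) * norm (of_int_vec j)"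
proof -
  have "cmod (of_int (j $ i) * v $ i) \<le> cmod (v $ i) * norm (of_int_vec j)" for i
    using component_le_norm_cart[of "of_int_vec j" i]
    by (simp add: norm_mult of_int_vec_def mult.commute mult_left_mono)
  from add_mono[OF this[of 1] this[of 2]] show ?thesis
    unfolding linear_form_def sum_2 using norm_triangle_ineq order_trans by (fastforce simp: distrib_right)
qed

text \<open>\<open>X\<close> and \<open>Y\<close> are scaled moduli of the forms of two
  eigenvectors, for eigenvalues of modulus \<open>lam\<close> and \<open>inverse lam\<close>. The
  moduli differ, so the eigenvectors are independent, and Cramer's rule recovers \<open>j\<close>
  from its two forms; this gives the last bound. The factor \<open>lam\<close> there is a
  normalisation: at a nonzero lattice point the larger form is at least \<open>lam\<close>, which
  keeps the logarithms in the levels at least 1.\<close>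

lemma hyperbolic_forms_exist:
  fixes A :: "int^2^2" and lam :: real
  assumes lam: "lam > 1"
    and ev: "cmod ` {\<mu>. matrix_eigenvalue (map_matrix of_int A) \<mu>} = {lam, inverse lam}"
  obtains X Y :: "int^2 \<Rightarrow> real" and V where
    "\<And>j. X (transpose A *v j) = lam * X j" "\<And>j. Y (transpose A *v j) = Y j / lam"
    "\<And>j. 0 \<le> X j" "\<And>j. 0 \<le> Y j"
    "\<And>a b. X a - X b \<le> V * norm (of_int_vec (a - b))" "\<And>a b. Y a - Y b \<le> V * norm (of_int_vec (a - b))"
    "\<And>j. X j \<le> V * norm (of_int_vec j)" "\<And>j. Y j \<le> V * norm (of_int_vec j)"
    "\<And>j. lam * norm (of_int_vec j) \<le> max (X j) (Y j)"
proof -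
  have "lam \<in> cmod ` {\<mu>. matrix_eigenvalue (map_matrix of_int A) \<mu>}" unfolding ev by simp
  then obtain \<mu> v where v: "cmod \<mu> = lam" "v \<noteq> 0" "map_matrix of_int A *v v = \<mu> *s v"
    by (auto simp: matrix_eigenvalue_def)
  have "inverse lam \<in> cmod ` {\<mu>. matrix_eigenvalue (map_matrix of_int A) \<mu>}" unfolding ev by simp
  then obtain \<nu> w where w: "cmod \<nu> = inverse lam" "w \<noteq> 0" "map_matrix of_int A *v w = \<nu> *s w"
    by (auto simp: matrix_eigenvalue_def)
  define D where "D = v $ 1 * w $ 2 - v $ 2 * w $ 1"
  have D: "D \<noteq> 0"
  proof
    assume D0: "D = 0"
    obtain c where c: "w = c *s v"
    proof (cases "v $ 1 = 0")
      case True
      then have "v $ 2 \<noteq> 0" using v(2) by (auto simp: vec_eq_iff forall_2)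
      moreover from this have "w $ 1 = 0" using True D0 by (simp add: D_def)
      ultimately have "w = (w $ 2 / v $ 2) *s v" using True by (simp add: vec_eq_iff forall_2)
      then show ?thesis by (rule that)
    next
      case False
      then have "w = (w $ 1 / v $ 1) *s v" using D0 by (simp add: vec_eq_iff forall_2 D_def field_simps)
      then show ?thesis by (rule that)
    qed
    have "(map_matrix of_int A *v w) $ i = c * (map_matrix of_int A *v v) $ i" for i
      by (simp add: c matrix_vector_mult_def vector_scalar_mult_def sum_2 algebra_simps)
    then have "\<nu> *s w = \<mu> *s w"
      unfolding w(3) v(3) by (simp add: vec_eq_iff c vector_scalar_mult_def mult_ac)
    then have "(\<nu> - \<mu>) *s w = 0" by (simp add: vec_eq_iff vector_scalar_mult_def algebra_simps)
    then have "\<nu> = \<mu>" using w(2) by (auto simp: vec_eq_iff vector_scalar_mult_def)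
    then have "inverse lam = lam" using v(1) w(1) by simp
    then show False using lam by (metis inverse_less_1_iff less_asym not_less_iff_gr_or_eq)
  qed
  define U where "U = cmod (v $ 1) + cmod (v $ 2) + (cmod (w $ 1) + cmod (w $ 2))"
  have key: "cmod D * norm (of_int_vec j) \<le> 2 * U * max (cmod (linear_form v j)) (cmod (linear_form w j))" for j
  proof -
    let ?m = "max (cmod (linear_form v j)) (cmod (linear_form w j))"
    have "of_int (j $ 1) * D = linear_form v j * w $ 2 - linear_form w j * v $ 2"
      "of_int (j $ 2) * D = linear_form w j * v $ 1 - linear_form v j * w $ 1"
      by (simp_all add: D_def linear_form_def sum_2 algebra_simps)
    then have "cmod (of_int (j $ 1) * D) \<le> cmod (linear_form v j * w $ 2) + cmod (linear_form w j * v $ 2)"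
      "cmod (of_int (j $ 2) * D) \<le> cmod (linear_form w j * v $ 1) + cmod (linear_form v j * w $ 1)"
      by (simp_all add: norm_triangle_ineq4)
    moreover have "cmod (linear_form v j * z) \<le> ?m * cmod z" "cmod (linear_form w j * z) \<le> ?m * cmod z" for z
      by (simp_all add: norm_mult mult_right_mono)
    ultimately have b: "cmod (of_int (j $ 1) * D) \<le> ?m * cmod (w $ 2) + ?m * cmod (v $ 2)"
      "cmod (of_int (j $ 2) * D) \<le> ?m * cmod (v $ 1) + ?m * cmod (w $ 1)"
      by (meson add_mono order_trans)+
    have "norm (of_int_vec j) \<le> \<bar>of_int (j $ 1)\<bar> + \<bar>of_int (j $ 2)\<bar>"
      using norm_le_l1_cart[of "of_int_vec j"] by (simp add: of_int_vec_def sum_2)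
    then have "cmod D * norm (of_int_vec j) \<le> cmod D * (\<bar>of_int (j $ 1)\<bar> + \<bar>of_int (j $ 2)\<bar>)"
      by (rule mult_left_mono) simp
    also have "\<dots> = cmod (of_int (j $ 1) * D) + cmod (of_int (j $ 2) * D)"
      by (simp add: norm_mult algebra_simps)
    also have "\<dots> \<le> ?m * U" using b unfolding U_def by (simp add: algebra_simps)
    also have "\<dots> \<le> 2 * (?m * U)"
    proof -
      have "0 \<le> ?m * U" unfolding U_def by (intro mult_nonneg_nonneg) (auto simp: le_max_iff_disj)
      then show ?thesis by linarith
    qed
    finally show ?thesis by (simp add: mult_ac)
  qed
  \<comment> \<open>The scale that converts \<open>key\<close> into the normalised lower bound on
    the larger form.\<close>
  define s where "s = lam * 2 * U / cmod D"
  have U: "U \<ge> 0" by (simp add: U_def)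
  have s: "s \<ge> 0" unfolding s_def using U lam by simp
  have vU: "cmod (linear_form v j) \<le> U * norm (of_int_vec j)" "cmod (linear_form w j) \<le> U * norm (of_int_vec j)" for j
    by (rule order_trans[OF cmod_linear_form_le], rule mult_right_mono; simp add: U_def)+
  show thesis
  proof (rule that[of "\<lambda>j. s * cmod (linear_form v j)" "\<lambda>j. s * cmod (linear_form w j)" "s * U"])
    fix j a b :: "int^2"
    show "s * cmod (linear_form v (transpose A *v j)) = lam * (s * cmod (linear_form v j))"
      by (simp only: linear_form_eigen[OF v(3)] norm_mult v(1) mult_ac)
    show "s * cmod (linear_form w (transpose A *v j)) = s * cmod (linear_form w j) / lam"
      by (simp only: linear_form_eigen[OF w(3)] norm_mult w(1) divide_inverse mult_ac)
    show "0 \<le> s * cmod (linear_form v j)" "0 \<le> s * cmod (linear_form w j)" using s by auto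
    have "cmod (linear_form z a) - cmod (linear_form z b) \<le> cmod (linear_form z (a - b))" for z
      unfolding linear_form_diff by (rule norm_triangle_ineq2)
    then have "cmod (linear_form v a) - cmod (linear_form v b) \<le> U * norm (of_int_vec (a - b))"
      "cmod (linear_form w a) - cmod (linear_form w b) \<le> U * norm (of_int_vec (a - b))"
      using vU order_trans by blast+
    from mult_left_mono[OF this(1) s] mult_left_mono[OF this(2) s]
    show "s * cmod (linear_form v a) - s * cmod (linear_form v b) \<le> s * U * norm (of_int_vec (a - b))"
      "s * cmod (linear_form w a) - s * cmod (linear_form w b) \<le> s * U * norm (of_int_vec (a - b))"
      by (simp_all add: right_diff_distrib mult.assoc)
    show "s * cmod (linear_form v j) \<le> s * U * norm (of_int_vec j)" "s * cmod (linear_form w j) \<le> s * U * norm (of_int_vec j)"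
      using mult_left_mono[OF vU(1) s] mult_left_mono[OF vU(2) s] by (simp_all add: mult.assoc)
    have "lam * norm (of_int_vec j) = lam / cmod D * (cmod D * norm (of_int_vec j))"
      using D by simp
    also have "\<dots> \<le> lam / cmod D * (2 * U * max (cmod (linear_form v j)) (cmod (linear_form w j)))"
      using key lam by (intro mult_left_mono) auto
    also have "\<dots> = s * max (cmod (linear_form v j)) (cmod (linear_form w j))"
      by (simp add: s_def)
    also have "\<dots> = max (s * cmod (linear_form v j)) (s * cmod (linear_form w j))"
      using s by (simp add: max_mult_distrib_left)
    finally show "lam * norm (of_int_vec j) \<le> max (s * cmod (linear_form v j)) (s * cmod (linear_form w j))" .
  qed
qed

text \<open>The witness is given by the adjugate. A determinant 1 or -1 is its own inverse, so the
  preimage is integral.\<close>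

lemma transpose_surj:
  fixes A :: "int^2^2"
  assumes "det A = 1 \<or> det A = -1"
  shows "\<exists>j. transpose A *v j = k"
proof -
  let ?d = "det A"
  let ?j = "vector [?d * (A $ 2 $ 2 * k $ 1 - A $ 2 $ 1 * k $ 2), ?d * (A $ 1 $ 1 * k $ 2 - A $ 1 $ 2 * k $ 1)] :: int^2"
  have "(transpose A *v ?j) $ i = ?d * ?d * k $ i" for i
    using exhaust_2[of i] by (auto simp: matrix_vector_mult_def transpose_def sum_2 det_2 algebra_simps)
  moreover have "?d * ?d = 1" using assms by auto
  ultimately show ?thesis by (intro exI[of _ ?j]) (simp add: vec_eq_iff)
qed

text \<open>A signed logarithm of the frequency: growing where \<open>X\<close> dominates,
  decreasing where \<open>Y\<close> does. It is used with base \<open>sqrt lam\<close>, for which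
  the exact factor \<open>lam\<close> of the transpose is worth two units; one of them is reserved
  for the perturbation.\<close>

definition level :: "real \<Rightarrow> ('i \<Rightarrow> real) \<Rightarrow> ('i \<Rightarrow> real) \<Rightarrow> 'i \<Rightarrow> int" where
  "level m X Y j = (if Y j < X j then \<lfloor>log m (X j)\<rfloor> else - \<lfloor>log m (Y j)\<rfloor>)"

lemma floor_log_step:
  assumes "m > 1" "x > 0" "m * x \<le> y"
  shows "\<lfloor>log m x\<rfloor> + 1 \<le> \<lfloor>log m y\<rfloor>"
proof -
  have "log m x + 1 = log m (m * x)" using assms by (simp add: log_mult)
  also have "\<dots> \<le> log m y" using assms mult_pos_pos[of m x] by (intro log_mono) auto
  finally have "\<lfloor>log m x + 1\<rfloor> \<le> \<lfloor>log m y\<rfloor>" by (rule floor_mono)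
  then show ?thesis by simp
qed

lemma powi_floor_log_le:
  assumes "m > 1" "x > 0"
  shows "m powi \<lfloor>log m x\<rfloor> \<le> x"
proof -
  have "m powi \<lfloor>log m x\<rfloor> = m powr \<lfloor>log m x\<rfloor>" using assms by (simp add: powr_real_of_int')
  also have "\<dots> \<le> m powr (log m x)" using assms by (intro powr_mono) auto
  also have "\<dots> = x" using assms by (intro powr_log_cancel) auto
  finally show ?thesis .
qed

lemma floor_log_pos: "m > 1 \<Longrightarrow> m \<le> x \<Longrightarrow> 1 \<le> \<lfloor>log m x\<rfloor>"
  using floor_log_step[of m 1 x] by simp

text \<open>If \<open>X\<close> dominates at \<open>j\<close>, it dominates at \<open>k\<close> and
  has grown by at least \<open>sqrt lam\<close>. If \<open>Y\<close> dominates at both, it has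
  shrunk by at least that factor. If dominance passes from \<open>Y\<close> to \<open>X\<close>, the
  level jumps from at most -1 to at least 1, all logarithms being at least 1 by \<open>low\<close>.
  The tolerance \<open>(sqrt lam - 1) / lam\<close> is the value for which
  \<open>1 / lam + t = 1 / sqrt lam\<close>.\<close>

lemma level_near:
  assumes lam: "lam > 1"
    and jk: "j \<noteq> 0" "k \<noteq> (0::int^2)"
    and X: "\<bar>X k - lam * X j\<bar> \<le> t * max (X j) (Y j)" and Y: "\<bar>Y k - Y j / lam\<bar> \<le> t * max (X j) (Y j)"
    and t: "0 \<le> t" "t \<le> (sqrt lam - 1) / lam"
    and low: "\<And>i. i \<noteq> 0 \<Longrightarrow> lam \<le> max (X i) (Y i)"
  shows "level (sqrt lam) X Y j + 1 \<le> level (sqrt lam) X Y k"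
proof -
  let ?m = "sqrt lam"
  have m: "1 < ?m" using lam by simp
  have mm: "?m * ?m = lam" unfolding real_sqrt_mult_self using lam by linarith
  have ml: "?m \<le> lam" using lam mult_left_mono[of 1 ?m ?m] m mm by linarith
  have "lam * t \<le> ?m - 1" using t(2) lam by (simp add: le_divide_eq mult.commute)
  moreover have "t \<le> lam * t" using t(1) lam by (simp add: mult_le_cancel_right1)
  moreover have "?m - 1 \<le> ?m * (?m - 1)" using m by (simp add: mult_le_cancel_right1)
  moreover have "?m * (?m - 1) = lam - ?m" by (simp only: right_diff_distrib mm mult_1_right)
  ultimately have t1: "t \<le> lam - ?m" and t3: "lam * t \<le> ?m - 1" by linarith+
  have t2: "1 / lam + t \<le> 1 / ?m"
  proof -
    have "1 / lam + t = (1 + lam * t) / lam" using lam by (simp add: add_divide_distrib)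
    also have "\<dots> \<le> ?m / lam" using t3 lam by (intro divide_right_mono) auto
    also have "\<dots> = ?m / (?m * ?m)" by (simp only: mm)
    also have "\<dots> = 1 / ?m" using m by (intro nonzero_divide_mult_cancel_left) simp
    finally show ?thesis .
  qed
  show ?thesis
  proof (cases "Y j < X j")
    case True
    then have Xj: "lam \<le> X j" using low[OF jk(1)] by simp
    have "lam * X j - t * X j \<le> X k" using X True by (simp add: max_def)
    then have "(lam - t) * X j \<le> X k" by (simp add: left_diff_distrib)
    moreover have "?m * X j \<le> (lam - t) * X j" using t1 Xj lam by (intro mult_right_mono) auto
    ultimately have Xk: "?m * X j \<le> X k" by linarith
    have "Y k \<le> Y j / lam + t * X j" using Y True by (simp add: max_def)
    also have "\<dots> \<le> X j / lam + t * X j" using True lam by (simp add: divide_right_mono)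
    also have "\<dots> = (1 / lam + t) * X j" by (simp add: distrib_right)
    also have "\<dots> \<le> 1 / ?m * X j" using t2 Xj lam by (intro mult_right_mono) auto
    also have "\<dots> < ?m * X j" using m Xj lam
      by (intro mult_strict_right_mono) (simp_all add: divide_less_eq mm)
    finally have "Y k < X k" using Xk by linarith
    then show ?thesis using True floor_log_step[OF m _ Xk] Xj lam by (simp add: level_def)
  next
    case False
    then have Yj: "lam \<le> Y j" using low[OF jk(1)] by simp
    have mx: "max (X j) (Y j) = Y j" using False by simp
    show ?thesis
    proof (cases "Y k < X k")
      case True
      then have "lam \<le> X k" using low[OF jk(2)] by simp
      then have "1 \<le> \<lfloor>log ?m (X k)\<rfloor>" "1 \<le> \<lfloor>log ?m (Y j)\<rfloor>"
        using floor_log_pos[OF m] Yj ml by (meson order_trans)+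
      moreover have "level ?m X Y j = - \<lfloor>log ?m (Y j)\<rfloor>" "level ?m X Y k = \<lfloor>log ?m (X k)\<rfloor>"
        using True False by (simp_all add: level_def)
      ultimately show ?thesis by linarith
    next
      case Fk: False
      have Yk: "lam \<le> Y k" using low[OF jk(2)] Fk by simp
      have "Y k \<le> Y j / lam + t * Y j" using Y unfolding mx by linarith
      also have "\<dots> = (1 / lam + t) * Y j" by (simp add: distrib_right)
      also have "\<dots> \<le> 1 / ?m * Y j" using t2 Yj lam by (intro mult_right_mono) auto
      finally have "?m * Y k \<le> Y j" using m by (simp add: le_divide_eq mult.commute)
      from floor_log_step[OF m _ this] Yk lam False Fk show ?thesis by (simp add: level_def)
    qed
  qed
qed

lemma powi_level_le:
  assumes lam: "lam > 1" and low: "lam \<le> max (X i) (Y i)" and up: "X i \<le> B" "Y i \<le> B"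
  shows "sqrt lam powi level (sqrt lam) X Y i \<le> B" "sqrt lam powi (- level (sqrt lam) X Y i) \<le> B"
proof -
  let ?m = "sqrt lam"
  have m: "1 < ?m" using lam by simp
  have ml: "?m \<le> lam" using lam mult_left_mono[of 1 ?m ?m] m by simp
  have *: "?m powi \<lfloor>log ?m z\<rfloor> \<le> B" "?m powi (- \<lfloor>log ?m z\<rfloor>) \<le> B" if "lam \<le> z" "z \<le> B" for z
  proof -
    show "?m powi \<lfloor>log ?m z\<rfloor> \<le> B" using powi_floor_log_le[OF m, of z] that lam by simp
    have "1 \<le> \<lfloor>log ?m z\<rfloor>" using floor_log_pos[OF m] that ml by simp
    then have "?m powi (- \<lfloor>log ?m z\<rfloor>) \<le> ?m powi 0" using m by (intro power_int_increasing) auto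
    then show "?m powi (- \<lfloor>log ?m z\<rfloor>) \<le> B" using that lam by simp
  qed
  show "?m powi level ?m X Y i \<le> B" "?m powi (- level ?m X Y i) \<le> B"
    using * low up by (auto simp: level_def max_def split: if_splits)
qed

text \<open>Along the backward orbit \<open>X\<close> decays and \<open>Y\<close> grows, so the norm
  follows \<open>Y\<close> up to constants, once \<open>Y k0 > 0\<close>. With
  \<open>Y k0 = 0\<close> the orbit would shrink towards 0, against the lower bound
  \<open>lam\<close> on the larger form at nonzero lattice points.\<close>

lemma backward_orbit:
  fixes A :: "int^2^2"
  assumes lam: "lam > 1" and det: "det A = 1 \<or> det A = -1" and k0: "k0 \<noteq> 0"
    and X: "\<And>j. X (transpose A *v j) = lam * X j" and Y: "\<And>j. Y (transpose A *v j) = Y j / lam"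
    and nn: "\<And>j. 0 \<le> X j" "\<And>j. 0 \<le> Y j"
    and up: "\<And>j. X j \<le> V * norm (of_int_vec j)" "\<And>j. Y j \<le> V * norm (of_int_vec j)"
    and low: "\<And>j. lam * norm (of_int_vec j) \<le> max (X j) (Y j)"
  obtains orb c1 c2 where "orb 0 = k0" "\<And>n. transpose A *v orb (Suc n) = orb n" "c1 > 0"
    "\<And>n. c1 * lam ^ n \<le> norm (of_int_vec (orb n))" "\<And>n. norm (of_int_vec (orb n)) \<le> c2 * lam ^ n"
proof -
  obtain pre where pre: "\<And>k. transpose A *v pre k = k" using transpose_surj[OF det] by metis
  define orb where "orb = (\<lambda>n. (pre ^^ n) k0)"
  have o0: "orb 0 = k0" and os: "transpose A *v orb (Suc n) = orb n" for n
    by (simp_all only: orb_def funpow.simps o_apply id_apply pre)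
  have Xo: "X (orb n) = X k0 / lam ^ n" for n
  proof (induction n)
    case (Suc n)
    then show ?case using X[of "orb (Suc n)"] lam unfolding os by (simp add: field_simps)
  qed (simp add: o0)
  have Yo: "Y (orb n) = Y k0 * lam ^ n" for n
  proof (induction n)
    case (Suc n)
    then show ?case using Y[of "orb (Suc n)"] lam unfolding os by (simp add: field_simps)
  qed (simp add: o0)
  have nz: "orb n \<noteq> 0" for n
  proof (induction n)
    case (Suc n)
    then show ?case using os[of n] by auto
  qed (simp add: o0 k0)
  have low1: "lam \<le> max (X (orb n)) (Y (orb n))" for n
  proof -
    have "lam * 1 \<le> lam * norm (of_int_vec (orb n))"
      using norm_of_int_vec_ge_1[OF nz] lam by (intro mult_left_mono) auto
    then show ?thesis using low[of "orb n"] by simp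
  qed
  have Y0: "Y k0 > 0"
  proof (rule ccontr)
    assume "\<not> Y k0 > 0"
    then have "Y k0 = 0" using nn(2)[of k0] by simp
    then have "lam \<le> X k0 / lam ^ n" for n
      using low1[of n] Xo[of n] Yo[of n] lam nn(1)[of k0] by (auto simp: max_def split: if_splits)
    then have *: "lam * lam ^ n \<le> X k0" for n using lam by (simp add: le_divide_eq)
    obtain n where "X k0 < lam ^ n" using real_arch_pow[OF lam] by blast
    moreover have "lam ^ n \<le> lam * lam ^ n" using lam by (simp add: mult_le_cancel_right1)
    ultimately show False using *[of n] by linarith
  qed
  have V: "V > 0"
    using up(2)[of k0] Y0 norm_of_int_vec_ge_1[OF k0] by (smt (verit) mult_nonpos_nonneg)
  show thesis
  proof (rule that[of orb "Y k0 / V" "(X k0 + Y k0) / lam"])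
    show "orb 0 = k0" by (rule o0)
    show "transpose A *v orb (Suc n) = orb n" for n by (rule os)
    show "0 < Y k0 / V" using Y0 V by simp
    fix n
    show "Y k0 / V * lam ^ n \<le> norm (of_int_vec (orb n))"
      using up(2)[of "orb n"] V unfolding Yo by (simp add: field_simps)
    have l1: "1 \<le> lam ^ n" using lam by simp
    have "lam * norm (of_int_vec (orb n)) \<le> X k0 / lam ^ n + Y k0 * lam ^ n"
    proof -
      have "max (X (orb n)) (Y (orb n)) \<le> X (orb n) + Y (orb n)" using nn by simp
      then show ?thesis using low[of "orb n"] by (simp only: Xo Yo)
    qed
    also have "X k0 / lam ^ n \<le> X k0 * lam ^ n"
    proof -
      have "X k0 / lam ^ n \<le> X k0 / 1" using nn(1)[of k0] l1 by (intro divide_left_mono) auto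
      also have "\<dots> \<le> X k0 * lam ^ n" using nn(1)[of k0] l1 mult_left_mono[of 1 "lam ^ n" "X k0"] by simp
      finally show ?thesis .
    qed
    finally show "norm (of_int_vec (orb n)) \<le> (X k0 + Y k0) / lam * lam ^ n"
      using lam by (simp add: field_simps)
  qed
qed


section \<open>Uniform contraction of the anisotropic norm\<close>

lemma powr_half_div_cube:
  fixes x :: real
  assumes "x > 0"
  shows "x powr (1/2) / x ^ 3 = x powr (-5/2)"
proof -
  have "x powr (1/2) / x ^ 3 = x powr (1/2) / x powr 3" using assms by (simp add: powr_numeral)
  also have "\<dots> = x powr (1/2 - 3)" by (simp only: powr_diff)
  finally show ?thesis by simp
qed

text \<open>A product majorant of |p|^(-5/2). The exponent 5/4 in each coordinate exceeds 1, so
  planar sums are bounded by the square of a one-dimensional series; \<open>max 1\<close> covers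
  vanishing coordinates.\<close>

definition lattice_weight :: "int^2 \<Rightarrow> real" where
  "lattice_weight p = max 1 \<bar>of_int (p $ 1)\<bar> powr (-5/4) * max 1 \<bar>of_int (p $ 2)\<bar> powr (-5/4)"

lemma norm_powr_le_lattice_weight:
  assumes "p \<noteq> 0"
  shows "norm (of_int_vec p :: real^2) powr (-5/2) \<le> lattice_weight p"
proof -
  let ?N = "norm (of_int_vec p :: real^2)"
  have N1: "1 \<le> ?N" by (rule norm_of_int_vec_ge_1[OF assms])
  have "max 1 \<bar>of_int (p $ i)\<bar> \<le> ?N" for i
    using component_le_norm_cart[of "of_int_vec p :: real^2" i] N1 by (simp add: of_int_vec_def)
  then have c: "?N powr (-5/4) \<le> max 1 \<bar>of_int (p $ i)\<bar> powr (-5/4)" for i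
    by (intro powr_mono2') auto
  have "?N powr (-5/2) = ?N powr (-5/4) * ?N powr (-5/4)"
    by (simp flip: powr_add)
  also have "\<dots> \<le> lattice_weight p"
    unfolding lattice_weight_def by (intro mult_mono c) auto
  finally show ?thesis .
qed

lemma lattice_weight_summable:
  obtains S where "S > 0" "\<And>P. finite P \<Longrightarrow> (\<Sum>p\<in>P. lattice_weight p) \<le> S"
proof -
  let ?g = "\<lambda>m::int. max 1 \<bar>of_int m\<bar> powr (-5/4) :: real"
  let ?B = "1 + 2 * (\<Sum>i. real i powr (-5/4))"
  have sm: "summable (\<lambda>i. real i powr (-5/4))" by (simp add: summable_real_powr_iff)
  \<comment> \<open>\<open>0 powr _\<close> is 0, so the term \<open>i = 0\<close> contributes
    nothing and \<open>m = 0\<close> is counted by the leading 1.\<close>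
  have int: "(\<Sum>m\<in>{-int n..int n}. ?g m) = 1 + 2 * (\<Sum>i<Suc n. real i powr (-5/4))" for n
  proof (induction n)
    case (Suc n)
    have "{-int (Suc n)..int (Suc n)} = insert (int (Suc n)) (insert (- int (Suc n)) {-int n..int n})" by auto
    then show ?case using Suc by (simp add: add_ac)
  qed simp
  have B: "(\<Sum>m\<in>{-int n..int n}. ?g m) \<le> ?B" for n
    unfolding int using sum_le_suminf[OF sm, of "{..<Suc n}"] by simp
  have B0: "?B > 0" using suminf_nonneg[OF sm] by simp
  have "(\<Sum>p\<in>P. lattice_weight p) \<le> ?B * ?B" if P: "finite P" for P
  proof -
    define n where "n = nat (Max (insert 0 ((\<lambda>p. max \<bar>p $ 1\<bar> \<bar>p $ 2\<bar>) ` P)))"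
    have n: "max \<bar>p $ 1\<bar> \<bar>p $ 2\<bar> \<le> int n" if "p \<in> P" for p
    proof -
      have "max \<bar>p $ 1\<bar> \<bar>p $ 2\<bar> \<le> Max (insert 0 ((\<lambda>p. max \<bar>p $ 1\<bar> \<bar>p $ 2\<bar>) ` P))"
        using P that by (intro Max_ge) auto
      then show ?thesis unfolding n_def by linarith
    qed
    let ?I = "{-int n..int n}"
    have inj: "inj_on (\<lambda>p::int^2. (p $ 1, p $ 2)) P" by (auto simp: inj_on_def vec_eq_iff forall_2)
    have "(\<Sum>p\<in>P. lattice_weight p) = (\<Sum>(a, b)\<in>(\<lambda>p. (p $ 1, p $ 2)) ` P. ?g a * ?g b)"
      by (simp add: sum.reindex[OF inj] lattice_weight_def)
    also have "\<dots> \<le> (\<Sum>(a, b)\<in>?I \<times> ?I. ?g a * ?g b)"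
    proof (intro sum_mono2 subsetI)
      fix z assume "z \<in> (\<lambda>p::int^2. (p $ 1, p $ 2)) ` P"
      then obtain p where p: "p \<in> P" "z = (p $ 1, p $ 2)" by blast
      from n[OF p(1)] have "\<bar>p $ 1\<bar> \<le> int n" "\<bar>p $ 2\<bar> \<le> int n" by auto
      then show "z \<in> ?I \<times> ?I" unfolding p(2) by (simp only: mem_Times_iff fst_conv snd_conv atLeastAtMost_iff) linarith
    qed auto
    also have "\<dots> = (\<Sum>m\<in>?I. ?g m) * (\<Sum>m\<in>?I. ?g m)"
      by (simp add: sum_product sum.cartesian_product)
    also have "\<dots> \<le> ?B * ?B" using B0 by (intro mult_mono B) (auto intro: sum_nonneg)
    finally show ?thesis .
  qed
  then show ?thesis using that[of "?B * ?B"] B0 by simp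
qed

section \<open>The weight attached to a pair of eigenforms\<close>

locale hyperbolic_forms =
  fixes A :: "int^2^2" and lam :: real and X Y :: "int^2 \<Rightarrow> real" and V :: real
  assumes lam: "lam > 1"
    and X_hom: "\<And>j. X (transpose A *v j) = lam * X j" and Y_hom: "\<And>j. Y (transpose A *v j) = Y j / lam"
    and X_nonneg: "\<And>j. 0 \<le> X j" and Y_nonneg: "\<And>j. 0 \<le> Y j"
    and X_lip: "\<And>a b. X a - X b \<le> V * norm (of_int_vec (a - b))"
    and Y_lip: "\<And>a b. Y a - Y b \<le> V * norm (of_int_vec (a - b))"
    and X_up: "\<And>j. X j \<le> V * norm (of_int_vec j)" and Y_up: "\<And>j. Y j \<le> V * norm (of_int_vec j)"
    and low: "\<And>j. lam * norm (of_int_vec j) \<le> max (X j) (Y j)"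
begin

text \<open>The exponent 1/8 makes \<open>\<rho> ^ 4\<close> equal to \<open>sqrt lam\<close>, the
  base of the levels. The weight and its inverse are then at most of order |j|^(1/4), which leaves
  the cubic decay of the entries summable.\<close>

definition \<rho> :: real where "\<rho> = lam powr (1/8)"

definition lev :: "int^2 \<Rightarrow> int" where "lev = level (sqrt lam) X Y"

lemma \<rho>: "\<rho> > 1"
  using lam by (simp add: \<rho>_def)

lemma \<rho>4: "\<rho> ^ 4 = sqrt lam"
proof -
  have "\<rho> ^ 4 = lam powr (1/2)" using lam by (simp add: \<rho>_def powr_power)
  then show ?thesis using lam by (simp add: powr_half_sqrt)
qed

lemma V: "V \<ge> lam"
proof -
  have "lam * norm (of_int_vec (1::int^2)) \<le> V * norm (of_int_vec (1::int^2) :: real^2)"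
    using low[of 1] X_up[of 1] Y_up[of 1] by linarith
  moreover have "0 < norm (of_int_vec (1::int^2) :: real^2)"
    using norm_of_int_vec_ge_1[OF one_neq_zero] by (rule less_le_trans[OF zero_less_one])
  ultimately show ?thesis by (rule mult_right_le_imp_le)
qed

lemma low1: "j \<noteq> 0 \<Longrightarrow> lam \<le> max (X j) (Y j)"
  using low[of j] norm_of_int_vec_ge_1[of j] lam mult_left_mono[of 1 "norm (of_int_vec j)" lam] by linarith

lemma \<rho>_lev_le:
  assumes "j \<noteq> 0"
  shows "(\<rho> powi lev j) ^ 4 \<le> V * norm (of_int_vec j)" "(\<rho> powi (- lev j)) ^ 4 \<le> V * norm (of_int_vec j)"
proof -
  have "(\<rho> powi z) ^ 4 = sqrt lam powi z" for z
    unfolding \<rho>4[symmetric] by (simp add: power_int_power power_int_power' mult.commute)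
  then show "(\<rho> powi lev j) ^ 4 \<le> V * norm (of_int_vec j)" "(\<rho> powi (- lev j)) ^ 4 \<le> V * norm (of_int_vec j)"
    using powi_level_le[where X=X and Y=Y and i=j and lam=lam, OF lam low1[OF assms] X_up[of j] Y_up[of j]] by (simp_all only: lev_def)
qed

lemma norm_transpose_le: "norm (of_int_vec (transpose A *v j)) \<le> V * norm (of_int_vec j)"
proof -
  have "lam * norm (of_int_vec (transpose A *v j)) \<le> max (lam * X j) (Y j / lam)"
    using low[of "transpose A *v j"] by (simp only: X_hom Y_hom)
  also have "\<dots> \<le> lam * (V * norm (of_int_vec j))"
  proof (rule max.boundedI)
    show "lam * X j \<le> lam * (V * norm (of_int_vec j))" using X_up lam by (intro mult_left_mono) auto
    have "Y j / lam \<le> Y j * 1" using Y_nonneg[of j] lam by (simp add: divide_le_eq mult_le_cancel_left1)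
    also have "\<dots> \<le> Y j * lam" using Y_nonneg[of j] lam by (intro mult_left_mono) auto
    also have "\<dots> \<le> lam * (V * norm (of_int_vec j))"
      using mult_left_mono[OF Y_up[of j], of lam] lam by (simp add: mult.commute)
    finally show "Y j / lam \<le> lam * (V * norm (of_int_vec j))" .
  qed
  finally show ?thesis using lam by simp
qed

lemma transpose_inj: "inj ((*v) (transpose A))"
proof (rule injI)
  fix a b assume eq: "transpose A *v a = transpose A *v b"
  have "transpose A *v (a - b) = 0"
    using eq by (simp add: vec_eq_iff matrix_vector_mult_def sum_2 algebra_simps del: transpose_matrix_vector)
  moreover have "X 0 = 0" "Y 0 = 0" using X_up[of 0] X_nonneg[of 0] Y_up[of 0] Y_nonneg[of 0]
    by (simp_all add: of_int_vec_0)
  ultimately have "X (a - b) = 0" "Y (a - b) = 0"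
    using X_hom[of "a - b"] Y_hom[of "a - b"] lam by auto
  then show "a = b" using low1[of "a - b"] lam by force
qed

text \<open>Within this radius the error \<open>V * |p|\<close> in either form stays below
  \<open>(sqrt lam - 1) / lam\<close> times \<open>max (X j) (Y j)\<close>, the tolerance of
  \<open>level_near\<close>.\<close>

definition near_radius :: real where "near_radius = (sqrt lam - 1) / V"

lemma near_radius: "near_radius > 0"
  using V lam by (simp add: near_radius_def)

lemma lev_near:
  assumes "j \<noteq> 0" "k \<noteq> 0" and near: "norm (of_int_vec (k - transpose A *v j)) \<le> near_radius * norm (of_int_vec j)"
  shows "lev j + 1 \<le> lev k"
proof -
  let ?p = "norm (of_int_vec (k - transpose A *v j))" and ?Z = "max (X j) (Y j)"
  have "V * ?p \<le> V * (near_radius * norm (of_int_vec j))" using near V lam by (intro mult_left_mono) auto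
  also have "\<dots> = (sqrt lam - 1) * norm (of_int_vec j)" using V lam by (simp add: near_radius_def)
  also have "\<dots> = (sqrt lam - 1) / lam * (lam * norm (of_int_vec j))" using lam by simp
  also have "\<dots> \<le> (sqrt lam - 1) / lam * ?Z" using low lam by (intro mult_left_mono) auto
  finally have Vp: "V * ?p \<le> (sqrt lam - 1) / lam * ?Z" .
  have sym: "norm (of_int_vec (transpose A *v j - k)) = ?p"
    using of_int_vec_minus[of "k - transpose A *v j"] by (simp add: norm_minus_commute)
  have "\<bar>X k - lam * X j\<bar> \<le> V * ?p" "\<bar>Y k - Y j / lam\<bar> \<le> V * ?p"
    using X_lip[of k "transpose A *v j"] X_lip[of "transpose A *v j" k]
      Y_lip[of k "transpose A *v j"] Y_lip[of "transpose A *v j" k]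
    unfolding X_hom Y_hom sym by linarith+
  then show ?thesis unfolding lev_def
    using Vp lam by (intro level_near[where t="(sqrt lam - 1) / lam"] assms low1) auto
qed

text \<open>By contraposition of \<open>lev_near\<close>, a level that does not rise forces
  \<open>k\<close> away from \<open>transpose A *v j\<close>. Both frequencies are then bounded by
  multiples of the mismatch, the quotient of weights by a multiple of its square root, and the cubic
  decay leaves the exponent -5/2.\<close>

lemma far_weight:
  obtains C where "C > 0" "\<And>j k. j \<noteq> 0 \<Longrightarrow> k \<noteq> 0 \<Longrightarrow> lev k \<le> lev j \<Longrightarrow>
     k - transpose A *v j \<noteq> 0 \<and> near_radius * norm (of_int_vec j) \<le> norm (of_int_vec (k - transpose A *v j)) \<and>
     \<rho> powi (lev j - lev k) / norm (of_int_vec (k - transpose A *v j)) ^ 3 \<le> C * lattice_weight (k - transpose A *v j)"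
proof -
  define C0 where "C0 = V\<^sup>2 * ((1 / near_radius) * (1 + V / near_radius))"
  \<comment> \<open>With \<open>max 1 C0\<close> one has \<open>C0 \<le> C ^ 4\<close>, so the
    comparison of fourth powers takes no root of the constant.\<close>
  define C where "C = max 1 C0"
  show thesis
  proof (rule that[of C])
    show "C > 0" by (simp add: C_def)
    fix j k :: "int^2" assume j: "j \<noteq> 0" and k: "k \<noteq> 0" and le: "lev k \<le> lev j"
    let ?p = "k - transpose A *v j" and ?r = near_radius
    let ?N = "norm (of_int_vec ?p)"
    have "\<not> ?N \<le> ?r * norm (of_int_vec j)" using lev_near[OF j k] le by linarith
    then have far: "?r * norm (of_int_vec j) < ?N" by simp
    have N0: "0 < ?N"
    proof -
      have "0 \<le> ?r * norm (of_int_vec j)" using near_radius by simp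
      then show ?thesis using far by linarith
    qed
    then have p0: "?p \<noteq> 0" by (auto simp: of_int_vec_0)
    have N1: "1 \<le> ?N" by (rule norm_of_int_vec_ge_1[OF p0])
    have jb: "norm (of_int_vec j) \<le> 1 / ?r * ?N" using far near_radius by (simp add: field_simps)
    have "norm (of_int_vec k) \<le> ?N + norm (of_int_vec (transpose A *v j))"
      using norm_triangle_ineq[of "of_int_vec ?p" "of_int_vec (transpose A *v j)"]
      unfolding of_int_vec_add[symmetric] by simp
    also have "\<dots> \<le> ?N + V * (1 / ?r * ?N)"
      using norm_transpose_le[of j] mult_left_mono[OF jb, of V] V lam by linarith
    finally have kb: "norm (of_int_vec k) \<le> (1 + V / ?r) * ?N" by (simp add: algebra_simps)
    have "(\<rho> powi (lev j - lev k)) ^ 4 = (\<rho> powi lev j) ^ 4 * (\<rho> powi (- lev k)) ^ 4"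
      using \<rho> by (simp add: power_int_diff power_int_minus divide_inverse power_mult_distrib)
    also have "\<dots> \<le> (V * norm (of_int_vec j)) * (V * norm (of_int_vec k))"
      using V lam by (intro mult_mono \<rho>_lev_le j k) auto
    also have "\<dots> = V\<^sup>2 * (norm (of_int_vec j) * norm (of_int_vec k))" by (simp add: power2_eq_square)
    also have "\<dots> \<le> V\<^sup>2 * ((1 / ?r * ?N) * ((1 + V / ?r) * ?N))"
      using near_radius by (intro mult_left_mono mult_mono jb kb) auto
    also have "\<dots> = C0 * ?N\<^sup>2" by (simp add: C0_def power2_eq_square)
    also have "\<dots> \<le> C ^ 4 * ?N\<^sup>2"
    proof (rule mult_right_mono)
      have "C0 \<le> C ^ 1" by (simp add: C_def)
      also have "\<dots> \<le> C ^ 4" by (rule power_increasing) (auto simp: C_def)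
      finally show "C0 \<le> C ^ 4" .
    qed simp
    also have "\<dots> = (C * ?N powr (1/2)) ^ 4"
      using N0 by (simp add: power_mult_distrib powr_power powr_numeral)
    finally have "\<rho> powi (lev j - lev k) \<le> C * ?N powr (1/2)"
      by (rule power_le_imp_le_base[of _ 3, simplified]) (simp add: C_def)
    then have "\<rho> powi (lev j - lev k) / ?N ^ 3 \<le> C * ?N powr (1/2) / ?N ^ 3"
      using N0 by (intro divide_right_mono) auto
    also have "\<dots> = C * ?N powr (-5/2)"
      using N0 powr_half_div_cube[of ?N] by (simp only: times_divide_eq_right[symmetric])
    also have "\<dots> \<le> C * lattice_weight ?p"
      using norm_powr_le_lattice_weight[OF p0] by (intro mult_left_mono) (auto simp: C_def)
    finally show "?p \<noteq> 0 \<and> ?r * norm (of_int_vec j) \<le> ?N \<and> \<rho> powi (lev j - lev k) / ?N ^ 3 \<le> C * lattice_weight ?p"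
      using p0 far by simp
  qed
qed

text \<open>The part \<open>(1 + d) / \<rho>\<^sup>2\<close> does not depend on \<open>f\<close>;
  the Schur bound is of order \<epsilon>. A small \<epsilon> thus pushes the total below 1 for all
  such \<open>f\<close> at once. The zero mode is excluded on both sides because the lower bound on
  the forms holds at nonzero points.\<close>

lemma uniform_contraction:
  obtains \<epsilon>1 q where "0 < \<epsilon>1" "0 < q" "q < 1" "\<epsilon>1 \<le> 1 / 32"
    "\<And>\<epsilon> f J K a. 0 \<le> \<epsilon> \<Longrightarrow> \<epsilon> \<le> \<epsilon>1 \<Longrightarrow> volume_preserving_diffeo f \<Longrightarrow>
       dist_Cinfinity f (torus_map_of_matrix A) \<le> \<epsilon> \<Longrightarrow> finite J \<Longrightarrow> finite K \<Longrightarrow> 0 \<notin> J \<Longrightarrow> 0 \<notin> K \<Longrightarrow>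
       (\<Sum>j\<in>J. (\<rho> powi lev j * cmod (\<Sum>k\<in>K. transfer_entry f j k * a k))\<^sup>2)
        \<le> q * (\<Sum>k\<in>K. (\<rho> powi lev k * cmod (a k))\<^sup>2)"
proof -
  obtain S where S: "S > 0" "\<And>P. finite P \<Longrightarrow> (\<Sum>p\<in>P. lattice_weight p) \<le> S"
    using lattice_weight_summable by metis
  obtain C where C: "C > 0" and far: "\<And>j k. j \<noteq> 0 \<Longrightarrow> k \<noteq> 0 \<Longrightarrow> lev k \<le> lev j \<Longrightarrow>
     k - transpose A *v j \<noteq> 0 \<and> near_radius * norm (of_int_vec j) \<le> norm (of_int_vec (k - transpose A *v j)) \<and>
     \<rho> powi (lev j - lev k) / norm (of_int_vec (k - transpose A *v j)) ^ 3 \<le> C * lattice_weight (k - transpose A *v j)"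
    using far_weight by metis
  let ?r = near_radius
  \<comment> \<open>\<open>1 + d\<close> is the midpoint of 1 and \<open>\<rho>\<^sup>2\<close>, so
    the gap \<open>g\<close> below is positive.\<close>
  define d where "d = (\<rho>\<^sup>2 - 1) / 2"
  have \<rho>2: "\<rho>\<^sup>2 > 1" using \<rho> by simp
  have d: "d > 0" using \<rho>2 by (simp add: d_def)
  define g where "g = 1 - (1 + d) / \<rho>\<^sup>2"
  have g: "g > 0" 
  proof -
    have "1 + (x - 1) / 2 < x" if "1 < x" for x :: real using that by (simp add: field_simps)
    then have "1 + d < \<rho>\<^sup>2" using \<rho>2 unfolding d_def by blast
    then show ?thesis using \<rho>2 by (simp add: g_def divide_less_eq)
  qed
  \<comment> \<open>Half of the gap is granted to the Schur part:
    \<open>(1 + 1 / d) * \<sigma>\<^sup>2 = g / 2\<close>.\<close>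
  define \<sigma> where "\<sigma> = sqrt (g / 2 / (1 + 1 / d))"
  have dd: "1 + 1 / d > 0" using d by (simp add: add_pos_pos)
  have \<sigma>: "\<sigma> > 0" unfolding \<sigma>_def using g dd by simp
  have "0 \<le> g / 2 / (1 + 1 / d)" using g dd by (intro divide_nonneg_nonneg) auto
  then have "\<sigma>\<^sup>2 = g / 2 / (1 + 1 / d)" unfolding \<sigma>_def by (rule real_sqrt_pow2)
  then have \<sigma>2: "(1 + 1 / d) * \<sigma>\<^sup>2 = g / 2" using dd by (metis less_irrefl nonzero_mult_div_cancel_left times_divide_eq_right)
  define c where "c = 8192 / ?r * C * S"
  have c: "c > 0" unfolding c_def using near_radius C S by simp
  \<comment> \<open>The three bounds serve the lift estimates, the condition
    \<open>128 * \<epsilon> \<le> r\<close> of non-stationary phase, and the Schur bound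
    \<sigma>.\<close>
  define \<epsilon>1 where "\<epsilon>1 = min (1 / 32) (min (?r / 128) (\<sigma> / c))"
  show thesis
  proof (rule that[of \<epsilon>1 "1 - g / 2"])
    show "0 < \<epsilon>1" unfolding \<epsilon>1_def using near_radius \<sigma> c by simp
    have "0 < (1 + d) / \<rho>\<^sup>2" using d \<rho>2 by (intro divide_pos_pos) auto
    then have "g < 1" unfolding g_def by simp
    then show "0 < 1 - g / 2" "1 - g / 2 < 1" using g by simp_all
    show "\<epsilon>1 \<le> 1 / 32" unfolding \<epsilon>1_def by (rule min.cobounded1)
    fix \<epsilon> f and J K :: "(int^2) set" and a :: "int^2 \<Rightarrow> complex"
    assume \<epsilon>: "0 \<le> \<epsilon>" "\<epsilon> \<le> \<epsilon>1" and f: "volume_preserving_diffeo f"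
      and dist: "dist_Cinfinity f (torus_map_of_matrix A) \<le> \<epsilon>"
      and fin: "finite J" "finite K" and z: "0 \<notin> J" "0 \<notin> K"
    interpret volume_preserving_diffeo f by (rule f)
    have \<epsilon>': "\<epsilon> \<le> 1 / 32" "128 * \<epsilon> \<le> ?r" "\<epsilon> * c \<le> \<sigma>"
    proof -
      have "\<epsilon> \<le> 1 / 32" "\<epsilon> \<le> ?r / 128" "\<epsilon> \<le> \<sigma> / c"
        using \<epsilon>(2) unfolding \<epsilon>1_def min.bounded_iff by blast+
      then show "\<epsilon> \<le> 1 / 32" "128 * \<epsilon> \<le> ?r" "\<epsilon> * c \<le> \<sigma>" using c by (auto simp: le_divide_eq mult.commute)
    qed
    have sf: "smooth_torus_map f" using smooth by (simp add: smooth_torus_diffeo_def)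
    obtain F where F: "is_smooth_lift F f"
      "\<And>v x. norm v \<le> 1 \<Longrightarrow> norm (iter_deriv [v] F x - real_mat A *v v) \<le> 32 * \<epsilon>"
      "\<And>vs x. 2 \<le> length vs \<Longrightarrow> length vs \<le> 4 \<Longrightarrow> \<forall>v\<in>set vs. norm v \<le> 1 \<Longrightarrow> norm (iter_deriv vs F x) \<le> 32 * \<epsilon>"
      by (rule near_matrix_lift[OF sf dist \<epsilon>'(1)]) (rule that)
    let ?c = "8192 * \<epsilon> / ?r * C"
    have c0: "0 \<le> ?c" using \<epsilon> near_radius C by simp
    have entry: "\<rho> powi (lev j - lev k) * cmod (transfer_entry f j k) \<le> ?c * lattice_weight (k - transpose A *v j)"
      if "j \<noteq> 0" "k \<noteq> 0" "lev k \<le> lev j" for j k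
    proof -
      let ?N = "norm (of_int_vec (k - transpose A *v j))"
      note fj = far[OF that]
      have "cmod (transfer_entry f j k) \<le> 8192 * \<epsilon> / ?r / ?N ^ 3"
        using fj \<epsilon>(1) \<epsilon>'(2) near_radius by (intro transfer_entry_far[OF F(1) measurable_f F(2,3)]) auto
      then have "\<rho> powi (lev j - lev k) * cmod (transfer_entry f j k) \<le> \<rho> powi (lev j - lev k) * (8192 * \<epsilon> / ?r / ?N ^ 3)"
        using \<rho> by (intro mult_left_mono) auto
      also have "\<dots> = 8192 * \<epsilon> / ?r * (\<rho> powi (lev j - lev k) / ?N ^ 3)" by simp
      also have "\<dots> \<le> 8192 * \<epsilon> / ?r * (C * lattice_weight (k - transpose A *v j))"
        using fj \<epsilon>(1) near_radius by (intro mult_left_mono) auto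
      finally show ?thesis by (simp add: mult.assoc)
    qed
    have cS: "?c * S \<le> \<sigma>" using \<epsilon>'(3) by (simp add: c_def mult_ac)
    have "(\<Sum>j\<in>J. (\<rho> powi lev j * cmod (\<Sum>k\<in>K. transfer_entry f j k * a k))\<^sup>2)
      \<le> ((1 + d) / \<rho>\<^sup>2 + (1 + 1 / d) * \<sigma>\<^sup>2) * (\<Sum>k\<in>K. (\<rho> powi lev k * cmod (a k))\<^sup>2)"
    proof (rule weighted_contraction[OF fin \<rho> d])
      show "0 \<le> \<sigma>" using \<sigma> by simp
      show "(\<Sum>j\<in>J. (cmod (\<Sum>k\<in>L. transfer_entry f j k * c k))\<^sup>2) \<le> (\<Sum>k\<in>L. (cmod (c k))\<^sup>2)" if "L \<subseteq> K" for L c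
        using fin that by (intro transfer_entry_contraction) (auto intro: finite_subset)
      show "(\<Sum>k | k \<in> K \<and> lev k \<le> lev j. \<rho> powi (lev j - lev k) * cmod (transfer_entry f j k)) \<le> \<sigma>" if "j \<in> J" for j
      proof -
        let ?K = "{k. k \<in> K \<and> lev k \<le> lev j}"
        have inj: "inj_on (\<lambda>k. k - transpose A *v j) ?K" by (auto simp: inj_on_def)
        have "(\<Sum>k\<in>?K. \<rho> powi (lev j - lev k) * cmod (transfer_entry f j k)) \<le> (\<Sum>k\<in>?K. ?c * lattice_weight (k - transpose A *v j))"
          using that z by (intro sum_mono entry) auto
        also have "\<dots> = ?c * (\<Sum>p\<in>(\<lambda>k. k - transpose A *v j) ` ?K. lattice_weight p)"
          by (simp only: sum_distrib_left[symmetric] sum.reindex[OF inj] o_def)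
        also have "\<dots> \<le> ?c * S" using c0 fin by (intro mult_left_mono S(2)) auto
        finally show ?thesis using cS by linarith
      qed
      show "(\<Sum>j | j \<in> J \<and> lev k \<le> lev j. \<rho> powi (lev j - lev k) * cmod (transfer_entry f j k)) \<le> \<sigma>" if "k \<in> K" for k
      proof -
        let ?J = "{j. j \<in> J \<and> lev k \<le> lev j}"
        \<comment> \<open>Injectivity of the transpose makes the mismatches in a column distinct, so
          \<open>S\<close> bounds column sums as well as row sums.\<close>
        have inj: "inj_on (\<lambda>j. k - transpose A *v j) ?J"
          using transpose_inj by (auto simp: inj_on_def simp del: transpose_matrix_vector)
        have "(\<Sum>j\<in>?J. \<rho> powi (lev j - lev k) * cmod (transfer_entry f j k)) \<le> (\<Sum>j\<in>?J. ?c * lattice_weight (k - transpose A *v j))"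
          using that z by (intro sum_mono entry) auto
        also have "\<dots> = ?c * (\<Sum>p\<in>(\<lambda>j. k - transpose A *v j) ` ?J. lattice_weight p)"
          by (simp only: sum_distrib_left[symmetric] sum.reindex[OF inj] o_def)
        also have "\<dots> \<le> ?c * S" using c0 fin by (intro mult_left_mono S(2)) auto
        finally show ?thesis using cS by linarith
      qed
    qed
    also have "(1 + d) / \<rho>\<^sup>2 + (1 + 1 / d) * \<sigma>\<^sup>2 = 1 - g / 2"
    proof -
      have "(1 + d) / \<rho>\<^sup>2 = 1 - g" by (simp add: g_def)
      then show ?thesis unfolding \<sigma>2 by linarith
    qed
    finally show "(\<Sum>j\<in>J. (\<rho> powi lev j * cmod (\<Sum>k\<in>K. transfer_entry f j k * a k))\<^sup>2)
        \<le> (1 - g / 2) * (\<Sum>k\<in>K. (\<rho> powi lev k * cmod (a k))\<^sup>2)" .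
  qed
qed

end


section \<open>Fourier coefficients of the iterates\<close>

lemma abs_summable_if_eq: "(\<lambda>k. norm ((if k = k0 then 1 else 0) :: complex)) summable_on (UNIV :: 'a set)"
proof -
  have "((\<lambda>k. norm ((if k = k0 then 1 else 0) :: complex)) has_sum 1) UNIV"
    using has_sum_finite_neutralI[of "{k0}" UNIV "\<lambda>k. norm ((if k = k0 then 1 else 0) :: complex)"] by simp
  then show ?thesis by (rule has_sum_imp_summable)
qed

definition heat_multiplier :: "real \<Rightarrow> int^2 \<Rightarrow> real" where
  "heat_multiplier t k = exp (- 4 * pi\<^sup>2 * t * (norm (of_int_vec k))\<^sup>2)"

lemma heat_semigroup_eq:
  "heat_semigroup t \<phi> = fourier_series (\<lambda>k. of_real (heat_multiplier t k) * fourier_coeff \<phi> k)"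
  by (rule ext) (simp only: heat_semigroup_def fourier_series_def heat_multiplier_def)

lemma heat_multiplier_bounds:
  assumes "t \<ge> 0"
  shows "0 \<le> heat_multiplier t k" "heat_multiplier t k \<le> 1"
    "k \<noteq> 0 \<Longrightarrow> heat_multiplier t k \<le> exp (- 4 * pi\<^sup>2 * t)"
    "1 - heat_multiplier t k \<le> 4 * pi\<^sup>2 * t * (norm (of_int_vec k))\<^sup>2"
proof -
  show "0 \<le> heat_multiplier t k" by (simp add: heat_multiplier_def)
  show "heat_multiplier t k \<le> 1" using assms by (simp add: heat_multiplier_def)
  show "1 - heat_multiplier t k \<le> 4 * pi\<^sup>2 * t * (norm (of_int_vec k))\<^sup>2"
    unfolding heat_multiplier_def using exp_ge_add_one_self[of "- 4 * pi\<^sup>2 * t * (norm (of_int_vec k))\<^sup>2"] by linarith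
  show "heat_multiplier t k \<le> exp (- 4 * pi\<^sup>2 * t)" if "k \<noteq> 0"
  proof -
    have "(4 * pi\<^sup>2 * t) * 1 \<le> (4 * pi\<^sup>2 * t) * (norm (of_int_vec k))\<^sup>2"
      using norm_of_int_vec_ge_1[OF that] assms by (intro mult_left_mono one_le_power) auto
    then show ?thesis unfolding heat_multiplier_def by simp
  qed
qed

lemma heat_multiplier_summable:
  assumes t: "t > 0"
  shows "heat_multiplier t summable_on UNIV"
proof -
  obtain S where S: "S > 0" "\<And>P. finite P \<Longrightarrow> (\<Sum>p\<in>P. lattice_weight p) \<le> S"
    using lattice_weight_summable by metis
  define c where "c = 4 * pi\<^sup>2 * t"
  have c: "c > 0" using t by (simp add: c_def)
  have le: "heat_multiplier t k \<le> (2 / c\<^sup>2) * lattice_weight k" if "k \<noteq> 0" for k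
  proof -
    let ?N = "norm (of_int_vec k)"
    have N: "1 \<le> ?N" by (rule norm_of_int_vec_ge_1[OF that])
    have y: "c * ?N\<^sup>2 > 0" using c N by (intro mult_pos_pos) auto
    \<comment> \<open>The quadratic Taylor term already yields decay of order |k|^(-4), enough for
      comparison with the lattice weight.\<close>
    have "(c * ?N\<^sup>2)\<^sup>2 / 2 \<le> exp (c * ?N\<^sup>2)"
      using exp_lower_Taylor_quadratic[of "c * ?N\<^sup>2"] y by simp
    then have "1 / exp (c * ?N\<^sup>2) \<le> 1 / ((c * ?N\<^sup>2)\<^sup>2 / 2)"
      using y by (intro divide_left_mono mult_pos_pos[OF exp_gt_zero] divide_pos_pos[OF zero_less_power[OF y]]) auto
    also have "\<dots> = 2 / c\<^sup>2 * (1 / ?N ^ 4)"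
      by (simp add: power_mult_distrib power_mult[symmetric])
    also have "\<dots> \<le> 2 / c\<^sup>2 * ?N powr (-5/2)"
    proof (rule mult_left_mono)
      have "1 / ?N ^ 4 = ?N powr (-4)" using N by (simp add: powr_minus powr_numeral divide_inverse)
      also have "\<dots> \<le> ?N powr (-5/2)" using N by (intro powr_mono) auto
      finally show "1 / ?N ^ 4 \<le> ?N powr (-5/2)" .
    qed simp
    also have "\<dots> \<le> 2 / c\<^sup>2 * lattice_weight k"
      using norm_powr_le_lattice_weight[OF that] by (intro mult_left_mono) auto
    finally show ?thesis by (simp add: heat_multiplier_def c_def exp_minus divide_inverse)
  qed
  show ?thesis
  proof (rule nonneg_bdd_above_summable_on)
    show "0 \<le> heat_multiplier t k" for k by (simp add: heat_multiplier_def)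
    show "bdd_above (sum (heat_multiplier t) ` {F. F \<subseteq> UNIV \<and> finite F})"
    proof (rule bdd_aboveI2)
      fix P :: "(int^2) set" assume "P \<in> {F. F \<subseteq> UNIV \<and> finite F}"
      then have P: "finite P" by simp
      have "sum (heat_multiplier t) P \<le> sum (heat_multiplier t) (insert 0 (P - {0}))"
        using P by (intro sum_mono2) (auto simp: heat_multiplier_def)
      also have "\<dots> = 1 + sum (heat_multiplier t) (P - {0})"
        by (subst sum.insert) (use P in \<open>auto simp: heat_multiplier_def of_int_vec_0\<close>)
      also have "sum (heat_multiplier t) (P - {0}) \<le> (\<Sum>p\<in>P - {0}. (2 / c\<^sup>2) * lattice_weight p)"
        by (intro sum_mono le) auto
      also have "\<dots> \<le> (2 / c\<^sup>2) * S"
        unfolding sum_distrib_left[symmetric] using P by (intro mult_left_mono S(2)) auto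
      finally show "sum (heat_multiplier t) P \<le> 1 + (2 / c\<^sup>2) * S" by simp
    qed
  qed
qed

text \<open>Matrix estimates are proved for finite truncations of the columns. The inequality is
  closed under limits, which transfers them to convergent infinite rows while \<open>J\<close> stays
  finite.\<close>

lemma weighted_l2_has_sum:
  fixes M :: "'j \<Rightarrow> 'k \<Rightarrow> complex"
  assumes J: "finite J" and s: "\<And>j. j \<in> J \<Longrightarrow> ((\<lambda>k. a k * M j k) has_sum b j) UNIV"
    and bd: "\<And>K. finite K \<Longrightarrow> (\<Sum>j\<in>J. (w j * cmod (\<Sum>k\<in>K. M j k * a k))\<^sup>2) \<le> B"
  shows "(\<Sum>j\<in>J. (w j * cmod (b j))\<^sup>2) \<le> B"
proof (rule tendsto_upperbound)
  show "((\<lambda>K. \<Sum>j\<in>J. (w j * cmod (\<Sum>k\<in>K. a k * M j k))\<^sup>2) \<longlongrightarrow> (\<Sum>j\<in>J. (w j * cmod (b j))\<^sup>2)) (finite_subsets_at_top UNIV)"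
    using s unfolding has_sum_def by (intro tendsto_intros) auto
  show "\<forall>\<^sub>F K in finite_subsets_at_top UNIV. (\<Sum>j\<in>J. (w j * cmod (\<Sum>k\<in>K. a k * M j k))\<^sup>2) \<le> B"
    using bd by (intro eventually_finite_subsets_at_top_weakI) (simp add: mult.commute)
qed simp

lemma cmod_contracted_sum_le:
  fixes h :: real
  assumes "0 \<le> h" "h \<le> 1"
  shows "cmod (of_real h * u + of_real h * v + w) \<le> cmod u + cmod v + cmod w"
proof -
  have "cmod (of_real h * z) \<le> cmod z" for z
    using assms by (simp add: norm_mult mult_left_le_one_le)
  then show ?thesis
    using norm_triangle_ineq[of "of_real h * u + of_real h * v" w] norm_triangle_ineq[of "of_real h * u" "of_real h * v"]
    by (smt (verit))
qed

text \<open>Fourier coefficients of the iterates. The recursion passes through the function because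
  \<open>transfer_op\<close> acts by composition; \<open>scalar_coeff_step\<close> recovers the
  matrix form.\<close>

primrec scalar_coeff :: "(torus \<Rightarrow> torus) \<Rightarrow> real \<Rightarrow> int^2 \<Rightarrow> nat \<Rightarrow> int^2 \<Rightarrow> complex" where
  "scalar_coeff f \<kappa> k0 0 = (\<lambda>k. if k = k0 then 1 else 0)"
| "scalar_coeff f \<kappa> k0 (Suc n) = (\<lambda>j. of_real (heat_multiplier \<kappa> j)
     * fourier_coeff (transfer_op f (fourier_series (scalar_coeff f \<kappa> k0 n))) j)"

lemma fourier_series_single: "fourier_series (\<lambda>k. if k = k0 then 1 else 0) = fourier_mode k0"
proof
  fix x
  have "((\<lambda>k. (if k = k0 then 1 else 0) * fourier_mode k x) has_sum fourier_mode k0 x) UNIV"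
    using has_sum_finite_neutralI[of "{k0}" UNIV "\<lambda>k. (if k = k0 then 1 else 0) * fourier_mode k x"] by simp
  then show "fourier_series (\<lambda>k. if k = k0 then 1 else 0) x = fourier_mode k0 x"
    unfolding fourier_series_def by (rule infsumI)
qed

lemma diffusive_iterate:
  "(diffusive_transfer_op f \<kappa> ^^ n) (fourier_mode k0) = fourier_series (scalar_coeff f \<kappa> k0 n)"
  by (induction n) (simp_all add: fourier_series_single diffusive_transfer_op_def heat_semigroup_eq)

context volume_preserving_diffeo
begin

text \<open>After composition with \<open>inv f\<close> the coefficients are still bounded by the
  sup norm, and the summable heat multiplier restores absolute summability.\<close>

lemma scalar_coeff_abs_summable:
  assumes \<kappa>: "\<kappa> > 0"
  shows "(\<lambda>k. norm (scalar_coeff f \<kappa> k0 n k)) summable_on UNIV"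
proof (induction n)
  case 0
  then show ?case using abs_summable_if_eq by simp
next
  case (Suc m)
  let ?a = "scalar_coeff f \<kappa> k0 m"
  let ?B = "\<Sum>\<^sub>\<infinity>k. cmod (?a k)"
  have "cmod (fourier_coeff (transfer_op f (fourier_series ?a)) j) \<le> ?B" for j
    unfolding fourier_coeff_def transfer_op_def
    by (rule norm_integral_haar_le)
      (auto simp: norm_mult intro!: cmod_fourier_series_le[OF Suc] infsum_nonneg)
  then have le: "norm (scalar_coeff f \<kappa> k0 (Suc m) j) \<le> heat_multiplier \<kappa> j * ?B" for j
    using heat_multiplier_bounds(1)[of \<kappa> j] \<kappa> by (simp add: norm_mult mult_left_mono)
  have "(\<lambda>j. heat_multiplier \<kappa> j * ?B) summable_on UNIV"
    by (intro summable_on_cmult_left heat_multiplier_summable \<kappa>)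
  then show ?case
    by (rule summable_on_comparison_test) (rule le, simp)
qed

lemma scalar_coeff_step:
  assumes \<kappa>: "\<kappa> > 0"
  obtains b where "\<And>j. ((\<lambda>k. scalar_coeff f \<kappa> k0 n k * transfer_entry f j k) has_sum b j) UNIV"
    "\<And>j. scalar_coeff f \<kappa> k0 (Suc n) j = of_real (heat_multiplier \<kappa> j) * b j"
  using that[of "fourier_coeff (transfer_op f (fourier_series (scalar_coeff f \<kappa> k0 n)))"]
    has_sum_fourier_coeff_transfer[OF scalar_coeff_abs_summable[OF \<kappa>]] by simp

text \<open>Row 0 of the matrix vanishes off \<open>k = 0\<close>, so the mean stays zero and every
  later sum may omit that mode.\<close>

lemma scalar_coeff_0:
  assumes \<kappa>: "\<kappa> > 0" and k0: "k0 \<noteq> 0"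
  shows "scalar_coeff f \<kappa> k0 n 0 = 0"
proof (induction n)
  case (Suc n)
  obtain b where b: "\<And>j. ((\<lambda>k. scalar_coeff f \<kappa> k0 n k * transfer_entry f j k) has_sum b j) UNIV"
    "\<And>j. scalar_coeff f \<kappa> k0 (Suc n) j = of_real (heat_multiplier \<kappa> j) * b j"
    using scalar_coeff_step[OF \<kappa>] by metis
  have "(\<lambda>k. scalar_coeff f \<kappa> k0 n k * transfer_entry f 0 k) = (\<lambda>k. 0)"
  proof
    fix k show "scalar_coeff f \<kappa> k0 n k * transfer_entry f 0 k = 0"
      using Suc transfer_entry_0_left[of k] by (cases "k = 0") auto
  qed
  then have "b 0 = 0" using b(1)[of 0] by (metis has_sum_0 has_sum_unique)
  then show ?case by (simp only: b(2)) simp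
qed (use k0 in auto)

text \<open>Kept general in the weight since it is used twice: with weight 1 and heat factor
  \<open>h < 1\<close>, for convergence at a rate depending on \<kappa>; with the hyperbolic weight
  and \<open>h = 1\<close>, for a rate uniform in \<kappa> and \<open>f\<close>.\<close>

lemma scalar_coeff_weighted_decay:
  fixes w :: "int^2 \<Rightarrow> real"
  assumes \<kappa>: "\<kappa> > 0" and k0: "k0 \<noteq> 0" and q: "q \<ge> 0" and w: "\<And>j. 0 \<le> w j"
    and contr: "\<And>J K a. finite J \<Longrightarrow> finite K \<Longrightarrow> 0 \<notin> J \<Longrightarrow> 0 \<notin> K \<Longrightarrow>
      (\<Sum>j\<in>J. (w j * cmod (\<Sum>k\<in>K. transfer_entry f j k * a k))\<^sup>2) \<le> q * (\<Sum>k\<in>K. (w k * cmod (a k))\<^sup>2)"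
    and h: "0 \<le> h" "\<And>j. j \<noteq> 0 \<Longrightarrow> heat_multiplier \<kappa> j \<le> h"
    and J: "finite J" "0 \<notin> J"
  shows "(\<Sum>j\<in>J. (w j * cmod (scalar_coeff f \<kappa> k0 n j))\<^sup>2) \<le> (h\<^sup>2 * q) ^ n * (w k0)\<^sup>2"
  using J
proof (induction n arbitrary: J)
  case 0
  have "(\<Sum>j\<in>J. (w j * cmod (scalar_coeff f \<kappa> k0 0 j))\<^sup>2) = (\<Sum>j\<in>J. if j = k0 then (w k0)\<^sup>2 else 0)"
    by (intro sum.cong) auto
  also have "\<dots> \<le> (w k0)\<^sup>2" using 0 by simp
  finally show ?case by simp
next
  case (Suc n)
  let ?a = "scalar_coeff f \<kappa> k0 n"
  let ?W = "(h\<^sup>2 * q) ^ n * (w k0)\<^sup>2"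
  obtain b where b: "\<And>j. ((\<lambda>k. ?a k * transfer_entry f j k) has_sum b j) UNIV"
    "\<And>j. scalar_coeff f \<kappa> k0 (Suc n) j = of_real (heat_multiplier \<kappa> j) * b j"
    using scalar_coeff_step[OF \<kappa>] by metis
  have "(\<Sum>j\<in>J. (w j * cmod (b j))\<^sup>2) \<le> q * ?W"
  proof (rule weighted_l2_has_sum[OF Suc.prems(1) b(1)])
    fix K :: "(int^2) set" assume K: "finite K"
    have "(\<Sum>k\<in>K. transfer_entry f j k * ?a k) = (\<Sum>k\<in>K - {0}. transfer_entry f j k * ?a k)" for j
      using K scalar_coeff_0[OF \<kappa> k0] by (intro sum.mono_neutral_right) auto
    then have "(\<Sum>j\<in>J. (w j * cmod (\<Sum>k\<in>K. transfer_entry f j k * ?a k))\<^sup>2)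
        \<le> q * (\<Sum>k\<in>K - {0}. (w k * cmod (?a k))\<^sup>2)"
      using contr[of J "K - {0}" ?a] Suc.prems K by simp
    also have "\<dots> \<le> q * ?W" using K q by (intro mult_left_mono Suc.IH) auto
    finally show "(\<Sum>j\<in>J. (w j * cmod (\<Sum>k\<in>K. transfer_entry f j k * ?a k))\<^sup>2) \<le> q * ?W" .
  qed
  moreover have "(\<Sum>j\<in>J. (w j * cmod (scalar_coeff f \<kappa> k0 (Suc n) j))\<^sup>2) \<le> (\<Sum>j\<in>J. h\<^sup>2 * (w j * cmod (b j))\<^sup>2)"
  proof (rule sum_mono)
    fix j assume "j \<in> J"
    then have "j \<noteq> 0" using Suc.prems(2) by metis
    then have hj: "heat_multiplier \<kappa> j \<le> h" by (rule h(2))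
    have h0: "0 \<le> heat_multiplier \<kappa> j" using heat_multiplier_bounds(1)[of \<kappa>] \<kappa> by simp
    have "w j * cmod (scalar_coeff f \<kappa> k0 (Suc n) j) = heat_multiplier \<kappa> j * (w j * cmod (b j))"
      using h0 by (simp only: b(2)) (simp add: norm_mult)
    also have "\<dots> \<le> h * (w j * cmod (b j))" using hj w by (intro mult_right_mono) auto
    finally have "(w j * cmod (scalar_coeff f \<kappa> k0 (Suc n) j))\<^sup>2 \<le> (h * (w j * cmod (b j)))\<^sup>2"
      using w by (intro power_mono) auto
    then show "(w j * cmod (scalar_coeff f \<kappa> k0 (Suc n) j))\<^sup>2 \<le> h\<^sup>2 * (w j * cmod (b j))\<^sup>2"
      by (simp only: power_mult_distrib)
  qed
  ultimately have "(\<Sum>j\<in>J. (w j * cmod (scalar_coeff f \<kappa> k0 (Suc n) j))\<^sup>2) \<le> h\<^sup>2 * (q * ?W)"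
    unfolding sum_distrib_left[symmetric]
    by (meson mult_left_mono order_trans zero_le_power2)
  then show ?case by (simp add: mult_ac)
qed

lemma scalar_coeff_l2_decay:
  assumes "\<kappa> > 0" "k0 \<noteq> 0" "finite J"
  shows "(\<Sum>j\<in>J. (cmod (scalar_coeff f \<kappa> k0 n j))\<^sup>2) \<le> exp (- 8 * pi\<^sup>2 * \<kappa>) ^ n"
proof -
  have "(\<Sum>j\<in>J. (cmod (scalar_coeff f \<kappa> k0 n j))\<^sup>2) = (\<Sum>j\<in>J - {0}. (1 * cmod (scalar_coeff f \<kappa> k0 n j))\<^sup>2)"
    using assms scalar_coeff_0 by (intro sum.mono_neutral_cong_right) auto
  also have "\<dots> \<le> ((exp (- 4 * pi\<^sup>2 * \<kappa>))\<^sup>2 * 1) ^ n * 1\<^sup>2"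
  proof (rule scalar_coeff_weighted_decay[where w="\<lambda>_. 1"])
    show "heat_multiplier \<kappa> j \<le> exp (- 4 * pi\<^sup>2 * \<kappa>)" if "j \<noteq> 0" for j
      using heat_multiplier_bounds(3)[OF _ that] assms by simp
  qed (use assms transfer_entry_contraction in auto)
  also have "(exp (- 4 * pi\<^sup>2 * \<kappa>))\<^sup>2 = exp (- 8 * pi\<^sup>2 * \<kappa>)"
    unfolding power2_eq_square[of "exp _"] exp_add[symmetric] by (simp add: algebra_simps)
  finally show ?thesis by simp
qed

text \<open>Errors accumulate without amplification, because neither the transfer matrix nor the
  heat multiplier increases the \<open>\<ell>\<^sup>2\<close> norm. Passing to \<open>orb m\<close>
  adds the error of one matrix column and the heat loss of one mode.\<close>

lemma scalar_coeff_near_orbit: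
  assumes \<kappa>: "\<kappa> > 0" and close: "\<And>x. dist (f x) (torus_map_of_matrix A x) \<le> d"
    and orb: "orb 0 = k0" "\<And>n. transpose A *v orb (Suc n) = orb n"
    and J: "finite J"
  shows "L2_set (\<lambda>j. cmod (scalar_coeff f \<kappa> k0 n j - (if j = orb n then 1 else 0))) J
     \<le> (\<Sum>m=1..n. 2 * pi * norm (of_int_vec (orb m)) * d + 4 * pi\<^sup>2 * \<kappa> * (norm (of_int_vec (orb m)))\<^sup>2)"
  using J
proof (induction n arbitrary: J)
  case 0
  then show ?case by (simp add: orb(1) L2_set_def)
next
  case (Suc n)
  let ?a = "scalar_coeff f \<kappa> k0 n" and ?k = "orb n" and ?k' = "orb (Suc n)"
  let ?E = "\<Sum>m=1..n. 2 * pi * norm (of_int_vec (orb m)) * d + 4 * pi\<^sup>2 * \<kappa> * (norm (of_int_vec (orb m)))\<^sup>2"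
  let ?M = "transfer_entry f" and ?h = "heat_multiplier \<kappa>"
  have E0: "0 \<le> ?E" using Suc.IH[of "{}"] by simp
  have d0: "0 \<le> d" using close zero_le_dist order_trans by blast
  have h0: "0 \<le> ?h j" "?h j \<le> 1" for j using heat_multiplier_bounds(1,2)[of \<kappa>] \<kappa> by simp_all
  obtain b where b: "\<And>j. ((\<lambda>k. ?a k * ?M j k) has_sum b j) UNIV"
    "\<And>j. scalar_coeff f \<kappa> k0 (Suc n) j = of_real (?h j) * b j"
    using scalar_coeff_step[OF \<kappa>] by metis
  have diff: "((\<lambda>k. (?a k - (if k = ?k then 1 else 0)) * ?M j k) has_sum (b j - ?M j ?k)) UNIV" for j
  proof -
    have "((\<lambda>k. (if k = ?k then 1 else 0) * ?M j k) has_sum ?M j ?k) UNIV"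
      using has_sum_finite_neutralI[of "{?k}" UNIV "\<lambda>k. (if k = ?k then 1 else 0) * ?M j k"] by simp
    from has_sum_add[OF b(1) has_sum_uminusI[OF this]] show ?thesis by (simp add: left_diff_distrib)
  qed
  have "(\<Sum>j\<in>J. (1 * cmod (b j - ?M j ?k))\<^sup>2) \<le> ?E\<^sup>2"
  proof (rule weighted_l2_has_sum[OF Suc.prems diff])
    fix K :: "(int^2) set" assume K: "finite K"
    have "(\<Sum>j\<in>J. (1 * cmod (\<Sum>k\<in>K. ?M j k * (?a k - (if k = ?k then 1 else 0))))\<^sup>2)
       \<le> (\<Sum>k\<in>K. (cmod (?a k - (if k = ?k then 1 else 0)))\<^sup>2)"
      using transfer_entry_contraction[OF Suc.prems K] by simp
    also have "\<dots> = (L2_set (\<lambda>k. cmod (?a k - (if k = ?k then 1 else 0))) K)\<^sup>2"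
      by (simp add: L2_set_def sum_nonneg)
    also have "\<dots> \<le> ?E\<^sup>2" by (intro power_mono Suc.IH K L2_set_nonneg)
    finally show "(\<Sum>j\<in>J. (1 * cmod (\<Sum>k\<in>K. ?M j k * (?a k - (if k = ?k then 1 else 0))))\<^sup>2) \<le> ?E\<^sup>2" .
  qed
  then have 1: "L2_set (\<lambda>j. cmod (b j - ?M j ?k)) J \<le> ?E"
    unfolding L2_set_def using E0 by (simp add: real_le_lsqrt sum_nonneg)
  have 2: "L2_set (\<lambda>j. cmod (?M j ?k - (if j = ?k' then 1 else 0))) J \<le> 2 * pi * norm (of_int_vec ?k') * d"
    unfolding L2_set_def using transfer_entry_column[OF close Suc.prems orb(2)] d0
    by (simp add: real_le_lsqrt sum_nonneg)
  have 3: "L2_set (\<lambda>j. cmod (of_real (?h j - 1) * (if j = ?k' then 1 else 0))) J \<le> 4 * pi\<^sup>2 * \<kappa> * (norm (of_int_vec ?k'))\<^sup>2"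
  proof -
    have "(\<Sum>j\<in>J. (cmod (of_real (?h j - 1) * (if j = ?k' then 1 else 0)))\<^sup>2) = (\<Sum>j\<in>J. if j = ?k' then (1 - ?h ?k')\<^sup>2 else 0)"
      by (intro sum.cong) (auto simp: norm_mult power2_commute simp del: of_real_diff)
    also have "\<dots> \<le> (1 - ?h ?k')\<^sup>2" using Suc.prems by simp
    also have "\<dots> \<le> (4 * pi\<^sup>2 * \<kappa> * (norm (of_int_vec ?k'))\<^sup>2)\<^sup>2"
      using heat_multiplier_bounds(4)[of \<kappa> ?k'] h0[of ?k'] \<kappa> by (intro power_mono) auto
    finally show ?thesis unfolding L2_set_def using \<kappa> by (intro real_le_lsqrt) (auto intro: sum_nonneg)
  qed
  have "L2_set (\<lambda>j. cmod (scalar_coeff f \<kappa> k0 (Suc n) j - (if j = ?k' then 1 else 0))) J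
     \<le> L2_set (\<lambda>j. (cmod (b j - ?M j ?k) + cmod (?M j ?k - (if j = ?k' then 1 else 0)))
          + cmod (of_real (?h j - 1) * (if j = ?k' then 1 else 0))) J"
  proof (rule L2_set_mono)
    fix j
    let ?\<delta> = "if j = ?k' then 1 else 0 :: complex"
    \<comment> \<open>The three terms are the propagated earlier error, the error of the column at
      \<open>orb n\<close>, and the diffusive loss on the exact mode.\<close>
    have "scalar_coeff f \<kappa> k0 (Suc n) j - ?\<delta> = of_real (?h j) * (b j - ?M j ?k) + of_real (?h j) * (?M j ?k - ?\<delta>) + of_real (?h j - 1) * ?\<delta>"
      unfolding b(2) by (simp add: algebra_simps)
    then show "cmod (scalar_coeff f \<kappa> k0 (Suc n) j - ?\<delta>) \<le> (cmod (b j - ?M j ?k) + cmod (?M j ?k - ?\<delta>)) + cmod (of_real (?h j - 1) * ?\<delta>)"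
      using cmod_contracted_sum_le[OF h0] by (simp only:)
  qed simp
  also have "\<dots> \<le> L2_set (\<lambda>j. cmod (b j - ?M j ?k) + cmod (?M j ?k - (if j = ?k' then 1 else 0))) J
      + L2_set (\<lambda>j. cmod (of_real (?h j - 1) * (if j = ?k' then 1 else 0))) J"
    by (rule L2_set_triangle_ineq)
  also have "\<dots> \<le> (?E + 2 * pi * norm (of_int_vec ?k') * d) + 4 * pi\<^sup>2 * \<kappa> * (norm (of_int_vec ?k'))\<^sup>2"
    using order_trans[OF L2_set_triangle_ineq add_mono[OF 1 2]] 3 by (rule add_mono)
  finally show ?case by simp
qed

end


section \<open>Second moments of the stationary scalar\<close>

text \<open>Tonelli: the expectation of the series is at most the sum of \<open>b\<close>, so the
  series is finite almost surely.\<close>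

lemma AE_summable_weighted:
  fixes Z :: "nat \<Rightarrow> 'w \<Rightarrow> real" and b :: "nat \<Rightarrow> real"
  assumes int: "\<And>n. integrable M (Z n)" and nn: "\<And>n w. 0 \<le> Z n w" and le: "\<And>n. (\<integral>w. Z n w \<partial>M) \<le> 1"
    and b: "summable b" "\<And>n. 0 \<le> b n"
  shows "AE w in M. summable (\<lambda>n. b n * Z n w)" and "integrable M (\<lambda>w. \<Sum>n. b n * Z n w)"
proof -
  have [measurable]: "Z n \<in> borel_measurable M" for n using int by blast
  have sm: "summable (\<lambda>n. \<integral>w. norm (b n * Z n w) \<partial>M)"
  proof (rule summable_comparison_test'[OF b(1), of 0])
    fix n :: nat
    have "(\<integral>w. norm (b n * Z n w) \<partial>M) = b n * (\<integral>w. Z n w \<partial>M)"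
      using nn b(2) by (simp add: abs_mult)
    also have "\<dots> \<le> b n * 1" using le b(2) by (intro mult_left_mono)
    finally show "norm (\<integral>w. norm (b n * Z n w) \<partial>M) \<le> b n" by simp
  qed
  have "(\<integral>\<^sup>+w. (\<Sum>n. ennreal (b n * Z n w)) \<partial>M) = (\<Sum>n. \<integral>\<^sup>+w. ennreal (b n * Z n w) \<partial>M)"
    by (rule nn_integral_suminf) measurable
  also have "\<dots> = (\<Sum>n. ennreal (\<integral>w. norm (b n * Z n w) \<partial>M))"
    using int nn b(2) by (intro arg_cong[where f=suminf] ext) (simp add: nn_integral_eq_integral abs_mult)
  also have "\<dots> \<noteq> \<infinity>"
    using sm by (simp add: ennreal_suminf_neq_top integral_nonneg_AE)
  finally have "AE w in M. (\<Sum>n. ennreal (b n * Z n w)) \<noteq> \<infinity>"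
    by (intro nn_integral_PInf_AE) measurable
  then show AE: "AE w in M. summable (\<lambda>n. b n * Z n w)"
  proof eventually_elim
    case (elim w)
    then show ?case using b(2) nn by (intro summable_suminf_not_top) auto
  qed
  show "integrable M (\<lambda>w. \<Sum>n. b n * Z n w)"
  proof (rule integrable_suminf[OF _ _ sm])
    show "integrable M (\<lambda>w. b n * Z n w)" for n using int by simp
    show "AE w in M. summable (\<lambda>n. norm (b n * Z n w))"
      using AE by eventually_elim (use nn b(2) in \<open>simp add: abs_mult\<close>)
  qed
qed

section \<open>Orthogonality of the noise\<close>

locale normalized_noise =
  fixes M :: "'w measure" and \<eta> :: "nat \<Rightarrow> 'w \<Rightarrow> real"
  assumes noise: "normalized_iid M \<eta>"
begin

sublocale prob_space M
  using noise by (simp add: normalized_iid_def)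

lemma measurable_noise [measurable]: "\<eta> n \<in> borel_measurable M"
  using noise unfolding normalized_iid_def indep_vars_def2 by auto

lemma integrable_noise_sq [simp]: "integrable M (\<lambda>w. (\<eta> n w)\<^sup>2)"
  using noise by (simp add: normalized_iid_def)

lemma integrable_noise [simp]: "integrable M (\<eta> n)"
  by (rule square_integrable_imp_integrable) auto

lemma noise_mean: "expectation (\<eta> n) = 0"
  using noise by (simp add: normalized_iid_def)

lemma noise_sq: "expectation (\<lambda>w. (\<eta> n w)\<^sup>2) = 1"
proof -
  have "variance (\<eta> n) = 1" using noise unfolding normalized_iid_def by blast
  then show ?thesis by (simp add: noise_mean)
qed

lemma noise_cov:
  shows "integrable M (\<lambda>w. \<eta> n w * \<eta> m w)" "expectation (\<lambda>w. \<eta> n w * \<eta> m w) = (if n = m then 1 else 0)"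
proof -
  have ind: "indep_vars (\<lambda>_. borel) \<eta> {n, m}"
    by (rule indep_vars_subset[where I=UNIV]) (use noise in \<open>simp_all add: normalized_iid_def\<close>)
  have "expectation (\<lambda>w. \<eta> n w * \<eta> m w) = 0 \<and> integrable M (\<lambda>w. \<eta> n w * \<eta> m w)" if "n \<noteq> m"
    using indep_vars_lebesgue_integral[OF _ ind] indep_vars_integrable[OF _ ind] that
    by (simp add: noise_mean)
  then show "integrable M (\<lambda>w. \<eta> n w * \<eta> m w)" "expectation (\<lambda>w. \<eta> n w * \<eta> m w) = (if n = m then 1 else 0)"
    using noise_sq[of n] integrable_noise_sq[of n] by (cases "n = m"; simp add: power2_eq_square)+
qed

lemma expectation_abs_noise: "expectation (\<lambda>w. \<bar>\<eta> n w\<bar>) \<le> 1"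
proof -
  have "expectation (\<lambda>w. \<bar>\<eta> n w\<bar>) \<le> expectation (\<lambda>w. (1 + (\<eta> n w)\<^sup>2) / 2)"
  proof (rule integral_mono)
    fix w
    have "0 \<le> (\<bar>\<eta> n w\<bar> - 1)\<^sup>2" by simp
    then show "\<bar>\<eta> n w\<bar> \<le> (1 + (\<eta> n w)\<^sup>2) / 2" by (simp add: power2_diff)
  qed auto
  also have "\<dots> = 1" by (simp add: noise_sq prob_space)
  finally show ?thesis .
qed

lemma AE_summable_noise:
  assumes "summable b" "\<And>n. 0 \<le> b n"
  shows "AE w in M. summable (\<lambda>n. b n * \<bar>\<eta> n w\<bar>)"
  by (rule AE_summable_weighted(1)) (use assms expectation_abs_noise in auto)

lemma expectation_finite_sum_sq:
  fixes r :: "nat \<Rightarrow> real"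
  shows "integrable M (\<lambda>w. (\<Sum>n<N. \<eta> n w * r n)\<^sup>2)" "expectation (\<lambda>w. (\<Sum>n<N. \<eta> n w * r n)\<^sup>2) = (\<Sum>n<N. (r n)\<^sup>2)"
proof -
  have eq: "(\<lambda>w. (\<Sum>n<N. \<eta> n w * r n)\<^sup>2) = (\<lambda>w. \<Sum>n<N. \<Sum>m<N. r n * r m * (\<eta> n w * \<eta> m w))"
    by (simp add: power2_eq_square sum_product mult_ac)
  show "integrable M (\<lambda>w. (\<Sum>n<N. \<eta> n w * r n)\<^sup>2)"
    unfolding eq using noise_cov(1) by simp
  have "expectation (\<lambda>w. (\<Sum>n<N. \<eta> n w * r n)\<^sup>2) = (\<Sum>n<N. \<Sum>m<N. r n * r m * (if n = m then 1 else 0))"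
    unfolding eq using noise_cov by simp
  also have "\<dots> = (\<Sum>n<N. (r n)\<^sup>2)"
    by (simp add: if_distrib[of "(*) _"] power2_eq_square cong: if_cong)
  finally show "expectation (\<lambda>w. (\<Sum>n<N. \<eta> n w * r n)\<^sup>2) = (\<Sum>n<N. (r n)\<^sup>2)" .
qed

text \<open>Orthogonality settles the partial sums, dominated convergence the limit. Cauchy-Schwarz
  with weights \<open>norm (c n)\<close> produces the majorant \<open>?D\<close>, which is
  integrable by second moments.\<close>

lemma random_series_second_moment:
  fixes c :: "nat \<Rightarrow> complex"
  assumes c: "summable (\<lambda>n. norm (c n))"
  shows "integrable M (\<lambda>w. (cmod (\<Sum>n. of_real (\<eta> n w) * c n))\<^sup>2)"
    and "(\<lambda>n. (cmod (c n))\<^sup>2) sums expectation (\<lambda>w. (cmod (\<Sum>n. of_real (\<eta> n w) * c n))\<^sup>2)"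
proof -
  let ?C = "\<Sum>n. norm (c n)"
  let ?S = "\<lambda>N w. \<Sum>n<N. of_real (\<eta> n w) * c n"
  let ?D = "\<lambda>w. ?C * (\<Sum>n. norm (c n) * (\<eta> n w)\<^sup>2)"
  have ints: "integrable M (\<lambda>w. (cmod (?S N w))\<^sup>2)"
    and exps: "expectation (\<lambda>w. (cmod (?S N w))\<^sup>2) = (\<Sum>n<N. (cmod (c n))\<^sup>2)" for N
  proof -
    have eq: "(\<lambda>w. (cmod (?S N w))\<^sup>2) = (\<lambda>w. (\<Sum>n<N. \<eta> n w * Re (c n))\<^sup>2 + (\<Sum>n<N. \<eta> n w * Im (c n))\<^sup>2)"
      by (simp add: cmod_power2)
    show "integrable M (\<lambda>w. (cmod (?S N w))\<^sup>2)"
      unfolding eq using expectation_finite_sum_sq(1) by simp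
    have "expectation (\<lambda>w. (cmod (?S N w))\<^sup>2) = (\<Sum>n<N. (Re (c n))\<^sup>2) + (\<Sum>n<N. (Im (c n))\<^sup>2)"
      unfolding eq using expectation_finite_sum_sq by simp
    then show "expectation (\<lambda>w. (cmod (?S N w))\<^sup>2) = (\<Sum>n<N. (cmod (c n))\<^sup>2)"
      by (simp add: cmod_power2 sum.distrib)
  qed
  have w: "integrable M ?D"
    using AE_summable_weighted(2)[of M "\<lambda>n w. (\<eta> n w)\<^sup>2" "\<lambda>n. norm (c n)"] c noise_sq by simp
  have AE1: "AE w in M. summable (\<lambda>n. norm (c n) * \<bar>\<eta> n w\<bar>)"
    by (rule AE_summable_noise) (use c in auto)
  have AE2: "AE w in M. summable (\<lambda>n. norm (c n) * (\<eta> n w)\<^sup>2)"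
    by (rule AE_summable_weighted(1)) (use c noise_sq in auto)
  have lim: "AE w in M. (\<lambda>N. (cmod (?S N w))\<^sup>2) \<longlonglongrightarrow> (cmod (\<Sum>n. of_real (\<eta> n w) * c n))\<^sup>2"
    using AE1
  proof eventually_elim
    case (elim w)
    then have "summable (\<lambda>n. norm (of_real (\<eta> n w) * c n))" by (simp add: norm_mult mult.commute)
    then have "(\<lambda>N. ?S N w) \<longlonglongrightarrow> (\<Sum>n. of_real (\<eta> n w) * c n)"
      by (rule summable_LIMSEQ[OF summable_norm_cancel])
    then show ?case by (intro tendsto_power tendsto_norm)
  qed
  have bound: "AE w in M. norm ((cmod (?S N w))\<^sup>2) \<le> ?D w" for N
    using AE2
  proof eventually_elim
    case (elim w)
    have "cmod (?S N w) \<le> (\<Sum>n<N. norm (c n) * \<bar>\<eta> n w\<bar>)"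
      by (rule sum_norm_le) (simp add: norm_mult)
    also have "\<dots> = (\<Sum>n<N. sqrt (norm (c n)) * (sqrt (norm (c n)) * \<bar>\<eta> n w\<bar>))"
      by (intro sum.cong refl) (simp flip: mult.assoc)
    finally have "(cmod (?S N w))\<^sup>2 \<le> (\<Sum>n<N. sqrt (norm (c n)) * (sqrt (norm (c n)) * \<bar>\<eta> n w\<bar>))\<^sup>2"
      by (intro power_mono) auto
    also have "\<dots> \<le> (\<Sum>n<N. (sqrt (norm (c n)))\<^sup>2) * (\<Sum>n<N. (sqrt (norm (c n)) * \<bar>\<eta> n w\<bar>)\<^sup>2)"
      by (rule Cauchy_Schwarz_ineq_sum)
    also have "\<dots> = (\<Sum>n<N. norm (c n)) * (\<Sum>n<N. norm (c n) * (\<eta> n w)\<^sup>2)"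
      by (simp add: power_mult_distrib)
    also have "\<dots> \<le> ?D w"
      using c elim by (intro mult_mono sum_le_suminf sum_nonneg suminf_nonneg) auto
    finally show ?case by simp
  qed
  show "integrable M (\<lambda>w. (cmod (\<Sum>n. of_real (\<eta> n w) * c n))\<^sup>2)"
    by (rule integrable_dominated_convergence[OF _ _ w lim bound]) measurable
  have "(\<lambda>N. expectation (\<lambda>w. (cmod (?S N w))\<^sup>2)) \<longlonglongrightarrow> expectation (\<lambda>w. (cmod (\<Sum>n. of_real (\<eta> n w) * c n))\<^sup>2)"
    by (rule integral_dominated_convergence[OF _ _ w lim bound]) measurable
  then show "(\<lambda>n. (cmod (c n))\<^sup>2) sums expectation (\<lambda>w. (cmod (\<Sum>n. of_real (\<eta> n w) * c n))\<^sup>2)"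
    by (simp add: sums_def exps)
qed

end

section \<open>Window energy of the stationary scalar, mode by mode\<close>

lemma finite_bounded_modes: "finite {k::int^2. a \<le> norm (of_int_vec k) \<and> norm (of_int_vec k) \<le> b}"
proof -
  let ?I = "{- \<lceil>b\<rceil>..\<lceil>b\<rceil>}"
  have box: "k \<in> (\<lambda>(x, y). vector [x, y]) ` (?I \<times> ?I)" if "norm (of_int_vec k) \<le> b" for k :: "int^2"
  proof -
    have "k $ i \<in> ?I" for i
    proof -
      have "\<bar>of_int (k $ i)\<bar> \<le> b"
        using component_le_norm_cart[of "of_int_vec k :: real^2" i] that by (simp add: of_int_vec_def)
      then show ?thesis by simp linarith
    qed
    moreover have "k = vector [k $ 1, k $ 2]" by (simp add: vec_eq_iff forall_2)
    ultimately show ?thesis by (intro image_eqI[of _ _ "(k $ 1, k $ 2)"]) auto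
  qed
  then have "{k::int^2. a \<le> norm (of_int_vec k) \<and> norm (of_int_vec k) \<le> b} \<subseteq> (\<lambda>(x, y). vector [x, y]) ` (?I \<times> ?I)"
    by (intro subsetI box) simp
  then show ?thesis by (rule finite_subset) simp
qed

lemma L2_norm_fourier_proj:
  "(L2_norm_torus (fourier_proj a b \<phi>))\<^sup>2 = (\<Sum>k | a \<le> norm (of_int_vec k) \<and> norm (of_int_vec k) \<le> b. (cmod (fourier_coeff \<phi> k))\<^sup>2)"
  unfolding L2_norm_torus_def fourier_proj_def parseval_finite[OF finite_bounded_modes]
  by (simp add: sum_nonneg)

locale stationary_setting = volume_preserving_diffeo f + normalized_noise M \<eta>
  for f and M :: "'w measure" and \<eta> +
  fixes \<kappa> :: real and k0 :: "int^2"
  assumes \<kappa>: "\<kappa> > 0" and k0: "k0 \<noteq> 0"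
begin

abbreviation c :: "nat \<Rightarrow> int^2 \<Rightarrow> complex" where
  "c n \<equiv> scalar_coeff f \<kappa> k0 n"

lemmas c_summable = scalar_coeff_abs_summable[OF \<kappa>, of k0]

text \<open>One heat step turns \<open>\<ell>\<^sup>2\<close> decay into
  \<open>\<ell>\<^sup>1\<close> decay: a singleton \<open>J\<close> bounds each coefficient before
  that step by \<open>?r ^ n\<close>, and the heat multiplier is summable. Hence the estimate at
  \<open>Suc n\<close>.\<close>

lemma summable_l1: "summable (\<lambda>n. \<Sum>\<^sub>\<infinity>k. cmod (c n k))"
proof -
  let ?r = "exp (- 4 * pi\<^sup>2 * \<kappa>)" and ?H = "\<Sum>\<^sub>\<infinity>k. heat_multiplier \<kappa> k"
  have le: "(\<Sum>\<^sub>\<infinity>k. cmod (c (Suc n) k)) \<le> ?H * ?r ^ n" for n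
  proof -
    have r2: "exp (- 8 * pi\<^sup>2 * \<kappa>) = ?r\<^sup>2"
      unfolding power2_eq_square[of "exp _"] exp_add[symmetric] by (simp add: algebra_simps)
    obtain b where b: "\<And>j. ((\<lambda>k. c n k * transfer_entry f j k) has_sum b j) UNIV"
      "\<And>j. c (Suc n) j = of_real (heat_multiplier \<kappa> j) * b j"
      using scalar_coeff_step[OF \<kappa>] by metis
    have bb: "cmod (b j) \<le> ?r ^ n" for j
    proof -
      have "(\<Sum>i\<in>{j}. (1 * cmod (b i))\<^sup>2) \<le> exp (- 8 * pi\<^sup>2 * \<kappa>) ^ n"
      proof (rule weighted_l2_has_sum[OF _ b(1)])
        fix K :: "(int^2) set" assume K: "finite K"
        have "(\<Sum>i\<in>{j}. (1 * cmod (\<Sum>k\<in>K. transfer_entry f i k * c n k))\<^sup>2) \<le> (\<Sum>k\<in>K. (cmod (c n k))\<^sup>2)"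
          using transfer_entry_contraction[of "{j}" K "c n"] K by simp
        also have "\<dots> \<le> exp (- 8 * pi\<^sup>2 * \<kappa>) ^ n"
          by (rule scalar_coeff_l2_decay[OF \<kappa> k0 K])
        finally show "(\<Sum>i\<in>{j}. (1 * cmod (\<Sum>k\<in>K. transfer_entry f i k * c n k))\<^sup>2) \<le> exp (- 8 * pi\<^sup>2 * \<kappa>) ^ n" .
      qed simp
      then have "(cmod (b j))\<^sup>2 \<le> (?r ^ n)\<^sup>2" unfolding r2 by (simp flip: power_mult add: mult.commute)
      then show ?thesis by (rule power2_le_imp_le) simp
    qed
    have "cmod (c (Suc n) k) \<le> heat_multiplier \<kappa> k * ?r ^ n" for k
      unfolding b(2) using bb[of k] heat_multiplier_bounds(1)[of \<kappa> k] \<kappa> by (simp add: norm_mult mult_left_mono)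
    then have "(\<Sum>\<^sub>\<infinity>k. cmod (c (Suc n) k)) \<le> (\<Sum>\<^sub>\<infinity>k. heat_multiplier \<kappa> k * ?r ^ n)"
      by (intro infsum_mono c_summable summable_on_cmult_left heat_multiplier_summable \<kappa>) auto
    also have "\<dots> = ?H * ?r ^ n" by (rule infsum_cmult_left) (use heat_multiplier_summable \<kappa> in auto)
    finally show ?thesis .
  qed
  have "summable (\<lambda>n. ?H * ?r ^ n)" using \<kappa> by (intro summable_mult summable_geometric) auto
  then have "summable (\<lambda>n. \<Sum>\<^sub>\<infinity>k. cmod (c (Suc n) k))"
    by (rule summable_comparison_test'[where N=0]) (use le in \<open>simp add: infsum_nonneg\<close>)
  then show ?thesis unfolding summable_Suc_iff[of "\<lambda>n. \<Sum>\<^sub>\<infinity>k. cmod (c n k)"] .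
qed

lemma cmod_c_le: "cmod (c n k) \<le> (\<Sum>\<^sub>\<infinity>k. cmod (c n k))"
proof -
  have "sum (\<lambda>k. cmod (c n k)) {k} \<le> (\<Sum>\<^sub>\<infinity>k. cmod (c n k))"
    by (rule finite_sum_le_infsum) (use c_summable in auto)
  then show ?thesis by simp
qed

lemma summable_c: "summable (\<lambda>n. cmod (c n k))"
  using summable_l1 by (rule summable_comparison_test'[where N=0]) (use cmod_c_le in simp)

abbreviation g :: "'w \<Rightarrow> torus \<Rightarrow> complex" where
  "g \<equiv> stationary_scalar f \<kappa> (fourier_mode k0) \<eta>"

lemma g_eq: "g w x = (\<Sum>n. of_real (\<eta> n w) * fourier_series (c n) x)"
  by (simp add: stationary_scalar_def diffusive_iterate)

text \<open>The series of \<open>\<ell>\<^sup>1\<close> norms dominates uniformly in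
  \<open>x\<close> and \<open>k\<close>, so one null set serves all frequencies and sum and integral
  may be exchanged.\<close>

lemma AE_fourier_coeff_g:
  "AE w in M. \<forall>k. fourier_coeff (g w) k = (\<Sum>n. of_real (\<eta> n w) * c n k)"
  using AE_summable_noise[OF summable_l1 infsum_nonneg[OF norm_ge_zero]]
proof eventually_elim
  case (elim w)
  show ?case
  proof
    fix k
    let ?f = "\<lambda>n x. of_real (\<eta> n w) * fourier_series (c n) x * cnj (fourier_mode k x)"
    let ?B = "\<lambda>n. (\<Sum>\<^sub>\<infinity>k. cmod (c n k)) * \<bar>\<eta> n w\<bar>"
    note [measurable] = measurable_fourier_series[OF c_summable]
    have fb: "norm (?f n x) \<le> ?B n" for n x
      using mult_right_mono[OF cmod_fourier_series_le[OF c_summable, of n x] abs_ge_zero[of "\<eta> n w"]]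
      by (simp add: norm_mult mult.commute)
    have "g w x * cnj (fourier_mode k x) = (\<Sum>n. ?f n x)" for x
    proof -
      have "summable (\<lambda>n. norm (of_real (\<eta> n w) * fourier_series (c n) x))"
        using elim by (rule summable_comparison_test'[where N=0])
          (use fb in \<open>simp add: norm_mult\<close>)
      then have "summable (\<lambda>n. of_real (\<eta> n w) * fourier_series (c n) x)" by (rule summable_norm_cancel)
      then show ?thesis unfolding g_eq by (rule suminf_mult2)
    qed
    then have "fourier_coeff (g w) k = (\<integral>x. (\<Sum>n. ?f n x) \<partial>haar_torus)"
      by (simp add: fourier_coeff_def)
    also have "\<dots> = (\<Sum>n. \<integral>x. ?f n x \<partial>haar_torus)"
    proof (rule integral_suminf)
      show "integrable haar_torus (?f n)" for n
        by (rule integrable_haar_bounded[OF _ fb]) measurable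
      show "AE x in haar_torus. summable (\<lambda>n. norm (?f n x))"
        by (rule AE_I2, rule summable_comparison_test'[OF elim, where N=0]) (use fb in simp)
      show "summable (\<lambda>n. \<integral>x. norm (?f n x) \<partial>haar_torus)"
      proof (rule summable_comparison_test'[OF elim, where N=0])
        fix n :: nat
        have B0: "0 \<le> ?B n" by (intro mult_nonneg_nonneg infsum_nonneg) auto
        show "norm (\<integral>x. norm (?f n x) \<partial>haar_torus) \<le> ?B n"
          by (rule norm_integral_haar_le[OF _ B0]) (use fb in simp)
      qed
    qed
    also have "(\<lambda>n. \<integral>x. ?f n x \<partial>haar_torus) = (\<lambda>n. of_real (\<eta> n w) * c n k)"
    proof
      fix n
      have "(\<integral>x. ?f n x \<partial>haar_torus) = of_real (\<eta> n w) * fourier_coeff (fourier_series (c n)) k"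
        unfolding fourier_coeff_def by (simp add: mult.assoc)
      then show "(\<integral>x. ?f n x \<partial>haar_torus) = of_real (\<eta> n w) * c n k"
        by (simp only: fourier_coeff_fourier_series[OF c_summable])
    qed
    finally show "fourier_coeff (g w) k = (\<Sum>n. of_real (\<eta> n w) * c n k)" .
  qed
qed

lemma measurable_fourier_coeff_g: "(\<lambda>w. fourier_coeff (g w) k) \<in> borel_measurable M"
  unfolding fourier_coeff_def g_eq
proof (rule haar.borel_measurable_lebesgue_integral)
  note [measurable] = measurable_fourier_series[OF c_summable]
  show "(\<lambda>(w, x). (\<Sum>n. of_real (\<eta> n w) * fourier_series (c n) x) * cnj (fourier_mode k x)) \<in> borel_measurable (M \<Otimes>\<^sub>M haar_torus)"
    by measurable
qed

text \<open>The window holds finitely many modes, so the second-moment identity applies to each of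
  them. The series for the coefficients holds only almost surely, hence the separate measurability
  of \<open>energy\<close>.\<close>

lemma expected_energy:
  fixes a b :: real
  defines "R \<equiv> {k::int^2. a \<le> norm (of_int_vec k) \<and> norm (of_int_vec k) \<le> b}"
  defines "energy \<equiv> \<lambda>w. (L2_norm_torus (fourier_proj a b (g w)))\<^sup>2"
  shows "integrable M energy" "(\<lambda>n. \<Sum>k\<in>R. (cmod (c n k))\<^sup>2) sums expectation energy"
proof -
  let ?s = "\<lambda>k w. (cmod (\<Sum>n. of_real (\<eta> n w) * c n k))\<^sup>2"
  note [measurable] = measurable_fourier_coeff_g
  have e: "energy = (\<lambda>w. \<Sum>k\<in>R. (cmod (fourier_coeff (g w) k))\<^sup>2)"
    unfolding energy_def L2_norm_fourier_proj R_def ..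
  have m: "energy \<in> borel_measurable M" unfolding e by measurable
  have ae: "AE w in M. (\<Sum>k\<in>R. ?s k w) = energy w"
    using AE_fourier_coeff_g by eventually_elim (simp add: e)
  have int: "integrable M (\<lambda>w. \<Sum>k\<in>R. ?s k w)"
    by (intro Bochner_Integration.integrable_sum random_series_second_moment(1) summable_c)
  then show "integrable M energy"
    using m ae by (rule integrable_cong_AE_imp)
  have "expectation energy = expectation (\<lambda>w. \<Sum>k\<in>R. ?s k w)"
    using ae m int by (intro integral_cong_AE) auto
  also have "\<dots> = (\<Sum>k\<in>R. expectation (?s k))"
    by (intro Bochner_Integration.integral_sum random_series_second_moment(1) summable_c)
  finally have "expectation energy = (\<Sum>k\<in>R. expectation (?s k))" .
  moreover have "(\<lambda>n. \<Sum>k\<in>R. (cmod (c n k))\<^sup>2) sums (\<Sum>k\<in>R. expectation (?s k))"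
    by (intro sums_sum random_series_second_moment(2) summable_c)
  ultimately show "(\<lambda>n. \<Sum>k\<in>R. (cmod (c n k))\<^sup>2) sums expectation energy" by simp
qed

end


section \<open>Counting modes in a spectral window\<close>

lemma sum_powers_le:
  fixes z :: real
  assumes "z > 1"
  shows "(\<Sum>m\<le>n. z ^ m) \<le> z / (z - 1) * z ^ n"
proof (induction n)
  case 0
  then show ?case using assms by (simp add: le_divide_eq)
next
  case (Suc n)
  have "(\<Sum>m\<le>Suc n. z ^ m) \<le> z / (z - 1) * z ^ n + z ^ Suc n" using Suc by simp
  also have "\<dots> = z / (z - 1) * z ^ Suc n" using assms by (simp add: field_simps)
  finally show ?case .
qed

lemma card_nats_le:
  assumes "finite T" "\<And>n. n \<in> T \<Longrightarrow> u \<le> real n \<and> real n \<le> v" "0 \<le> B" "v - u + 1 \<le> B"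
  shows "real (card T) \<le> B"
proof (cases "T = {}")
  case False
  have "T \<subseteq> {Min T..Max T}" using assms(1) by auto
  then have "card T \<le> Max T + 1 - Min T" using card_mono[of "{Min T..Max T}" T] by simp
  moreover have "Min T \<le> Max T" using assms(1) False by simp
  ultimately have "real (card T) \<le> real (Max T) + 1 - real (Min T)" by linarith
  also have "\<dots> \<le> v - u + 1"
    using assms(2)[OF Min_in[OF assms(1) False]] assms(2)[OF Max_in[OF assms(1) False]] by linarith
  finally show ?thesis using assms(4) by linarith
qed (use assms in simp)

text \<open>The window of admissible exponents may begin below 0 while the indices are natural
  numbers; \<open>u'\<close> is a nonnegative replacement for the left end.\<close>

lemma card_nats_ge:
  assumes "finite T" "\<And>n. u \<le> real n \<Longrightarrow> real n \<le> v \<Longrightarrow> n \<in> T" "u \<le> u'" "0 \<le> u'"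
  shows "v - u' - 1 \<le> real (card T)"
proof (cases "v - u' - 1 \<le> 0")
  case True
  then show ?thesis by linarith
next
  case False
  let ?I = "{nat \<lceil>u'\<rceil>..nat \<lfloor>v\<rfloor>}"
  have "?I \<subseteq> T"
  proof
    fix n assume n: "n \<in> ?I"
    then have "u' \<le> real n" "real n \<le> v" using assms False by (auto simp: nat_le_iff le_nat_iff ceiling_le_iff le_floor_iff)
    then show "n \<in> T" using assms by (intro assms(2)) auto
  qed
  then have "card ?I \<le> card T" using assms(1) by (rule card_mono[rotated])
  moreover have "v - u' - 1 \<le> real (card ?I)" using assms False by simp linarith
  ultimately show ?thesis by linarith
qed

text \<open>On the logarithmic scale the window has length \<open>log lam L\<close>, and
  \<open>log lam (x n)\<close> equals \<open>n\<close> up to bounded errors. The discrepancy in the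
  count involves neither \<open>L\<close> nor \<open>l\<close>.\<close>

lemma card_geometric_window:
  fixes x :: "nat \<Rightarrow> real"
  assumes lam: "lam > 1" and c1: "c1 > 0" and x: "\<And>n. c1 * lam ^ n \<le> x n" "\<And>n. x n \<le> c2 * lam ^ n" and L: "L > 1"
  shows "finite {n. L ^ l \<le> x n \<and> x n \<le> L ^ (l + 1)}"
    and "\<bar>real (card {n. L ^ l \<le> x n \<and> x n \<le> L ^ (l + 1)}) - ln L / ln lam\<bar> \<le> \<bar>log lam c1\<bar> + \<bar>log lam c2\<bar> + 1"
proof -
  let ?T = "{n. L ^ l \<le> x n \<and> x n \<le> L ^ (l + 1)}"
  let ?\<Lambda> = "log lam L"
  have c2: "c2 > 0" using x[of 0] c1 by simp
  have lg: "log lam (L ^ m) = real m * ?\<Lambda>" for m using L lam by (simp add: log_nat_power)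
  have lgc: "log lam (c * lam ^ n) = log lam c + real n" if "c > 0" for c n
    using that lam by (simp add: log_mult log_nat_power)
  have \<Lambda>: "?\<Lambda> > 0" using L lam by simp
  have up: "real n \<le> real (l + 1) * ?\<Lambda> - log lam c1" "real l * ?\<Lambda> - log lam c2 \<le> real n" if "n \<in> ?T" for n
  proof -
    have "c1 * lam ^ n \<le> L ^ (l + 1)" "L ^ l \<le> c2 * lam ^ n" using that x[of n] by auto
    then have "log lam (c1 * lam ^ n) \<le> log lam (L ^ (l + 1))" "log lam (L ^ l) \<le> log lam (c2 * lam ^ n)"
      using lam L c1 c2 by (simp_all only: log_le_cancel_iff zero_less_power mult_pos_pos less_trans[OF zero_less_one])
    then show "real n \<le> real (l + 1) * ?\<Lambda> - log lam c1" "real l * ?\<Lambda> - log lam c2 \<le> real n"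
      unfolding lg lgc[OF c1] lgc[OF c2] by linarith+
  qed
  show fin: "finite ?T"
  proof (rule finite_subset)
    show "?T \<subseteq> {..nat \<lceil>real (l + 1) * ?\<Lambda> - log lam c1\<rceil>}"
    proof
      fix n assume "n \<in> ?T"
      from up(1)[OF this] show "n \<in> {..nat \<lceil>real (l + 1) * ?\<Lambda> - log lam c1\<rceil>}" by simp linarith
    qed
  qed simp
  have "real (card ?T) \<le> ?\<Lambda> + (\<bar>log lam c1\<bar> + \<bar>log lam c2\<bar> + 1)"
  proof (rule card_nats_le[OF fin])
    show "real l * ?\<Lambda> - log lam c2 \<le> real n \<and> real n \<le> real (l + 1) * ?\<Lambda> - log lam c1" if "n \<in> ?T" for n
      using up[OF that] by simp
    show "0 \<le> ?\<Lambda> + (\<bar>log lam c1\<bar> + \<bar>log lam c2\<bar> + 1)" using \<Lambda> by linarith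
    show "real (l + 1) * ?\<Lambda> - log lam c1 - (real l * ?\<Lambda> - log lam c2) + 1 \<le> ?\<Lambda> + (\<bar>log lam c1\<bar> + \<bar>log lam c2\<bar> + 1)"
      by (simp add: distrib_right)
  qed
  moreover have "real (l + 1) * ?\<Lambda> - log lam c2 - (real l * ?\<Lambda> + \<bar>log lam c1\<bar>) - 1 \<le> real (card ?T)"
  proof (rule card_nats_ge[OF fin])
    fix n assume n: "real l * ?\<Lambda> - log lam c1 \<le> real n" "real n \<le> real (l + 1) * ?\<Lambda> - log lam c2"
    then have "log lam (L ^ l) \<le> log lam (c1 * lam ^ n)" "log lam (c2 * lam ^ n) \<le> log lam (L ^ (l + 1))"
      unfolding lg lgc[OF c1] lgc[OF c2] by linarith+
    then have "L ^ l \<le> c1 * lam ^ n" "c2 * lam ^ n \<le> L ^ (l + 1)"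
      using lam L c1 c2 by (simp_all only: log_le_cancel_iff zero_less_power mult_pos_pos less_trans[OF zero_less_one])
    then show "n \<in> ?T" using x[of n] by auto
  next
    show "real l * ?\<Lambda> - log lam c1 \<le> real l * ?\<Lambda> + \<bar>log lam c1\<bar>" by linarith
    show "0 \<le> real l * ?\<Lambda> + \<bar>log lam c1\<bar>" using \<Lambda> by simp
  qed
  then have "?\<Lambda> - (\<bar>log lam c1\<bar> + \<bar>log lam c2\<bar> + 1) \<le> real (card ?T)" by (simp add: distrib_right)
  ultimately show "\<bar>real (card ?T) - ln L / ln lam\<bar> \<le> \<bar>log lam c1\<bar> + \<bar>log lam c2\<bar> + 1"
    by (simp add: log_def abs_le_iff)
qed

text \<open>The deterministic core, with \<open>e n\<close> the window energy of the
  \<open>n\<close>-th iterate, \<open>x n\<close> the norm of the orbit point and \<open>d\<close>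
  the larger of \<epsilon> and \<kappa>. The sum is cut at \<open>N\<close> with
  \<open>lam ^ N\<close> about \<open>d powr (-1/2)\<close>. Up to \<open>N\<close> the comparison
  errors sum to order \<open>d * lam ^ (2 * N) \<le> 1\<close>; beyond it the decay of
  \<open>q ^ n\<close> outweighs the cost of the window; and no orbit point beyond \<open>N\<close>
  lies in the window.\<close>

lemma energy_count:
  fixes x :: "nat \<Rightarrow> real"
  assumes lam: "lam > 1" and q: "0 < q" "q < 1" and c1: "c1 > 0"
    and x: "\<And>n. c1 * lam ^ n \<le> x n" "\<And>n. x n \<le> c2 * lam ^ n"
    and B: "0 \<le> B1" "0 \<le> B2" "0 \<le> B3"
  obtains C K where "C > 0"
    "\<And>L. L > 1 \<Longrightarrow> \<exists>d0>0. \<forall>d l e T. 0 < d \<longrightarrow> d \<le> d0 \<longrightarrow> real l \<le> C / ln L * (\<bar>ln d\<bar> - 1) \<longrightarrow>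
       e sums T \<longrightarrow> (\<forall>n. 0 \<le> e n) \<longrightarrow>
       (\<forall>n. \<bar>e n - (if L ^ l \<le> x n \<and> x n \<le> L ^ (l + 1) then 1 else 0)\<bar> \<le> B1 * d * (lam\<^sup>2) ^ n) \<longrightarrow>
       (\<forall>n. e n \<le> sqrt (B2 * L ^ (l + 1)) * B3 * q ^ n) \<longrightarrow> \<bar>T - ln L / ln lam\<bar> \<le> K"
proof -
  \<comment> \<open>The rate as a power of \<open>lam\<close>: since
    \<open>q = lam powr (- s)\<close>, the tail starts with
    \<open>q ^ (N + 1) \<le> d powr (s / 2)\<close>.\<close>
  define s where "s = - ln q / ln lam"
  have s: "s > 0" using lam q by (simp add: s_def divide_neg_pos)
  have qs: "lam powr (- s) = q" using lam q by (simp add: s_def powr_def)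
  \<comment> \<open>\<open>C \<le> 1/8\<close> puts the top of the window, at most
    \<open>d powr (- 2 * C)\<close>, below \<open>d powr (-1/4)\<close>;
    \<open>C \<le> s / 2\<close> lets \<open>d powr (s / 2)\<close> beat the cost
    \<open>d powr (- C)\<close> of removing the weight.\<close>
  define C where "C = min (1/8) (s/2)"
  have C: "C > 0" "C \<le> 1/8" "C \<le> s/2" using s by (auto simp: C_def)
  define z where "z = lam\<^sup>2"
  have z: "z > 1" unfolding z_def using lam by simp
  define K where "K = B1 * (z / (z - 1)) + sqrt B2 * B3 / (1 - q) + (\<bar>log lam c1\<bar> + \<bar>log lam c2\<bar> + 1)"
  show thesis
  proof (rule that[OF C(1), of K])
    fix L :: real assume L: "L > 1"
    \<comment> \<open>\<open>L powr (- 1 / C)\<close> makes the extra factor \<open>L\<close> at the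
      top of the window at most \<open>d powr (- C)\<close>; only here does the threshold depend on
      \<open>L\<close>. \<open>(c1 / 2) ^ 4\<close> gives \<open>d powr (1/4) \<le> c1 / 2\<close>,
      the contradiction behind \<open>SN\<close>.\<close>
    define d0 where "d0 = min (1/2) (min (L powr (- 1 / C)) ((c1 / 2) ^ 4))"
    have d0: "d0 > 0" unfolding d0_def using L c1 by simp
    have main: "\<bar>T - ln L / ln lam\<bar> \<le> K"
      if d: "0 < d" "d \<le> d0" and l: "real l \<le> C / ln L * (\<bar>ln d\<bar> - 1)" and T: "e sums T"
        and e0: "\<And>n. 0 \<le> e n"
        and near: "\<And>n. \<bar>e n - (if L ^ l \<le> x n \<and> x n \<le> L ^ (l + 1) then 1 else 0)\<bar> \<le> B1 * d * z ^ n"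
        and far: "\<And>n. e n \<le> sqrt (B2 * L ^ (l + 1)) * B3 * q ^ n"
      for d l e T
    proof -
      have db: "d \<le> 1/2" "d \<le> L powr (- 1 / C)" "d \<le> (c1 / 2) ^ 4"
        using d(2) unfolding d0_def min.bounded_iff by blast+
      have lnL: "ln L > 0" using L by simp
      have lnd: "\<bar>ln d\<bar> = - ln d" using d(1) db(1) by simp
      have Ll: "L ^ l \<le> d powr (- C)"
      proof -
        have "real l * ln L \<le> C / ln L * (\<bar>ln d\<bar> - 1) * ln L" using l lnL by (intro mult_right_mono) auto
        also have "\<dots> = C * (- ln d - 1)" using lnL by (simp add: lnd)
        also have "\<dots> \<le> - C * ln d" using C(1) by (simp add: algebra_simps)
        finally have "exp (real l * ln L) \<le> exp (- C * ln d)" by simp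
        then show ?thesis using L d(1) by (simp add: powr_def exp_of_nat_mult)
      qed
      have L1: "L \<le> d powr (- C)"
      proof -
        have "(L powr (- 1 / C)) powr (- C) \<le> d powr (- C)"
          using db(2) d(1) C(1) by (intro powr_mono2') auto
        then show ?thesis using L C(1) by (simp add: powr_powr)
      qed
      have R: "L ^ (l + 1) \<le> d powr (- 2 * C)"
      proof -
        have "L ^ (l + 1) = L ^ l * L" by simp
        also have "\<dots> \<le> d powr (- C) * d powr (- C)" using Ll L1 L by (intro mult_mono) auto
        also have "\<dots> = d powr (- 2 * C)" by (simp flip: powr_add)
        finally show ?thesis .
      qed
      have d1: "1 \<le> d powr (-1/2)" using powr_mono2'[of "-1/2" d 1] d(1) db(1) by simp
      define N where "N = nat \<lfloor>log lam (d powr (-1/2))\<rfloor>"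
      have lg0: "0 \<le> log lam (d powr (-1/2))" using d1 d(1) lam by (subst zero_le_log_cancel_iff) auto
      have N1: "lam ^ N \<le> d powr (-1/2)"
      proof -
        have "lam ^ N = lam powr (real N)" using lam by (simp add: powr_realpow)
        also have "\<dots> \<le> lam powr (log lam (d powr (-1/2)))"
          using lg0 lam by (intro powr_mono) (auto simp: N_def)
        finally show ?thesis using lam d(1) by simp
      qed
      have N2: "d powr (-1/2) \<le> lam ^ (N + 1)"
      proof -
        have "d powr (-1/2) = lam powr (log lam (d powr (-1/2)))" using lam d(1) by simp
        also have "\<dots> \<le> lam powr (real (N + 1))"
        proof (rule powr_mono)
          show "log lam (d powr (-1/2)) \<le> real (N + 1)" unfolding N_def using lg0 by linarith
        qed (use lam in simp)
        finally show ?thesis using lam by (simp only: powr_realpow)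
      qed
      let ?S = "{n. L ^ l \<le> x n \<and> x n \<le> L ^ (l + 1)}"
      let ?i = "\<lambda>n. if L ^ l \<le> x n \<and> x n \<le> L ^ (l + 1) then 1 else 0 :: real"
      have SN: "?S \<subseteq> {..N}"
      proof (rule subsetI, rule ccontr)
        fix n assume n: "n \<in> ?S" "n \<notin> {..N}"
        then have "lam ^ (N + 1) \<le> lam ^ n" using lam by (intro power_increasing) auto
        then have "c1 * d powr (-1/2) \<le> c1 * lam ^ n" using N2 c1 by (intro mult_left_mono) auto
        also have "\<dots> \<le> x n" by (rule x)
        also have "\<dots> \<le> L ^ (l + 1)" using n by simp
        also have "\<dots> \<le> d powr (- 2 * C)" by (rule R)
        also have "\<dots> \<le> d powr (-1/4)" using d(1) db(1) C(2) by (intro powr_mono') auto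
        finally have "c1 * d powr (-1/2) \<le> d powr (-1/4)" .
        then have "c1 * d powr (-1/2) * d powr (1/2) \<le> d powr (-1/4) * d powr (1/2)"
          by (rule mult_right_mono) simp
        then have "c1 \<le> d powr (1/4)" using d(1) by (simp add: mult.assoc flip: powr_add)
        also have "\<dots> \<le> ((c1 / 2) ^ 4) powr (1/4)" using db(3) d(1) by (intro powr_mono2) auto
        also have "\<dots> = c1 / 2"
        proof -
          have "(c1 / 2) ^ 4 = (c1 / 2) powr 4" using c1 by (simp add: powr_numeral)
          then have "((c1 / 2) ^ 4) powr (1/4) = (c1 / 2) powr (4 * (1/4))" by (simp only: powr_powr)
          then show ?thesis using c1 by simp
        qed
        finally show False using c1 by simp
      qed
      have cardS: "real (card ?S) = (\<Sum>n\<le>N. ?i n)"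
      proof -
        have "(\<Sum>n\<le>N. ?i n) = real (card {n \<in> {..N}. L ^ l \<le> x n \<and> x n \<le> L ^ (l + 1)})"
          by (simp add: sum.If_cases Int_def)
        also have "{n \<in> {..N}. L ^ l \<le> x n \<and> x n \<le> L ^ (l + 1)} = ?S" using SN by auto
        finally show ?thesis by simp
      qed
      have head: "\<bar>(\<Sum>n\<le>N. e n) - real (card ?S)\<bar> \<le> B1 * (z / (z - 1))"
      proof -
        have "\<bar>(\<Sum>n\<le>N. e n) - real (card ?S)\<bar> = \<bar>\<Sum>n\<le>N. e n - ?i n\<bar>"
          unfolding cardS by (simp add: sum_subtractf)
        also have "\<dots> \<le> (\<Sum>n\<le>N. \<bar>e n - ?i n\<bar>)" by (rule sum_abs)
        also have "\<dots> \<le> (\<Sum>n\<le>N. B1 * d * z ^ n)" by (intro sum_mono near)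
        also have "\<dots> = B1 * d * (\<Sum>n\<le>N. z ^ n)" by (simp add: sum_distrib_left)
        also have "\<dots> \<le> B1 * d * (z / (z - 1) * z ^ N)"
          using B d by (intro mult_left_mono sum_powers_le z) auto
        also have "\<dots> = B1 * (z / (z - 1)) * (d * z ^ N)" by simp
        also have "\<dots> \<le> B1 * (z / (z - 1)) * 1"
        proof (rule mult_left_mono)
          have "z ^ N = (lam ^ N)\<^sup>2" by (simp only: z_def power_mult[symmetric] mult.commute[of 2 N])
          also have "\<dots> \<le> (d powr (-1/2))\<^sup>2" using N1 lam by (intro power_mono) auto
          also have "\<dots> = d powr (-1)" by (simp only: power2_eq_square powr_add[symmetric]) simp
          also have "\<dots> = 1 / d" using d(1) by (simp add: powr_minus divide_inverse)
          finally show "d * z ^ N \<le> 1" using d(1) by (simp add: field_simps)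
          show "0 \<le> B1 * (z / (z - 1))" using B z by simp
        qed
        finally show ?thesis by simp
      qed
      have sume: "summable e" using T by (rule sums_summable)
      have Tsplit: "T = (\<Sum>n\<le>N. e n) + (\<Sum>n. e (n + (N + 1)))"
        using suminf_split_initial_segment[OF sume, of "N + 1"] sums_unique[OF T] by (simp add: lessThan_Suc_atMost)
      have tail: "0 \<le> (\<Sum>n. e (n + (N + 1)))" "(\<Sum>n. e (n + (N + 1))) \<le> sqrt B2 * B3 / (1 - q)"
      proof -
        have st: "summable (\<lambda>n. e (n + (N + 1)))" using sume by (rule summable_ignore_initial_segment)
        show "0 \<le> (\<Sum>n. e (n + (N + 1)))" using st e0 by (intro suminf_nonneg)
        have qN: "q ^ (N + 1) \<le> d powr (s / 2)"
        proof -
          have "q ^ (N + 1) = (lam ^ (N + 1)) powr (- s)"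
          proof -
            have "q ^ (N + 1) = (lam powr (- s)) powr real (N + 1)"
              unfolding qs by (rule powr_realpow[OF q(1), symmetric])
            also have "\<dots> = (lam powr real (N + 1)) powr (- s)"
              by (simp only: powr_powr mult.commute)
            also have "lam powr real (N + 1) = lam ^ (N + 1)"
              using lam by (intro powr_realpow) simp
            finally show ?thesis .
          qed
          also have "\<dots> \<le> (d powr (-1/2)) powr (- s)"
            using N2 s d(1) by (intro powr_mono2') auto
          also have "\<dots> = d powr (s / 2)" by (simp add: powr_powr)
          finally show ?thesis .
        qed
        have pre: "sqrt (B2 * L ^ (l + 1)) * B3 * q ^ (N + 1) \<le> sqrt B2 * B3"
        proof -
          have "sqrt (L ^ (l + 1)) \<le> sqrt (d powr (- 2 * C))" using R by (rule real_sqrt_le_mono)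
          also have "\<dots> = d powr (- C)" by (simp add: powr_half_sqrt[symmetric] powr_powr)
          finally have "sqrt (L ^ (l + 1)) * q ^ (N + 1) \<le> d powr (- C) * d powr (s / 2)"
            using qN q by (intro mult_mono) auto
          also have "\<dots> = d powr (s / 2 - C)" by (simp flip: powr_add)
          also have "\<dots> \<le> 1"
            using powr_mono2[of "s / 2 - C" d 1] C(3) d(1) db(1) by simp
          finally have "sqrt (L ^ (l + 1)) * q ^ (N + 1) \<le> 1" .
          from mult_left_mono[OF this, of "sqrt B2 * B3"] show ?thesis
            using B by (simp add: real_sqrt_mult mult_ac)
        qed
        have "e (n + (N + 1)) \<le> sqrt B2 * B3 * q ^ n" for n
        proof -
          have "e (n + (N + 1)) \<le> sqrt (B2 * L ^ (l + 1)) * B3 * q ^ (N + 1) * q ^ n"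
            using far[of "n + (N + 1)"] by (simp add: power_add mult_ac)
          also have "\<dots> \<le> sqrt B2 * B3 * q ^ n" using pre q by (intro mult_right_mono) auto
          finally show ?thesis .
        qed
        moreover have geo: "(\<lambda>n. sqrt B2 * B3 * q ^ n) sums (sqrt B2 * B3 * (1 / (1 - q)))"
          using q by (intro sums_mult geometric_sums) auto
        ultimately have "(\<Sum>n. e (n + (N + 1))) \<le> (\<Sum>n. sqrt B2 * B3 * q ^ n)"
          using st sums_summable[OF geo] by (intro suminf_le) auto
        also have "\<dots> = sqrt B2 * B3 / (1 - q)" using sums_unique[OF geo] by simp
        finally show "(\<Sum>n. e (n + (N + 1))) \<le> sqrt B2 * B3 / (1 - q)" .
      qed
      show ?thesis
        using card_geometric_window(2)[OF lam c1 x L, of l] head tail unfolding Tsplit K_def by linarith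
    qed
    show "\<exists>d0>0. \<forall>d l e T. 0 < d \<longrightarrow> d \<le> d0 \<longrightarrow> real l \<le> C / ln L * (\<bar>ln d\<bar> - 1) \<longrightarrow>
       e sums T \<longrightarrow> (\<forall>n. 0 \<le> e n) \<longrightarrow>
       (\<forall>n. \<bar>e n - (if L ^ l \<le> x n \<and> x n \<le> L ^ (l + 1) then 1 else 0)\<bar> \<le> B1 * d * (lam\<^sup>2) ^ n) \<longrightarrow>
       (\<forall>n. e n \<le> sqrt (B2 * L ^ (l + 1)) * B3 * q ^ n) \<longrightarrow> \<bar>T - ln L / ln lam\<bar> \<le> K"
      using main d0 unfolding z_def by blast
  qed
qed

text \<open>Both norms are at most 1, so the difference of their squares costs only the factor
  \<open>?u + ?v \<le> 2\<close>.\<close>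

lemma L2_set_sq_diff_le:
  fixes a b :: "'i \<Rightarrow> complex"
  assumes "L2_set (\<lambda>k. cmod (a k)) R \<le> 1" "L2_set (\<lambda>k. cmod (b k)) R \<le> 1" "L2_set (\<lambda>k. cmod (a k - b k)) R \<le> E"
  shows "\<bar>(\<Sum>k\<in>R. (cmod (a k))\<^sup>2) - (\<Sum>k\<in>R. (cmod (b k))\<^sup>2)\<bar> \<le> 2 * E"
proof -
  let ?u = "L2_set (\<lambda>k. cmod (a k)) R" and ?v = "L2_set (\<lambda>k. cmod (b k)) R"
  have sq: "(\<Sum>k\<in>R. (cmod (w k))\<^sup>2) = (L2_set (\<lambda>k. cmod (w k)) R)\<^sup>2" for w :: "'i \<Rightarrow> complex"
    by (simp add: L2_set_def sum_nonneg)
  have "?u \<le> L2_set (\<lambda>k. cmod (a k - b k) + cmod (b k)) R"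
  proof (rule L2_set_mono)
    show "cmod (a k) \<le> cmod (a k - b k) + cmod (b k)" for k
      using norm_triangle_ineq[of "a k - b k" "b k"] by simp
  qed simp
  also have "\<dots> \<le> L2_set (\<lambda>k. cmod (a k - b k)) R + ?v" by (rule L2_set_triangle_ineq)
  finally have 1: "?u - ?v \<le> E" using assms(3) by linarith
  have "?v \<le> L2_set (\<lambda>k. cmod (a k - b k) + cmod (a k)) R"
  proof (rule L2_set_mono)
    show "cmod (b k) \<le> cmod (a k - b k) + cmod (a k)" for k
      using norm_triangle_ineq[of "b k - a k" "a k"] by (simp add: norm_minus_commute)
  qed simp
  also have "\<dots> \<le> L2_set (\<lambda>k. cmod (a k - b k)) R + ?u" by (rule L2_set_triangle_ineq)
  finally have 2: "\<bar>?u - ?v\<bar> \<le> E" using 1 assms(3) by linarith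
  have nn: "0 \<le> ?u" "0 \<le> ?v" by (rule L2_set_nonneg)+
  have "\<bar>?u\<^sup>2 - ?v\<^sup>2\<bar> = \<bar>?u - ?v\<bar> * (?u + ?v)"
    using nn by (simp add: power2_eq_square square_diff_square_factored abs_mult)
  also have "\<dots> \<le> E * 2" using 2 nn assms by (intro mult_mono) auto
  finally show ?thesis by (simp add: sq)
qed

text \<open>The thresholds come after \<open>L\<close> because the window ends at
  \<open>L ^ (l + 1)\<close>, which must stay below a power of
  \<open>1 / max \<epsilon> \<kappa>\<close> even for \<open>l = 0\<close>.\<close>

theorem theorem4p2:
  fixes A :: "int^2^2" and lam :: real and k\<^sub>0 :: "int^2"
    and M :: "'w measure" and \<eta> :: "nat \<Rightarrow> 'w \<Rightarrow> real"
  assumes det: "det A = 1 \<or> det A = -1"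
    and hyperbolic: "\<And>\<mu>. matrix_eigenvalue (map_matrix of_int A) \<mu> \<Longrightarrow> cmod \<mu> \<noteq> 1"
    and lambda: "lam > 1"
    and eigenvalues: "cmod ` {\<mu>. matrix_eigenvalue (map_matrix of_int A) \<mu>} = {lam, inverse lam}"
    and k0: "k\<^sub>0 \<noteq> 0"
    and noise: "normalized_iid M \<eta>"
  shows "\<exists>C > 0. \<exists>C' \<ge> 1. \<exists>K. \<forall>L > 1. \<exists>\<epsilon>\<^sub>0 > 0. \<exists>\<kappa>\<^sub>0 > 0.
    \<forall>\<epsilon> \<kappa> :: real. \<forall>f :: torus \<Rightarrow> torus. \<forall>l :: nat.
      0 < \<epsilon> \<longrightarrow> \<epsilon> \<le> \<epsilon>\<^sub>0 \<longrightarrow> 0 < \<kappa> \<longrightarrow> \<kappa> \<le> \<kappa>\<^sub>0 \<longrightarrow>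
      smooth_torus_diffeo f \<longrightarrow> volume_preserving f \<longrightarrow>
      dist_Cinfinity f (torus_map_of_matrix A) \<le> \<epsilon> \<longrightarrow>
      real l \<le> ell_crit C C' L \<epsilon> \<kappa> \<longrightarrow>
      (let energy = (\<lambda>\<omega>. (L2_norm_torus (fourier_proj (L ^ l) (L ^ (l + 1))
                        (stationary_scalar f \<kappa> (fourier_mode k\<^sub>0) \<eta> \<omega>)))\<^sup>2)
       in integrable M energy \<and>
          \<bar>prob_space.expectation M energy - ln L / ln lam\<bar> \<le> K)"
proof -
  obtain X Y V where XY: "\<And>j. X (transpose A *v j) = lam * X j" "\<And>j. Y (transpose A *v j) = Y j / lam"
    "\<And>j. 0 \<le> X j" "\<And>j. 0 \<le> Y j"
    "\<And>a b. X a - X b \<le> V * norm (of_int_vec (a - b))" "\<And>a b. Y a - Y b \<le> V * norm (of_int_vec (a - b))"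
    "\<And>j. X j \<le> V * norm (of_int_vec j)" "\<And>j. Y j \<le> V * norm (of_int_vec j)"
    "\<And>j. lam * norm (of_int_vec j) \<le> max (X j) (Y j)"
    by (rule hyperbolic_forms_exist[OF lambda eigenvalues]) (rule that)
  interpret hf: hyperbolic_forms A lam X Y V
    by (rule hyperbolic_forms.intro) (fact lambda XY)+
  obtain \<epsilon>1 q where \<epsilon>1: "0 < \<epsilon>1" "\<epsilon>1 \<le> 1 / 32" and q: "0 < q" "q < 1"
    and contraction: "\<And>\<epsilon> f J K a. 0 \<le> \<epsilon> \<Longrightarrow> \<epsilon> \<le> \<epsilon>1 \<Longrightarrow> volume_preserving_diffeo f \<Longrightarrow>
       dist_Cinfinity f (torus_map_of_matrix A) \<le> \<epsilon> \<Longrightarrow> finite J \<Longrightarrow> finite K \<Longrightarrow> 0 \<notin> J \<Longrightarrow> 0 \<notin> K \<Longrightarrow>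
       (\<Sum>j\<in>J. (hf.\<rho> powi hf.lev j * cmod (\<Sum>k\<in>K. transfer_entry f j k * a k))\<^sup>2)
        \<le> q * (\<Sum>k\<in>K. (hf.\<rho> powi hf.lev k * cmod (a k))\<^sup>2)"
    by (rule hf.uniform_contraction) (rule that)
  obtain orb c1 c2 where orb: "orb 0 = k\<^sub>0" "\<And>n. transpose A *v orb (Suc n) = orb n" and c1: "c1 > 0"
    and orb_norm: "\<And>n. c1 * lam ^ n \<le> norm (of_int_vec (orb n))" "\<And>n. norm (of_int_vec (orb n)) \<le> c2 * lam ^ n"
    by (rule backward_orbit[OF lambda det k0 XY(1-4,7-9)]) (rule that)
  \<comment> \<open>Weighted energy of the source mode, the starting value of the weighted
    decay.\<close>
  define W where "W = (hf.\<rho> powi hf.lev k\<^sub>0)\<^sup>2"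
  define z where "z = lam\<^sup>2"
  have z: "z > 1" unfolding z_def using lambda by simp
  \<comment> \<open>\<open>64 * pi\<close> is the Lipschitz factor \<open>2 * pi\<close> times the
    32 of the uniform distance bound; \<open>4 * pi\<^sup>2\<close> comes from the heat loss. The 2
    in \<open>B1\<close> is the one from the difference of squares.\<close>
  define c3 where "c3 = 64 * pi + 4 * pi\<^sup>2"
  have c3: "c3 \<ge> 0" by (simp add: c3_def)
  define B1 where "B1 = 2 * (c3 * c2\<^sup>2 * (z / (z - 1)))"
  have B: "0 \<le> B1" "0 \<le> V" "0 \<le> W"
    using c3 z hf.V lambda by (auto simp: B1_def W_def)
  obtain C K where C: "C > 0" and count: "\<And>L. L > 1 \<Longrightarrow> \<exists>d0>0. \<forall>d l e T. 0 < d \<longrightarrow> d \<le> d0 \<longrightarrow> real l \<le> C / ln L * (\<bar>ln d\<bar> - 1) \<longrightarrow>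
       e sums T \<longrightarrow> (\<forall>n. 0 \<le> e n) \<longrightarrow>
       (\<forall>n. \<bar>e n - (if L ^ l \<le> norm (of_int_vec (orb n)) \<and> norm (of_int_vec (orb n)) \<le> L ^ (l + 1) then 1 else 0)\<bar> \<le> B1 * d * (lam\<^sup>2) ^ n) \<longrightarrow>
       (\<forall>n. e n \<le> sqrt (V * L ^ (l + 1)) * W * q ^ n) \<longrightarrow> \<bar>T - ln L / ln lam\<bar> \<le> K"
    by (rule energy_count[OF lambda q c1 orb_norm B]) (rule that)
  let ?E = "\<lambda>L l f \<kappa> \<omega>. (L2_norm_torus (fourier_proj (L ^ l) (L ^ (l + 1))
    (stationary_scalar f \<kappa> (fourier_mode k\<^sub>0) \<eta> \<omega>)))\<^sup>2"
  have main: "\<exists>\<epsilon>\<^sub>0>0. \<forall>\<epsilon> \<kappa> f l. 0 < \<epsilon> \<longrightarrow> \<epsilon> \<le> \<epsilon>\<^sub>0 \<longrightarrow> 0 < \<kappa> \<longrightarrow> \<kappa> \<le> \<epsilon>\<^sub>0 \<longrightarrow>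
      smooth_torus_diffeo f \<longrightarrow> volume_preserving f \<longrightarrow>
      dist_Cinfinity f (torus_map_of_matrix A) \<le> \<epsilon> \<longrightarrow>
      real l \<le> ell_crit C 1 L \<epsilon> \<kappa> \<longrightarrow>
      integrable M (?E L l f \<kappa>) \<and>
      \<bar>prob_space.expectation M (?E L l f \<kappa>) - ln L / ln lam\<bar> \<le> K"
    if L: "L > 1" for L
  proof -
    obtain d0 where d0: "d0 > 0" and cnt: "\<And>d l e T. 0 < d \<Longrightarrow> d \<le> d0 \<Longrightarrow> real l \<le> C / ln L * (\<bar>ln d\<bar> - 1) \<Longrightarrow>
       e sums T \<Longrightarrow> (\<forall>n. 0 \<le> e n) \<Longrightarrow>
       (\<forall>n. \<bar>e n - (if L ^ l \<le> norm (of_int_vec (orb n)) \<and> norm (of_int_vec (orb n)) \<le> L ^ (l + 1) then 1 else 0)\<bar> \<le> B1 * d * (lam\<^sup>2) ^ n) \<Longrightarrow>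
       (\<forall>n. e n \<le> sqrt (V * L ^ (l + 1)) * W * q ^ n) \<Longrightarrow> \<bar>T - ln L / ln lam\<bar> \<le> K"
      using count[OF L] by metis
    show ?thesis
    proof (intro exI[of _ "min d0 \<epsilon>1"] conjI allI impI)
      show "min d0 \<epsilon>1 > 0" using d0 \<epsilon>1 by simp
      fix \<epsilon> \<kappa> :: real and f :: "torus \<Rightarrow> torus" and l :: nat
      assume \<epsilon>: "0 < \<epsilon>" "\<epsilon> \<le> min d0 \<epsilon>1" and \<kappa>: "0 < \<kappa>" "\<kappa> \<le> min d0 \<epsilon>1"
        and f: "smooth_torus_diffeo f" "volume_preserving f"
        and dist: "dist_Cinfinity f (torus_map_of_matrix A) \<le> \<epsilon>" and l: "real l \<le> ell_crit C 1 L \<epsilon> \<kappa>"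
      have vpd: "volume_preserving_diffeo f" using f by (rule volume_preserving_diffeo.intro)
      interpret st: stationary_setting f M \<eta> \<kappa> "k\<^sub>0"
        by (intro stationary_setting.intro vpd normalized_noise.intro noise stationary_setting_axioms.intro \<kappa>(1) k0)
      let ?c = "scalar_coeff f \<kappa> k\<^sub>0"
      let ?R = "{k::int^2. L ^ l \<le> norm (of_int_vec k) \<and> norm (of_int_vec k) \<le> L ^ (l + 1)}"
      let ?d = "max \<epsilon> \<kappa>"
      let ?e = "\<lambda>n. \<Sum>k\<in>?R. (cmod (?c n k))\<^sup>2"
      note energy = st.expected_energy[of "L ^ l" "L ^ (l + 1)"]
      show "integrable M (?E L l f \<kappa>)"
        by (rule energy(1))
      have R: "finite ?R" "0 \<notin> ?R"
        using finite_bounded_modes L by (auto simp: of_int_vec_0 not_le)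
      have eL: "\<epsilon> \<le> 1 / 32" "\<epsilon> \<le> \<epsilon>1" using \<epsilon> \<epsilon>1 by linarith+
      have close: "dist (f x) (torus_map_of_matrix A x) \<le> 32 * \<epsilon>" for x
      proof -
        have "smooth_torus_map f" using f by (simp add: smooth_torus_diffeo_def)
        then show ?thesis by (rule near_matrix_lift[OF _ dist eL(1)])
      qed
      \<comment> \<open>The weighted decay is used with \<open>h = 1\<close>. Removing the weight on
        the window costs its inverse square, at most \<open>sqrt (V * L ^ (l + 1))\<close> because
        the fourth power of the inverse weight is at most linear in the frequency.\<close>
      have far: "?e n \<le> sqrt (V * L ^ (l + 1)) * W * q ^ n" for n
      proof -
        have dec: "(\<Sum>k\<in>?R. (hf.\<rho> powi hf.lev k * cmod (?c n k))\<^sup>2) \<le> (1\<^sup>2 * q) ^ n * (hf.\<rho> powi hf.lev k\<^sub>0)\<^sup>2"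
        proof (rule st.scalar_coeff_weighted_decay[OF \<kappa>(1) k0])
          show "0 \<le> hf.\<rho> powi hf.lev j" for j using hf.\<rho> by simp
          show "heat_multiplier \<kappa> j \<le> 1" for j using heat_multiplier_bounds(2)[of \<kappa>] \<kappa> by simp
        qed (use q R contraction[OF _ eL(2) vpd dist] \<epsilon> in auto)
        have mode_le: "(cmod (?c n k))\<^sup>2 \<le> sqrt (V * L ^ (l + 1)) * (hf.\<rho> powi hf.lev k * cmod (?c n k))\<^sup>2" if "k \<in> ?R" for k
        proof -
          have k0: "k \<noteq> 0" using that R(2) by blast
          have "((hf.\<rho> powi (- hf.lev k))\<^sup>2)\<^sup>2 \<le> V * norm (of_int_vec k)"
            using hf.\<rho>_lev_le(2)[OF k0] by (simp flip: power_mult)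
          also have "\<dots> \<le> V * L ^ (l + 1)" using that B by (intro mult_left_mono) auto
          finally have s: "(hf.\<rho> powi (- hf.lev k))\<^sup>2 \<le> sqrt (V * L ^ (l + 1))" by (rule real_le_rsqrt)
          have "hf.\<rho> powi (- hf.lev k) * hf.\<rho> powi (hf.lev k) = 1"
            using hf.\<rho> by (simp add: power_int_minus)
          then have "(cmod (?c n k))\<^sup>2 = (hf.\<rho> powi (- hf.lev k) * (hf.\<rho> powi hf.lev k * cmod (?c n k)))\<^sup>2"
            by (simp only: mult.assoc[symmetric] mult_1)
          also have "\<dots> = (hf.\<rho> powi (- hf.lev k))\<^sup>2 * (hf.\<rho> powi hf.lev k * cmod (?c n k))\<^sup>2"
            by (rule power_mult_distrib)
          also have "\<dots> \<le> sqrt (V * L ^ (l + 1)) * (hf.\<rho> powi hf.lev k * cmod (?c n k))\<^sup>2"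
            using s by (intro mult_right_mono) auto
          finally show ?thesis .
        qed
        have "?e n \<le> (\<Sum>k\<in>?R. sqrt (V * L ^ (l + 1)) * (hf.\<rho> powi hf.lev k * cmod (?c n k))\<^sup>2)"
          by (intro sum_mono mode_le)
        also have "\<dots> \<le> sqrt (V * L ^ (l + 1)) * (q ^ n * W)"
          unfolding sum_distrib_left[symmetric] using dec B L by (intro mult_left_mono) (auto simp: W_def)
        finally show ?thesis by (simp add: mult_ac)
      qed
      have near: "\<bar>?e n - (if L ^ l \<le> norm (of_int_vec (orb n)) \<and> norm (of_int_vec (orb n)) \<le> L ^ (l + 1) then 1 else 0)\<bar>
          \<le> B1 * ?d * (lam\<^sup>2) ^ n" for n
      proof -
        let ?\<delta> = "\<lambda>k. if k = orb n then 1 else 0 :: complex"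
        let ?err = "c3 * c2\<^sup>2 * (z / (z - 1)) * ?d * z ^ n"
        have \<delta>sum: "(\<Sum>k\<in>?R. (cmod (?\<delta> k))\<^sup>2) = (if L ^ l \<le> norm (of_int_vec (orb n)) \<and> norm (of_int_vec (orb n)) \<le> L ^ (l + 1) then 1 else 0)"
        proof -
          have "(\<Sum>k\<in>?R. (cmod (?\<delta> k))\<^sup>2) = (\<Sum>k\<in>?R. if k = orb n then 1 else 0)"
            by (intro sum.cong) auto
          then show ?thesis using R(1) by simp
        qed
        have "L2_set (\<lambda>k. cmod (?c n k)) ?R \<le> 1"
        proof -
          have "?e n \<le> exp (- 8 * pi\<^sup>2 * \<kappa>) ^ n" by (rule st.scalar_coeff_l2_decay[OF \<kappa>(1) k0 R(1)])
          also have "\<dots> \<le> 1" using \<kappa> by (intro power_le_one) auto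
          finally show ?thesis unfolding L2_set_def by simp
        qed
        moreover have "L2_set (\<lambda>k. cmod (?\<delta> k)) ?R \<le> 1"
          unfolding L2_set_def \<delta>sum by simp
        moreover have "L2_set (\<lambda>k. cmod (?c n k - ?\<delta> k)) ?R \<le> ?err"
        proof -
          have "L2_set (\<lambda>k. cmod (?c n k - ?\<delta> k)) ?R
             \<le> (\<Sum>m=1..n. 2 * pi * norm (of_int_vec (orb m)) * (32 * \<epsilon>) + 4 * pi\<^sup>2 * \<kappa> * (norm (of_int_vec (orb m)))\<^sup>2)"
            by (rule st.scalar_coeff_near_orbit[OF \<kappa>(1) close orb R(1)])
          also have "\<dots> \<le> (\<Sum>m=1..n. c3 * c2\<^sup>2 * ?d * z ^ m)"
          proof (rule sum_mono)
            fix m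
            let ?x = "norm (of_int_vec (orb m))"
            have "0 < c1 * lam ^ m" using c1 lambda by simp
            then have "orb m \<noteq> 0" using orb_norm(1)[of m] by (auto simp: of_int_vec_0)
            then have x1: "1 \<le> ?x" by (rule norm_of_int_vec_ge_1)
            \<comment> \<open>Nonzero frequencies have norm at least 1, so the linear error of the
              map is absorbed in the quadratic one of the diffusion.\<close>
            have x2: "?x \<le> ?x\<^sup>2" using x1 by (simp add: power2_eq_square mult_le_cancel_left1)
            have "2 * pi * ?x * (32 * \<epsilon>) + 4 * pi\<^sup>2 * \<kappa> * ?x\<^sup>2 = 64 * pi * (\<epsilon> * ?x) + 4 * pi\<^sup>2 * (\<kappa> * ?x\<^sup>2)" by simp
            also have "\<dots> \<le> 64 * pi * (?d * ?x\<^sup>2) + 4 * pi\<^sup>2 * (?d * ?x\<^sup>2)"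
              using x2 \<epsilon>(1) \<kappa>(1) by (intro add_mono mult_left_mono mult_mono) auto
            also have "\<dots> = c3 * ?d * ?x\<^sup>2" by (simp add: c3_def algebra_simps)
            also have "\<dots> \<le> c3 * ?d * (c2 * lam ^ m)\<^sup>2"
              using c3 \<epsilon>(1) orb_norm(2)[of m] by (intro mult_left_mono power_mono) auto
            also have "\<dots> = c3 * c2\<^sup>2 * ?d * z ^ m"
            proof -
              have "(lam ^ m)\<^sup>2 = z ^ m" by (simp only: z_def power_mult[symmetric] mult.commute[of 2 m])
              then show ?thesis by (simp add: power_mult_distrib)
            qed
            finally show "2 * pi * ?x * (32 * \<epsilon>) + 4 * pi\<^sup>2 * \<kappa> * ?x\<^sup>2 \<le> c3 * c2\<^sup>2 * ?d * z ^ m" .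
          qed
          also have "\<dots> = c3 * c2\<^sup>2 * ?d * (\<Sum>m=1..n. z ^ m)" by (simp add: sum_distrib_left)
          also have "\<dots> \<le> c3 * c2\<^sup>2 * ?d * (z / (z - 1) * z ^ n)"
          proof (rule mult_left_mono)
            have "(\<Sum>m=1..n. z ^ m) \<le> (\<Sum>m\<le>n. z ^ m)" using z by (intro sum_mono2) auto
            also have "\<dots> \<le> z / (z - 1) * z ^ n" by (rule sum_powers_le[OF z])
            finally show "(\<Sum>m=1..n. z ^ m) \<le> z / (z - 1) * z ^ n" .
            show "0 \<le> c3 * c2\<^sup>2 * ?d" using c3 \<epsilon>(1) by simp
          qed
          finally show ?thesis by (simp only: mult_ac)
        qed
        ultimately have "\<bar>?e n - (\<Sum>k\<in>?R. (cmod (?\<delta> k))\<^sup>2)\<bar> \<le> 2 * ?err" by (rule L2_set_sq_diff_le)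
        then show ?thesis unfolding \<delta>sum by (simp add: B1_def z_def mult_ac)
      qed
      show "\<bar>prob_space.expectation M (?E L l f \<kappa>) - ln L / ln lam\<bar> \<le> K"
      proof (rule cnt[of ?d l ?e])
        show "0 < ?d" using \<epsilon> by simp
        show "?d \<le> d0" using \<epsilon> \<kappa> by simp
        show "real l \<le> C / ln L * (\<bar>ln ?d\<bar> - 1)" using l by (simp add: ell_crit_def)
        show "?e sums prob_space.expectation M (?E L l f \<kappa>)"
          by (rule energy(2))
        show "\<forall>n. 0 \<le> ?e n" by (simp add: sum_nonneg)
      qed (use near far in blast)+
    qed
  qed
  show ?thesis
  \<comment> \<open>\<open>C' = 1\<close> suffices: the remaining constants were absorbed in the
    smallness of \<epsilon> and \<kappa>, and one threshold serves for both.\<close>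
  proof (rule exI[of _ C], rule conjI[OF C], rule exI[of _ 1], rule conjI[OF order_refl], rule exI[of _ K], intro allI impI)
    fix L :: real assume "L > 1"
    from main[OF this] obtain e0 where "e0 > 0" and e0: "\<forall>\<epsilon> \<kappa> f l. 0 < \<epsilon> \<longrightarrow> \<epsilon> \<le> e0 \<longrightarrow> 0 < \<kappa> \<longrightarrow> \<kappa> \<le> e0 \<longrightarrow>
      smooth_torus_diffeo f \<longrightarrow> volume_preserving f \<longrightarrow>
      dist_Cinfinity f (torus_map_of_matrix A) \<le> \<epsilon> \<longrightarrow>
      real l \<le> ell_crit C 1 L \<epsilon> \<kappa> \<longrightarrow>
      integrable M (?E L l f \<kappa>) \<and>
      \<bar>prob_space.expectation M (?E L l f \<kappa>) - ln L / ln lam\<bar> \<le> K" by blast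
    show "\<exists>\<epsilon>\<^sub>0>0. \<exists>\<kappa>\<^sub>0>0. \<forall>\<epsilon> \<kappa> :: real. \<forall>f :: torus \<Rightarrow> torus. \<forall>l :: nat.
      0 < \<epsilon> \<longrightarrow> \<epsilon> \<le> \<epsilon>\<^sub>0 \<longrightarrow> 0 < \<kappa> \<longrightarrow> \<kappa> \<le> \<kappa>\<^sub>0 \<longrightarrow>
      smooth_torus_diffeo f \<longrightarrow> volume_preserving f \<longrightarrow>
      dist_Cinfinity f (torus_map_of_matrix A) \<le> \<epsilon> \<longrightarrow>
      real l \<le> ell_crit C 1 L \<epsilon> \<kappa> \<longrightarrow>
      (let energy = (\<lambda>\<omega>. (L2_norm_torus (fourier_proj (L ^ l) (L ^ (l + 1))
                        (stationary_scalar f \<kappa> (fourier_mode k\<^sub>0) \<eta> \<omega>)))\<^sup>2)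
       in integrable M energy \<and>
          \<bar>prob_space.expectation M energy - ln L / ln lam\<bar> \<le> K)"
      unfolding Let_def using e0 \<open>e0 > 0\<close> by (intro exI[of _ e0] conjI)
  qed
qed

end
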